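(* Let $b$ be a non-extreme point of $H^\infty_1$, and let $S_b:\mathcal H(b)\to\mathcal H(b)$, $S_bf=zf$, be the restriction of the forward shift to the de Branges-Rovnyak space $\mathcal H(b)$. Then $S_b^*\in B_1(\mathbb D)$, where $S_b^*$ is the adjoint of $S_b$ with respect to the inner product of $\mathcal H(b)$.
   Context: $\mathbb D=\{z\in\mathbb C:|z|<1\}$, $\mathbb T=\partial\mathbb D$, $m$ is Lebesgue measure on $\mathbb T$. $H^2$ is the Hardy space of analytic functions on $\mathbb D$ with square-summable Taylor coefficients, $H^\infty$ is the algebra of bounded analytic functions on $\mathbb D$ with the supremum norm, and $H^\infty_1=\{b\in H^\infty:\|b\|_\infty\leq 1\}$. For $b\in H^\infty_1$, $T_b:H^2\to H^2$ is multiplication by $b$ and $T_{\overline b}=T_b^*$. The de Branges-Rovnyak space is $\mathcal H(b)=(I-T_bT_{\overline b})^{1/2}H^2$ with inner product $\langle (I-T_bT_{\overline b})^{1/2}f,(I-T_bT_{\overline b})^{1/2}g\rangle_b=\langle f,g\rangle_2$ for $f,g\in H^2\ominus\ker (I-T_bT_{\overline b})^{1/2}$, where $\langle\cdot,\cdot\rangle_2$ is the inner product of $H^2$. It is a reproducing kernel Hilbert space on $\mathbb D$ with kernel $k^b_\omega(z)=\frac{1-\overline{b(\omega)}b(z)}{1-\overline\omega z}$. An extreme point of $H^\infty_1$ is an element of $H^\infty_1$ that does not lie in any open line segment connecting two distinct points of $H^\infty_1$; it is known that $b\in H^\infty_1$ is non-extreme (not an extreme point) if and only if $\int_{\mathbb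 T}\log(1-|b|^2)\,dm>-\infty$ (using radial boundary values of $b$). It is known that if $b$ is non-extreme, then the forward shift $Sf(z)=zf(z)$ maps $\mathcal H(b)$ into itself, and $S_b=S|_{\mathcal H(b)}$ is a bounded operator on $\mathcal H(b)$. For an open set $\Omega\subseteq\mathbb C$, an integer $n\geq1$ and a bounded operator $T$ on a complex separable Hilbert space $\mathcal H$, one writes $T\in B_n(\Omega)$ (Cowen-Douglas class of rank $n$) if: (i) $\dim\ker(T-\omega I)=n$ for all $\omega\in\Omega$; (ii) the closed linear span of $\bigcup_{\omega\in\Omega}\ker(T-\omega I)$ is $\mathcal H$; (iii) $\operatorname{ran}(T-\omega I)=\mathcal H$ for all $\omega\in\Omega$. *)

theory Defs
  imports
    "HOL-Complex_Analysis.Complex_Analysis"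
    "HOL-Library.Function_Algebras"
begin

section \<open>Complex Hilbert spaces of functions\<close>

text \<open>
  The type class of inner product spaces in the library is over the reals only. Complex inner
  product spaces are therefore represented by a carrier (a linear space of complex-valued functions
  under the pointwise operations) together with a sesquilinear form, linear in its first argument.
  Values of the form and of operators outside the carrier are irrelevant.
\<close>

definition cscale :: "complex \<Rightarrow> ('x \<Rightarrow> complex) \<Rightarrow> 'x \<Rightarrow> complex"
  where "cscale c f = (\<lambda>x. c * f x)"

interpretation cfun: vector_space cscale
  by unfold_locales (auto simp: cscale_def fun_eq_iff algebra_simps)

record 'x inner_space =
  vecs :: "('x \<Rightarrow> complex) set"
  ip :: "('x \<Rightarrow> complex) \<Rightarrow> ('x \<Rightarrow> complex) \<Rightarrow> complex"

type_synonym 'x operator = "('x \<Rightarrow> complex) \<Rightarrow> 'x \<Rightarrow> complex"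

definition hnorm :: "'x inner_space \<Rightarrow> ('x \<Rightarrow> complex) \<Rightarrow> real"
  where "hnorm H f = sqrt (Re (ip H f f))"

text \<open>The value 0 off the carrier serves the locale \<^locale>\<open>Metric_space\<close>, which asks for
  nonnegativity and symmetry of the distance on the whole type.\<close>

definition hdist :: "'x inner_space \<Rightarrow> ('x \<Rightarrow> complex) \<Rightarrow> ('x \<Rightarrow> complex) \<Rightarrow> real"
  where "hdist H f g = (if f \<in> vecs H \<and> g \<in> vecs H then hnorm H (f - g) else 0)"

definition htopology :: "'x inner_space \<Rightarrow> ('x \<Rightarrow> complex) topology"
  where "htopology H = Metric_space.mtopology (vecs H) (hdist H)"

definition complex_inner_space :: "'x inner_space \<Rightarrow> bool"
  where "complex_inner_space H \<longleftrightarrow>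
    cfun.subspace (vecs H) \<and>
    (\<forall>f\<in>vecs H. \<forall>g\<in>vecs H. \<forall>h\<in>vecs H. ip H (f + g) h = ip H f h + ip H g h) \<and>
    (\<forall>c. \<forall>f\<in>vecs H. \<forall>g\<in>vecs H. ip H (cscale c f) g = c * ip H f g) \<and>
    (\<forall>f\<in>vecs H. \<forall>g\<in>vecs H. ip H g f = cnj (ip H f g)) \<and>
    (\<forall>f\<in>vecs H. 0 \<le> Re (ip H f f) \<and> (ip H f f = 0 \<longrightarrow> f = 0))"

definition separable_hilbert_space :: "'x inner_space \<Rightarrow> bool"
  where "separable_hilbert_space H \<longleftrightarrow>
    complex_inner_space H \<and>
    Metric_space.mcomplete (vecs H) (hdist H) \<and>
    separable_space (htopology H)"

definition bounded_operator :: "'x inner_space \<Rightarrow> 'x operator \<Rightarrow> bool"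
  where "bounded_operator H T \<longleftrightarrow>
    T ` vecs H \<subseteq> vecs H \<and>
    (\<forall>f\<in>vecs H. \<forall>g\<in>vecs H. T (f + g) = T f + T g) \<and>
    (\<forall>c. \<forall>f\<in>vecs H. T (cscale c f) = cscale c (T f)) \<and>
    (\<exists>C. \<forall>f\<in>vecs H. hnorm H (T f) \<le> C * hnorm H f)"

definition hadjoint :: "'x inner_space \<Rightarrow> 'x operator \<Rightarrow> 'x operator"
  where "hadjoint H T g = (THE h. h \<in> vecs H \<and> (\<forall>f\<in>vecs H. ip H (T f) g = ip H f h))"

definition positive_operator :: "'x inner_space \<Rightarrow> 'x operator \<Rightarrow> bool"
  where "positive_operator H T \<longleftrightarrow>
    bounded_operator H T \<and> (\<forall>f\<in>vecs H. ip H (T f) f \<in> \<real> \<and> 0 \<le> Re (ip H (T f) f))"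

text \<open>On a Hilbert space a positive operator has exactly one positive square root, so the choice
  only affects values outside \<^term>\<open>vecs H\<close>.\<close>

definition sqrt_operator :: "'x inner_space \<Rightarrow> 'x operator \<Rightarrow> 'x operator"
  where "sqrt_operator H P =
    (SOME R. positive_operator H R \<and> (\<forall>f\<in>vecs H. R (R f) = P f))"

definition hkernel :: "'x inner_space \<Rightarrow> 'x operator \<Rightarrow> ('x \<Rightarrow> complex) set"
  where "hkernel H T = {f \<in> vecs H. T f = 0}"

definition hcomplement :: "'x inner_space \<Rightarrow> ('x \<Rightarrow> complex) set \<Rightarrow> ('x \<Rightarrow> complex) set"
  where "hcomplement H M = {f \<in> vecs H. \<forall>g\<in>M. ip H f g = 0}"


section \<open>The Cowen--Douglas class\<close>

text \<open>The dimension function of the library is 0 on infinite-dimensional spaces; as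
  \<^term>\<open>n \<ge> 1\<close>, the first spectral condition says that the kernel has finite
  dimension \<^term>\<open>n\<close>.\<close>

definition cowen_douglas :: "nat \<Rightarrow> complex set \<Rightarrow> 'x inner_space \<Rightarrow> 'x operator set"
  where "cowen_douglas n \<Omega> H = {T.
    open \<Omega> \<and> n \<ge> 1 \<and> separable_hilbert_space H \<and> bounded_operator H T \<and>
    (\<forall>\<omega>\<in>\<Omega>. cfun.dim (hkernel H (\<lambda>f. T f - cscale \<omega> f)) = n) \<and>
    htopology H closure_of cfun.span (\<Union>\<omega>\<in>\<Omega>. hkernel H (\<lambda>f. T f - cscale \<omega> f)) = vecs H \<and>
    (\<forall>\<omega>\<in>\<Omega>. (\<lambda>f. T f - cscale \<omega> f) ` vecs H = vecs H)}"


section \<open>Hardy spaces of the unit disc\<close>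

text \<open>Functions on the open unit disc are represented by their extension by zero, so that equality
  of functions on the disc is equality in the type.\<close>

definition disc_holomorphic :: "(complex \<Rightarrow> complex) set"
  where "disc_holomorphic = {f. f holomorphic_on ball 0 1 \<and> (\<forall>z. z \<notin> ball 0 1 \<longrightarrow> f z = 0)}"

definition taylor_coeff :: "(complex \<Rightarrow> complex) \<Rightarrow> nat \<Rightarrow> complex"
  where "taylor_coeff f n = (deriv ^^ n) f 0 / fact n"

definition Hardy2 :: "complex inner_space"
  where "Hardy2 =
    \<lparr>vecs = {f \<in> disc_holomorphic. summable (\<lambda>n. (cmod (taylor_coeff f n))\<^sup>2)},
     ip = (\<lambda>f g. \<Sum>n. taylor_coeff f n * cnj (taylor_coeff g n))\<rparr>"

definition Hinf :: "(complex \<Rightarrow> complex) set"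
  where "Hinf = {f \<in> disc_holomorphic. bounded (f ` ball 0 1)}"

definition Hinf_norm :: "(complex \<Rightarrow> complex) \<Rightarrow> real"
  where "Hinf_norm f = (SUP z\<in>ball 0 1. cmod (f z))"

definition Hinf1 :: "(complex \<Rightarrow> complex) set"
  where "Hinf1 = {b \<in> Hinf. Hinf_norm b \<le> 1}"

text \<open>The library notion \<^const>\<open>extreme_point_of\<close>, spelled out because the function type is not
  an instance of \<^class>\<open>real_vector\<close>.\<close>

definition Hinf1_extreme :: "(complex \<Rightarrow> complex) \<Rightarrow> bool"
  where "Hinf1_extreme b \<longleftrightarrow> b \<in> Hinf1 \<and>
    \<not> (\<exists>f\<in>Hinf1. \<exists>g\<in>Hinf1. f \<noteq> g \<and>
         (\<exists>t::real. 0 < t \<and> t < 1 \<and>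
            b = cscale (complex_of_real (1 - t)) f + cscale (complex_of_real t) g))"


section \<open>De Branges--Rovnyak spaces\<close>

definition mult_op :: "(complex \<Rightarrow> complex) \<Rightarrow> complex operator"
  where "mult_op b f = (\<lambda>z. b z * f z)"

definition defect_sqrt :: "(complex \<Rightarrow> complex) \<Rightarrow> complex operator"
  where "defect_sqrt b =
    sqrt_operator Hardy2 (\<lambda>f. f - mult_op b (hadjoint Hardy2 (mult_op b) f))"

definition defect_lift :: "(complex \<Rightarrow> complex) \<Rightarrow> complex operator"
  where "defect_lift b u =
    (THE f. f \<in> hcomplement Hardy2 (hkernel Hardy2 (defect_sqrt b)) \<and> defect_sqrt b f = u)"

definition deBranges_Rovnyak :: "(complex \<Rightarrow> complex) \<Rightarrow> complex inner_space"
  where "deBranges_Rovnyak b =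
    \<lparr>vecs = defect_sqrt b ` vecs Hardy2,
     ip = (\<lambda>u v. ip Hardy2 (defect_lift b u) (defect_lift b v))\<rparr>"

definition shift_dBR :: "(complex \<Rightarrow> complex) \<Rightarrow> complex operator"
  where "shift_dBR b = restrict (mult_op (\<lambda>z. z)) (vecs (deBranges_Rovnyak b))"

end

theory Submission
  imports Defs
begin

text \<open>Write \<open>B\<close> for multiplication by \<open>b\<close> on the Hardy space, \<open>S\<close> for the forward shift, and
  \<open>X f = (f - f 0) / z\<close> for the backward shift.

  For a Hilbert space of analytic functions on the disc the theorem has a soft reason. Suppose that
  \<open>X\<close> is a contraction on the space, that \<open>S\<close> is bounded, and that the evaluation at 0 is bounded
  and represented by \<open>k \<noteq> 0\<close>. From \<open>X S = I\<close> one gets \<open>S\<^sup>* X\<^sup>* = I\<close>, hence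
  \<open>(S\<^sup>* - w I) X\<^sup>* = I - w X\<^sup>*\<close>, which is invertible for \<open>\<bar>w\<bar> < 1\<close>; so \<open>S\<^sup>* - w I\<close> is onto. The kernel of
  \<open>S\<^sup>*\<close> is the line through \<open>k\<close>, and \<open>I - w X\<^sup>*\<close> carries the eigenspace at \<open>w\<close> onto it, so the
  eigenspaces are lines. Their spanning vectors \<open>(I - w X\<^sup>*)\<^sup>-\<^sup>1 k\<close> are the reproducing kernels, so they
  span a dense subspace. This is \<open>backward_shift_space.S_adj_cowen_douglas\<close>.

  What remains is to verify the hypotheses for the de Branges--Rovnyak space, which is the range of
  \<open>R = (I - B B\<^sup>*)\<^sup>1\<^sup>/\<^sup>2\<close>. Its norm has the variational description
  \<open>\<parallel>f\<parallel>\<^sub>b\<^sup>2 = sup (\<parallel>f + b g\<parallel>\<^sup>2 - \<parallel>g\<parallel>\<^sup>2)\<close>, the supremum over \<open>g\<close> in the Hardy space, finite exactly on the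
  range of \<open>R\<close> (\<open>hnorm_add_range_le\<close> and \<open>in_rangeI\<close>). It makes both shifts accessible by
  elementary algebra with constant terms. For the contractivity of \<open>X\<close> this algebra suffices. For
  the boundedness of \<open>S\<close> the strict inequality \<open>\<parallel>X b\<parallel>\<^sub>b\<^sup>2 < 1 - \<bar>b 0\<bar>\<^sup>2\<close> is decisive, and this is where
  \<open>b\<close> not being extreme enters: writing \<open>b = (1 - t) f + t g\<close> with \<open>f \<noteq> g\<close>, the function
  \<open>h = (t (1 - t))\<^sup>1\<^sup>/\<^sup>2 (f - g)\<close> satisfies \<open>\<bar>b\<bar>\<^sup>2 + \<bar>h\<bar>\<^sup>2 \<le> 1\<close> on the disc, so that
  \<open>\<parallel>b f\<parallel>\<^sup>2 + \<parallel>h f\<parallel>\<^sup>2 \<le> \<parallel>f\<parallel>\<^sup>2\<close> for all \<open>f\<close> in the Hardy space, with \<open>h \<noteq> 0\<close>.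

  The functional analysis rests on one lemma, \<open>functional_represented\<close>, a form of the Riesz
  representation theorem; the square root \<open>R\<close> exists by the binomial series. The norm inequality above
  is obtained by averaging over roots of unity on circles of radius less than 1.\<close>

section \<open>Inner product spaces of functions\<close>

locale inner_product_functions =
  fixes H :: "'x inner_space"
  assumes inner_space: "complex_inner_space H"
begin

lemma subspace_vecs: "cfun.subspace (vecs H)"
  using inner_space by (simp add: complex_inner_space_def)

lemma vecs_closed [simp, intro]:
  "0 \<in> vecs H"
  "f \<in> vecs H \<Longrightarrow> g \<in> vecs H \<Longrightarrow> f + g \<in> vecs H"
  "f \<in> vecs H \<Longrightarrow> g \<in> vecs H \<Longrightarrow> f - g \<in> vecs H"
  "f \<in> vecs H \<Longrightarrow> cscale c f \<in> vecs H"
  using subspace_vecs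
  by (auto intro: cfun.subspace_0 cfun.subspace_add cfun.subspace_diff cfun.subspace_scale)

lemma
  shows ip_left [simp]:
    "f \<in> vecs H \<Longrightarrow> g \<in> vecs H \<Longrightarrow> h \<in> vecs H \<Longrightarrow> ip H (f + g) h = ip H f h + ip H g h"
    "f \<in> vecs H \<Longrightarrow> g \<in> vecs H \<Longrightarrow> ip H (cscale c f) g = c * ip H f g"
    and ip_commute: "f \<in> vecs H \<Longrightarrow> g \<in> vecs H \<Longrightarrow> ip H g f = cnj (ip H f g)"
    and ip_self_Re: "f \<in> vecs H \<Longrightarrow> 0 \<le> Re (ip H f f)"
    and ip_definite: "f \<in> vecs H \<Longrightarrow> ip H f f = 0 \<Longrightarrow> f = 0"
proof -
  have *: "\<forall>f\<in>vecs H. \<forall>g\<in>vecs H. \<forall>h\<in>vecs H. ip H (f + g) h = ip H f h + ip H g h"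
    "\<forall>c. \<forall>f\<in>vecs H. \<forall>g\<in>vecs H. ip H (cscale c f) g = c * ip H f g"
    "\<forall>f\<in>vecs H. \<forall>g\<in>vecs H. ip H g f = cnj (ip H f g)"
    "\<forall>f\<in>vecs H. 0 \<le> Re (ip H f f) \<and> (ip H f f = 0 \<longrightarrow> f = 0)"
    using inner_space unfolding complex_inner_space_def by - (elim conjE, assumption)+
  show "f \<in> vecs H \<Longrightarrow> g \<in> vecs H \<Longrightarrow> h \<in> vecs H \<Longrightarrow> ip H (f + g) h = ip H f h + ip H g h"
    "f \<in> vecs H \<Longrightarrow> g \<in> vecs H \<Longrightarrow> ip H (cscale c f) g = c * ip H f g"
    "f \<in> vecs H \<Longrightarrow> g \<in> vecs H \<Longrightarrow> ip H g f = cnj (ip H f g)"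
    using *(1-3) by blast+
  show "f \<in> vecs H \<Longrightarrow> 0 \<le> Re (ip H f f)" "f \<in> vecs H \<Longrightarrow> ip H f f = 0 \<Longrightarrow> f = 0"
    using *(4) by blast+
qed

lemma ip_diff_left [simp]:
  assumes "f \<in> vecs H" "g \<in> vecs H" "h \<in> vecs H"
  shows "ip H (f - g) h = ip H f h - ip H g h"
proof -
  have "ip H f h = ip H ((f - g) + g) h" by simp
  also have "\<dots> = ip H (f - g) h + ip H g h" using assms by (intro ip_left) auto
  finally show ?thesis by simp
qed

lemma ip_right [simp]:
  assumes "f \<in> vecs H" "g \<in> vecs H" "h \<in> vecs H"
  shows "ip H h (f + g) = ip H h f + ip H h g"
    and "ip H h (f - g) = ip H h f - ip H h g"
    and "ip H h (cscale c f) = cnj c * ip H h f"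
  using assms ip_commute[of f h] ip_commute[of g h] ip_commute[of "f + g" h] ip_commute[of "f - g" h]
    ip_commute[of "cscale c f" h] by simp_all

lemma ip_zero [simp]: "f \<in> vecs H \<Longrightarrow> ip H 0 f = 0" "f \<in> vecs H \<Longrightarrow> ip H f 0 = 0"
  using ip_diff_left[of f f f] ip_right(2)[of f f f] by simp_all

lemma ip_self: "f \<in> vecs H \<Longrightarrow> ip H f f = complex_of_real ((hnorm H f)\<^sup>2)"
proof -
  assume f: "f \<in> vecs H"
  have "Im (ip H f f) = 0" using ip_commute[OF f f] by (simp add: complex_eq_iff)
  moreover have "0 \<le> Re (ip H f f)" using f by (rule ip_self_Re)
  ultimately show ?thesis by (simp add: hnorm_def complex_eq_iff)
qed

lemma hnorm_nonneg [simp]: "f \<in> vecs H \<Longrightarrow> 0 \<le> hnorm H f"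
  by (simp add: hnorm_def ip_self_Re)

lemma hnorm_zero [simp]: "hnorm H 0 = 0"
  by (simp add: hnorm_def)

lemma hnorm_eq_0_iff: "f \<in> vecs H \<Longrightarrow> hnorm H f = 0 \<longleftrightarrow> f = 0"
  using ip_self[of f] ip_definite by auto

lemma hnorm_add_sq:
  assumes "f \<in> vecs H" "g \<in> vecs H"
  shows "(hnorm H (f + g))\<^sup>2 = (hnorm H f)\<^sup>2 + 2 * Re (ip H f g) + (hnorm H g)\<^sup>2"
proof -
  have "complex_of_real ((hnorm H (f + g))\<^sup>2) = ip H f f + (ip H f g + cnj (ip H f g)) + ip H g g"
    using assms ip_self[of "f + g"] ip_commute[of f g] by (simp add: algebra_simps)
  then show ?thesis using assms by (simp add: ip_self complex_eq_iff)
qed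

lemma hnorm_diff_sq:
  assumes "f \<in> vecs H" "g \<in> vecs H"
  shows "(hnorm H (f - g))\<^sup>2 = (hnorm H f)\<^sup>2 - 2 * Re (ip H f g) + (hnorm H g)\<^sup>2"
  using hnorm_add_sq[of "f - g" g] assms ip_self[of g] by (simp add: algebra_simps)

lemma hnorm_cscale [simp]:
  assumes "f \<in> vecs H"
  shows "hnorm H (cscale c f) = cmod c * hnorm H f"
proof -
  have "complex_of_real ((hnorm H (cscale c f))\<^sup>2) = (c * cnj c) * ip H f f"
    using assms ip_self[of "cscale c f"] by (simp add: mult_ac)
  also have "\<dots> = complex_of_real ((cmod c * hnorm H f)\<^sup>2)"
    using assms by (simp add: ip_self power_mult_distrib flip: complex_norm_square)
  finally have "(hnorm H (cscale c f))\<^sup>2 = (cmod c * hnorm H f)\<^sup>2"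
    using of_real_eq_iff by blast
  then show ?thesis using assms by (simp add: power2_eq_iff_nonneg)
qed

lemma hnorm_minus_commute: "f \<in> vecs H \<Longrightarrow> g \<in> vecs H \<Longrightarrow> hnorm H (f - g) = hnorm H (g - f)"
  using hnorm_cscale[of "g - f" "-1"] by (simp add: cfun.scale_minus_left)

lemma Cauchy_Schwarz:
  assumes f: "f \<in> vecs H" and g: "g \<in> vecs H"
  shows "cmod (ip H f g) \<le> hnorm H f * hnorm H g"
proof (cases "g = 0")
  case True
  then show ?thesis using f by simp
next
  case False
  then have n: "hnorm H g > 0" using g hnorm_eq_0_iff hnorm_nonneg by fastforce
  \<comment> \<open>The scalar for which \<open>c g\<close> is the orthogonal projection of \<open>f\<close> to the line spanned by \<open>g\<close>.\<close>
  define c where "c = ip H f g / complex_of_real ((hnorm H g)\<^sup>2)"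
  have c: "cnj c * ip H f g = complex_of_real ((cmod (ip H f g))\<^sup>2 / (hnorm H g)\<^sup>2)"
    using complex_norm_square[of "ip H f g"] by (simp add: c_def mult.commute)
  have m: "cmod c * hnorm H g = cmod (ip H f g) / hnorm H g"
    using n by (simp add: c_def norm_divide power2_eq_square norm_mult)
  have "0 \<le> (hnorm H (f - cscale c g))\<^sup>2" by simp
  also have "\<dots> = (hnorm H f)\<^sup>2 - (cmod (ip H f g))\<^sup>2 / (hnorm H g)\<^sup>2"
    using f g c m by (simp add: hnorm_diff_sq power_divide)
  finally have "(cmod (ip H f g))\<^sup>2 \<le> (hnorm H f * hnorm H g)\<^sup>2"
    using n by (simp add: field_simps)
  then show ?thesis by (rule power2_le_imp_le) (use f g in simp)
qed

lemma hnorm_triangle: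
  assumes f: "f \<in> vecs H" and g: "g \<in> vecs H"
  shows "hnorm H (f + g) \<le> hnorm H f + hnorm H g"
proof (rule power2_le_imp_le)
  have "Re (ip H f g) \<le> hnorm H f * hnorm H g"
    using Cauchy_Schwarz[OF f g] complex_Re_le_cmod[of "ip H f g"] by linarith
  then show "(hnorm H (f + g))\<^sup>2 \<le> (hnorm H f + hnorm H g)\<^sup>2"
    using f g by (simp add: hnorm_add_sq power2_sum)
qed (use f g in auto)

lemma hnorm_triangle_diff:
  assumes "f \<in> vecs H" "g \<in> vecs H" "h \<in> vecs H"
  shows "hnorm H (f - h) \<le> hnorm H (f - g) + hnorm H (g - h)"
  using hnorm_triangle[of "f - g" "g - h"] assms by simp

lemma hnorm_diff_le:
  assumes "f \<in> vecs H" "g \<in> vecs H"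
  shows "\<bar>hnorm H f - hnorm H g\<bar> \<le> hnorm H (f - g)"
  using hnorm_triangle[of "f - g" g] hnorm_triangle[of "g - f" f] hnorm_minus_commute[of f g] assms
  by simp

lemma eq_if_ip_eq:
  assumes "f \<in> vecs H" "g \<in> vecs H" "\<And>h. h \<in> vecs H \<Longrightarrow> ip H h f = ip H h g"
  shows "f = g"
proof -
  have "ip H (f - g) (f - g) = 0" using assms by simp
  then have "hnorm H (f - g) = 0" by (simp add: hnorm_def)
  then show ?thesis using hnorm_eq_0_iff[of "f - g"] assms by simp
qed

lemma tendsto_ip:
  assumes s: "\<And>n. s n \<in> vecs H" and u: "u \<in> vecs H" and v: "v \<in> vecs H"
    and lim: "(\<lambda>n. hnorm H (s n - u)) \<longlonglongrightarrow> 0"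
  shows "(\<lambda>n. ip H v (s n)) \<longlonglongrightarrow> ip H v u"
proof -
  have "(\<lambda>n. ip H v (s n) - ip H v u) \<longlonglongrightarrow> 0"
  proof (rule Lim_null_comparison)
    have "norm (ip H v (s n) - ip H v u) \<le> hnorm H v * hnorm H (s n - u)" for n
      using Cauchy_Schwarz[of v "s n - u"] s u v by simp
    then show "\<forall>\<^sub>F n in sequentially. norm (ip H v (s n) - ip H v u) \<le> hnorm H v * hnorm H (s n - u)"
      by simp
    show "(\<lambda>n. hnorm H v * hnorm H (s n - u)) \<longlonglongrightarrow> 0"
      using tendsto_mult_right_zero[OF lim] by simp
  qed
  then show ?thesis by (simp add: LIM_zero_iff)
qed

lemma tendsto_hnorm:
  assumes s: "\<And>n. s n \<in> vecs H" and u: "u \<in> vecs H"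
    and lim: "(\<lambda>n. hnorm H (s n - u)) \<longlonglongrightarrow> 0"
  shows "(\<lambda>n. hnorm H (s n)) \<longlonglongrightarrow> hnorm H u"
proof -
  have "(\<lambda>n. hnorm H (s n) - hnorm H u) \<longlonglongrightarrow> 0"
    using hnorm_diff_le s u by (intro Lim_null_comparison[OF _ lim]) auto
  then show ?thesis by (simp add: LIM_zero_iff)
qed

lemma Metric_space_hdist: "Metric_space (vecs H) (hdist H)"
proof
  show "0 \<le> hdist H f g" for f g by (simp add: hdist_def)
  show "hdist H f g = hdist H g f" for f g
    using hnorm_minus_commute by (simp add: hdist_def)
  show "hdist H f g = 0 \<longleftrightarrow> f = g" if "f \<in> vecs H" "g \<in> vecs H" for f g
    using that hnorm_eq_0_iff[of "f - g"] by (simp add: hdist_def)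
  show "hdist H f h \<le> hdist H f g + hdist H g h"
    if "f \<in> vecs H" "g \<in> vecs H" "h \<in> vecs H" for f g h
    using that hnorm_triangle_diff by (simp add: hdist_def)
qed

sublocale Metric_space "vecs H" "hdist H"
  by (rule Metric_space_hdist)

lemma topspace_htopology [simp]: "topspace (htopology H) = vecs H"
  by (simp add: htopology_def)

lemma limitin_iff_hnorm:
  assumes "\<And>n. s n \<in> vecs H" "u \<in> vecs H"
  shows "limitin mtopology s u sequentially \<longleftrightarrow> (\<lambda>n. hnorm H (s n - u)) \<longlonglongrightarrow> 0"
  using assms by (simp add: limitin_metric_dist_null hdist_def)

lemma MCauchy_iff_hnorm:
  assumes "\<And>n. s n \<in> vecs H"
  shows "MCauchy s \<longleftrightarrow> (\<forall>e>0. \<exists>N. \<forall>m\<ge>N. \<forall>n\<ge>N. hnorm H (s m - s n) < e)"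
  using assms unfolding MCauchy_def by (auto simp: hdist_def image_subset_iff)

lemma mcompleteI:
  assumes "\<And>s. (\<And>n. s n \<in> vecs H) \<Longrightarrow> \<forall>e>0. \<exists>N. \<forall>m\<ge>N. \<forall>n\<ge>N. hnorm H (s m - s n) < e
             \<Longrightarrow> \<exists>u\<in>vecs H. (\<lambda>n. hnorm H (s n - u)) \<longlonglongrightarrow> 0"
  shows mcomplete
  unfolding mcomplete_def
proof (intro allI impI)
  fix s assume c: "MCauchy s"
  then have s: "\<And>n. s n \<in> vecs H" by (auto simp: MCauchy_def)
  then obtain u where "u \<in> vecs H" "(\<lambda>n. hnorm H (s n - u)) \<longlonglongrightarrow> 0"
    using assms[of s] c MCauchy_iff_hnorm[of s] by auto
  then show "\<exists>x. limitin mtopology s x sequentially" using limitin_iff_hnorm[of s u] s by auto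
qed

lemma in_closure_of_htopology:
  assumes "A \<subseteq> vecs H"
  shows "f \<in> htopology H closure_of A \<longleftrightarrow> f \<in> vecs H \<and> (\<forall>e>0. \<exists>g\<in>A. hnorm H (f - g) < e)"
  unfolding htopology_def metric_closure_of using assms
  by (auto simp: hdist_def subset_iff)

text \<open>The countable dense set consists of the finite combinations with Gaussian rational
  coefficients.\<close>

lemma separable_if_sequence_total:
  fixes e :: "nat \<Rightarrow> 'x \<Rightarrow> complex"
  assumes e: "\<And>n. e n \<in> vecs H"
    and dense: "\<And>f r. f \<in> vecs H \<Longrightarrow> r > 0 \<Longrightarrow>
      \<exists>N a. hnorm H (f - (\<Sum>n<N. cscale (a n) (e n))) < r"
  shows "separable_space (htopology H)"
proof -
  define q where "q p = Complex (of_rat (fst p)) (of_rat (snd p))" for p :: "rat \<times> rat"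
  define L where "L ps = (\<Sum>n<length ps. cscale (q (ps ! n)) (e n))" for ps
  have sum_in: "(\<Sum>n<N. cscale (a n) (e n)) \<in> vecs H" for N :: nat and a
    using e by (intro cfun.subspace_sum[OF subspace_vecs]) auto
  have q_dense: "\<exists>p. cmod (z - q p) < r" if "r > 0" for z r
  proof -
    obtain x where x: "Re z < of_rat x" "of_rat x < Re z + r/2"
      using of_rat_dense[of "Re z" "Re z + r/2"] \<open>r > 0\<close> by auto
    obtain y where y: "Im z < of_rat y" "of_rat y < Im z + r/2"
      using of_rat_dense[of "Im z" "Im z + r/2"] \<open>r > 0\<close> by auto
    have "cmod (z - q (x, y)) \<le> \<bar>Re (z - q (x, y))\<bar> + \<bar>Im (z - q (x, y))\<bar>"
      by (rule cmod_le)
    also have "\<dots> < r" using x y by (simp add: q_def)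
    finally show ?thesis by blast
  qed
  have approx: "\<exists>ps. length ps = N \<and> hnorm H ((\<Sum>n<N. cscale (a n) (e n)) - L ps) < r" if "r > 0" for N r a
    using that
  proof (induction N arbitrary: r)
    case 0
    then show ?case by (simp add: L_def flip: zero_fun_def)
  next
    case (Suc N)
    then obtain ps where ps: "length ps = N" "hnorm H ((\<Sum>n<N. cscale (a n) (e n)) - L ps) < r/2"
      using half_gt_zero by blast
    have pos: "r / (2 * (1 + hnorm H (e N))) > 0"
      using Suc.prems hnorm_nonneg[OF e[of N]] by auto
    then obtain p where p: "cmod (a N - q p) < r / (2 * (1 + hnorm H (e N)))" using q_dense by blast
    have "cmod (a N - q p) * hnorm H (e N) \<le> cmod (a N - q p) * (1 + hnorm H (e N))"
      by (simp add: algebra_simps)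
    also have "\<dots> < r/2"
      using p hnorm_nonneg[OF e[of N]] by (auto simp: field_simps)
    finally have p': "hnorm H (cscale (a N - q p) (e N)) < r/2" using e by simp
    have L: "L (ps @ [p]) = L ps + cscale (q p) (e N)"
      by (simp add: L_def ps(1) nth_append)
    have split: "(\<Sum>n<Suc N. cscale (a n) (e n)) - L (ps @ [p])
        = ((\<Sum>n<N. cscale (a n) (e n)) - L ps) + cscale (a N - q p) (e N)"
      by (simp add: L cfun.scale_left_diff_distrib)
    have "L ps \<in> vecs H" unfolding L_def by (rule sum_in)
    then have "hnorm H ((\<Sum>n<N. cscale (a n) (e n)) - L ps + cscale (a N - q p) (e N))
        \<le> hnorm H ((\<Sum>n<N. cscale (a n) (e n)) - L ps) + hnorm H (cscale (a N - q p) (e N))"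
      by (intro hnorm_triangle vecs_closed sum_in e)
    then have "hnorm H ((\<Sum>n<Suc N. cscale (a n) (e n)) - L (ps @ [p])) < r"
      unfolding split using ps(2) p' by linarith
    moreover have "length (ps @ [p]) = Suc N" using ps(1) by simp
    ultimately show ?case by blast
  qed
  have sub: "range L \<subseteq> vecs H" using sum_in by (auto simp: L_def)
  have "f \<in> htopology H closure_of range L" if f: "f \<in> vecs H" for f
    unfolding in_closure_of_htopology[OF sub]
  proof (intro conjI allI impI)
    fix r :: real assume "r > 0"
    then obtain N a where 1: "hnorm H (f - (\<Sum>n<N. cscale (a n) (e n))) < r/2"
      using dense[OF f, of "r/2"] by auto
    obtain ps where 2: "hnorm H ((\<Sum>n<N. cscale (a n) (e n)) - L ps) < r/2"
      using approx[of "r/2" N a] \<open>r > 0\<close> by auto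
    have "L ps \<in> vecs H" using sub by blast
    from hnorm_triangle_diff[OF f sum_in[of a N] this] 1 2 have "hnorm H (f - L ps) < r"
      by linarith
    then show "\<exists>g\<in>range L. hnorm H (f - g) < r" by blast
  qed (fact f)
  then have "htopology H closure_of range L = topspace (htopology H)"
    using closure_of_subset_topspace[of "htopology H" "range L"] by auto
  moreover have "countable (range L)" by simp
  ultimately show ?thesis using sub unfolding separable_space_def topspace_htopology by blast
qed

end

section \<open>Representation of functionals and adjoints\<close>

context inner_product_functions
begin

lemma bounded_operatorD:
  assumes "bounded_operator H T"
  shows "f \<in> vecs H \<Longrightarrow> T f \<in> vecs H"
    and "f \<in> vecs H \<Longrightarrow> g \<in> vecs H \<Longrightarrow> T (f + g) = T f + T g"
    and "f \<in> vecs H \<Longrightarrow> T (cscale c f) = cscale c (T f)"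
  using assms by (auto simp: bounded_operator_def)

lemma bounded_operator_diff:
  assumes T: "bounded_operator H T" and f: "f \<in> vecs H" and g: "g \<in> vecs H"
  shows "T (f - g) = T f - T g"
  using bounded_operatorD(2)[OF T vecs_closed(3)[OF f g] g] by simp

lemma bounded_operator_zero: "bounded_operator H T \<Longrightarrow> T 0 = 0"
  using bounded_operator_diff[of T 0 0] by simp

lemma bounded_operator_bound:
  assumes "bounded_operator H T"
  obtains C where "0 \<le> C" "\<And>f. f \<in> vecs H \<Longrightarrow> hnorm H (T f) \<le> C * hnorm H f"
proof -
  obtain C where C: "\<forall>f\<in>vecs H. hnorm H (T f) \<le> C * hnorm H f"
    using assms by (auto simp: bounded_operator_def)
  have "hnorm H (T f) \<le> max 0 C * hnorm H f" if "f \<in> vecs H" for f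
    using that C mult_right_mono[of C "max 0 C" "hnorm H f"] hnorm_nonneg[of f] by fastforce
  then show ?thesis using that[of "max 0 C"] by simp
qed

lemma bounded_operatorI:
  assumes "\<And>f. f \<in> vecs H \<Longrightarrow> T f \<in> vecs H"
    and "\<And>f g. f \<in> vecs H \<Longrightarrow> g \<in> vecs H \<Longrightarrow> T (f + g) = T f + T g"
    and "\<And>c f. f \<in> vecs H \<Longrightarrow> T (cscale c f) = cscale c (T f)"
    and "\<And>f. f \<in> vecs H \<Longrightarrow> hnorm H (T f) \<le> C * hnorm H f"
  shows "bounded_operator H T"
  using assms unfolding bounded_operator_def by blast

lemma tendsto_bounded_operator:
  assumes T: "bounded_operator H T" and s: "\<And>n. s n \<in> vecs H" and u: "u \<in> vecs H"
    and lim: "(\<lambda>n. hnorm H (s n - u)) \<longlonglongrightarrow> 0"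
  shows "(\<lambda>n. hnorm H (T (s n) - T u)) \<longlonglongrightarrow> 0"
proof -
  obtain C where C: "\<And>f. f \<in> vecs H \<Longrightarrow> hnorm H (T f) \<le> C * hnorm H f"
    using bounded_operator_bound[OF T] by blast
  have "norm (hnorm H (T (s n) - T u)) \<le> C * hnorm H (s n - u)" for n
    using C[of "s n - u"] bounded_operatorD(1)[OF T] bounded_operator_diff[OF T] s u by simp
  then show ?thesis
    by (intro Lim_null_comparison[OF _ tendsto_mult_right_zero[OF lim, of C]] always_eventually) blast
qed

end

locale hilbert_functions = inner_product_functions H for H :: "'x inner_space" +
  assumes complete: mcomplete
begin

lemma Cauchy_converges:
  assumes s: "\<And>n. s n \<in> vecs H"
    and "\<And>e. e > 0 \<Longrightarrow> \<exists>N. \<forall>m\<ge>N. \<forall>n\<ge>N. hnorm H (s m - s n) < e"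
  obtains u where "u \<in> vecs H" "(\<lambda>n. hnorm H (s n - u)) \<longlonglongrightarrow> 0"
proof -
  have "MCauchy s" using assms MCauchy_iff_hnorm by simp
  then obtain u where u: "limitin mtopology s u sequentially"
    using complete by (auto simp: mcomplete_def)
  then have "u \<in> vecs H" by (simp add: limitin_mspace)
  with u s show ?thesis using limitin_iff_hnorm that by blast
qed

text \<open>The common source of the Riesz representation theorem, of orthogonal projections and of the
  description of operator ranges below. The real-valued function
  \<open>J v = \<parallel>T v\<parallel>\<^sup>2 - 2 Re (\<phi> v)\<close> is bounded below by \<open>- M\<close>; by the parallelogram law the images under
  \<open>T\<close> of a minimizing sequence form a Cauchy sequence, and the first variation of \<open>J\<close> vanishes at
  its limit \<open>u\<close>, which says that \<open>u\<close> represents \<open>\<phi>\<close>. The minimizing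
  sequence is part of the conclusion because projections need \<open>u\<close> to lie in the closure of the range
  of \<open>T\<close>.\<close>

lemma functional_represented:
  fixes T :: "('y \<Rightarrow> complex) \<Rightarrow> 'x \<Rightarrow> complex" and \<phi> :: "('y \<Rightarrow> complex) \<Rightarrow> complex"
  assumes V: "cfun.subspace V" and T: "\<And>v. v \<in> V \<Longrightarrow> T v \<in> vecs H"
    and T_add: "\<And>v w. v \<in> V \<Longrightarrow> w \<in> V \<Longrightarrow> T (v + w) = T v + T w"
    and T_scale: "\<And>c v. v \<in> V \<Longrightarrow> T (cscale c v) = cscale c (T v)"
    and \<phi>_add: "\<And>v w. v \<in> V \<Longrightarrow> w \<in> V \<Longrightarrow> \<phi> (v + w) = \<phi> v + \<phi> w"
    and \<phi>_scale: "\<And>c v. v \<in> V \<Longrightarrow> \<phi> (cscale c v) = c * \<phi> v"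
    and bound: "\<And>v. v \<in> V \<Longrightarrow> 2 * Re (\<phi> v) \<le> M + (hnorm H (T v))\<^sup>2"
  obtains u s where "u \<in> vecs H" "\<And>n. s n \<in> V" "(\<lambda>n. hnorm H (T (s n) - u)) \<longlonglongrightarrow> 0"
    "(hnorm H u)\<^sup>2 \<le> M" "\<And>v. v \<in> V \<Longrightarrow> \<phi> v = ip H (T v) u"
proof -
  define J where "J v = (hnorm H (T v))\<^sup>2 - 2 * Re (\<phi> v)" for v
  define m where "m = Inf (J ` V)"
  have V0: "V \<noteq> {}" using cfun.subspace_0[OF V] by blast
  have bdd: "bdd_below (J ` V)" using bound by (intro bdd_belowI2[of _ "-M"]) (force simp: J_def)
  have m: "m \<le> J v" if "v \<in> V" for v unfolding m_def using bdd that by (rule cINF_lower)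
  have "\<exists>v\<in>V. J v < m + 1 / real (Suc n)" for n
    using cInf_lessD[of "J ` V" "m + 1 / real (Suc n)"] V0 by (auto simp: m_def)
  then obtain s where s: "\<And>n. s n \<in> V" and Js: "\<And>n. J (s n) < m + 1 / real (Suc n)" by metis
  \<comment> \<open>The parallelogram law, applied to the midpoint of two almost minimizers.\<close>
  have close: "(hnorm H (T v - T w))\<^sup>2 \<le> 2 * (J v - m) + 2 * (J w - m)" if v: "v \<in> V" and w: "w \<in> V" for v w
  proof -
    have "v + w \<in> V" using V v w by (rule cfun.subspace_add)
    then have h: "cscale (1/2) (v + w) \<in> V" using V by (intro cfun.subspace_scale)
    have "J (cscale (1/2) (v + w)) = (hnorm H (T v + T w))\<^sup>2 / 4 - Re (\<phi> v) - Re (\<phi> w)"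
      using v w T \<open>v + w \<in> V\<close>
      by (simp add: J_def T_scale T_add \<phi>_scale \<phi>_add power_divide add_divide_distrib)
    then show ?thesis
      using m[OF h] T[OF v] T[OF w] hnorm_add_sq[of "T v" "T w"] hnorm_diff_sq[of "T v" "T w"]
      by (simp add: J_def field_simps)
  qed
  have "\<exists>N. \<forall>j\<ge>N. \<forall>k\<ge>N. hnorm H (T (s j) - T (s k)) < e" if e: "e > 0" for e
  proof -
    obtain N where N: "4 * (1 / real (Suc N)) < e\<^sup>2"
      using reals_Archimedean[of "e\<^sup>2 / 4"] e by (auto simp: field_simps)
    have "hnorm H (T (s j) - T (s k)) < e" if "j \<ge> N" "k \<ge> N" for j k
    proof (rule power2_less_imp_less)
      have "1 / real (Suc j) \<le> 1 / real (Suc N)" "1 / real (Suc k) \<le> 1 / real (Suc N)"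
        using that by (auto intro!: divide_left_mono)
      then show "(hnorm H (T (s j) - T (s k)))\<^sup>2 < e\<^sup>2"
        using close[OF s[of j] s[of k]] Js[of j] Js[of k] N by argo
    qed (use e in simp)
    then show ?thesis by blast
  qed
  then obtain u where u: "u \<in> vecs H" and lim: "(\<lambda>n. hnorm H (T (s n) - u)) \<longlonglongrightarrow> 0"
    using Cauchy_converges[of "\<lambda>n. T (s n)"] T s by blast
  \<comment> \<open>The first variation of \<open>J\<close> at the limit \<open>u\<close>.\<close>
  have Re_eq: "Re (\<phi> v) = Re (ip H (T v) u)" if v: "v \<in> V" for v
  proof -
    define d where "d = Re (ip H (T v) u) - Re (\<phi> v)"
    define q where "q = (hnorm H (T v))\<^sup>2"
    have ge: "0 \<le> 2 * t * d + t\<^sup>2 * q" for t :: real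
    proof -
      have "0 \<le> 1 / real (Suc n) + 2 * t * (Re (ip H (T v) (T (s n))) - Re (\<phi> v)) + t\<^sup>2 * q" for n
      proof -
        have tv: "cscale (of_real t) v \<in> V" using V v by (intro cfun.subspace_scale)
        then have "s n + cscale (of_real t) v \<in> V" using V s by (intro cfun.subspace_add)
        from m[OF this] have "m \<le> J (s n) + 2 * t * (Re (ip H (T v) (T (s n))) - Re (\<phi> v)) + t\<^sup>2 * q"
          using T[OF v] T[OF s[of n]] s v tv ip_commute[of "T v" "T (s n)"]
          by (simp add: J_def T_add T_scale \<phi>_add \<phi>_scale hnorm_add_sq q_def power_mult_distrib algebra_simps)
        then show ?thesis using Js[of n] by linarith
      qed
      moreover have "(\<lambda>n. 1 / real (Suc n) + 2 * t * (Re (ip H (T v) (T (s n))) - Re (\<phi> v)) + t\<^sup>2 * q)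
          \<longlonglongrightarrow> 0 + 2 * t * (Re (ip H (T v) u) - Re (\<phi> v)) + t\<^sup>2 * q"
        using T s u v lim
        by (intro tendsto_intros LIMSEQ_Suc[OF lim_1_over_n] tendsto_ip) auto
      ultimately show ?thesis by (intro LIMSEQ_le_const[of _ _ 0]) (auto simp: d_def)
    qed
    have "d = 0"
    proof (rule ccontr)
      assume "d \<noteq> 0"
      \<comment> \<open>The minimum of the quadratic would be at \<open>t = - d / q\<close>; adding 1 avoids dividing by zero.\<close>
      have q: "q \<ge> 0" by (simp add: q_def)
      have "0 \<le> 2 * (- d / (q + 1)) * d + (- d / (q + 1))\<^sup>2 * q" by (rule ge)
      also have "\<dots> = - (d\<^sup>2 * (q + 2)) / (q + 1)\<^sup>2"
        using q by (simp add: power2_eq_square divide_simps) (simp add: algebra_simps)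
      also have "\<dots> < 0" using q \<open>d \<noteq> 0\<close> by (simp add: divide_less_0_iff zero_less_mult_iff)
      finally show False by simp
    qed
    then show ?thesis by (simp add: d_def)
  qed
  have eq: "\<phi> v = ip H (T v) u" if v: "v \<in> V" for v
  proof (rule complex_eqI)
    show "Re (\<phi> v) = Re (ip H (T v) u)" using v by (rule Re_eq)
    show "Im (\<phi> v) = Im (ip H (T v) u)"
      using Re_eq[of "cscale \<i> v"] cfun.subspace_scale[OF V v] v T u by (simp add: T_scale \<phi>_scale)
  qed
  have "(\<lambda>n. Re (ip H u (T (s n)))) \<longlonglongrightarrow> Re (ip H u u)"
    using T s u lim by (intro tendsto_intros tendsto_ip) auto
  then have lhs: "(\<lambda>n. 2 * Re (\<phi> (s n))) \<longlonglongrightarrow> 2 * (hnorm H u)\<^sup>2"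
    using eq s T u ip_commute[of u] by (intro tendsto_intros) (simp add: ip_self)
  have "(\<lambda>n. M + (hnorm H (T (s n)))\<^sup>2) \<longlonglongrightarrow> M + (hnorm H u)\<^sup>2"
    using T s u lim by (intro tendsto_intros tendsto_hnorm) auto
  then have "2 * (hnorm H u)\<^sup>2 \<le> M + (hnorm H u)\<^sup>2"
    using lhs bound s by (intro LIMSEQ_le[OF lhs]) auto
  then show ?thesis using that[OF u s lim _ eq] by simp
qed

lemma functional_represented_on_range:
  fixes T :: "('y \<Rightarrow> complex) \<Rightarrow> 'x \<Rightarrow> complex" and \<phi> :: "('y \<Rightarrow> complex) \<Rightarrow> complex"
  assumes V: "cfun.subspace V" and T: "\<And>v. v \<in> V \<Longrightarrow> T v \<in> vecs H"
    and T_add: "\<And>v w. v \<in> V \<Longrightarrow> w \<in> V \<Longrightarrow> T (v + w) = T v + T w"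
    and T_scale: "\<And>c v. v \<in> V \<Longrightarrow> T (cscale c v) = cscale c (T v)"
    and \<phi>_add: "\<And>v w. v \<in> V \<Longrightarrow> w \<in> V \<Longrightarrow> \<phi> (v + w) = \<phi> v + \<phi> w"
    and \<phi>_scale: "\<And>c v. v \<in> V \<Longrightarrow> \<phi> (cscale c v) = c * \<phi> v"
    and bound: "\<And>v. v \<in> V \<Longrightarrow> cmod (\<phi> v) \<le> C * hnorm H (T v)"
  obtains u s where "u \<in> vecs H" "\<And>n. s n \<in> V" "(\<lambda>n. hnorm H (T (s n) - u)) \<longlonglongrightarrow> 0"
    "(hnorm H u)\<^sup>2 \<le> C\<^sup>2" "\<And>v. v \<in> V \<Longrightarrow> \<phi> v = ip H (T v) u"
proof -
  have "2 * Re (\<phi> v) \<le> C\<^sup>2 + (hnorm H (T v))\<^sup>2" if "v \<in> V" for v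
    using bound[OF that] complex_Re_le_cmod[of "\<phi> v"] sum_squares_bound[of C "hnorm H (T v)"] by linarith
  from functional_represented[OF V T T_add T_scale \<phi>_add \<phi>_scale this] that show ?thesis by blast
qed

lemma Riesz:
  assumes "\<And>v w. v \<in> vecs H \<Longrightarrow> w \<in> vecs H \<Longrightarrow> \<phi> (v + w) = \<phi> v + \<phi> w"
    and "\<And>c v. v \<in> vecs H \<Longrightarrow> \<phi> (cscale c v) = c * \<phi> v"
    and "\<And>v. v \<in> vecs H \<Longrightarrow> cmod (\<phi> v) \<le> C * hnorm H v"
  obtains u where "u \<in> vecs H" "\<And>v. v \<in> vecs H \<Longrightarrow> \<phi> v = ip H v u"
  by (rule functional_represented_on_range[of "vecs H" "\<lambda>v. v" \<phi> C, OF subspace_vecs])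
    (use assms that in auto)

lemma
  assumes T: "bounded_operator H T" and g: "g \<in> vecs H"
  shows hadjoint_in: "hadjoint H T g \<in> vecs H"
    and ip_hadjoint: "f \<in> vecs H \<Longrightarrow> ip H f (hadjoint H T g) = ip H (T f) g"
proof -
  obtain C where C: "\<And>f. f \<in> vecs H \<Longrightarrow> hnorm H (T f) \<le> C * hnorm H f"
    using bounded_operator_bound[OF T] by blast
  note TD = bounded_operatorD[OF T]
  have "cmod (ip H (T v) g) \<le> (C * hnorm H g) * hnorm H v" if "v \<in> vecs H" for v
  proof -
    have "cmod (ip H (T v) g) \<le> hnorm H (T v) * hnorm H g"
      using TD that g by (intro Cauchy_Schwarz)
    also have "\<dots> \<le> C * hnorm H v * hnorm H g"
      using C[OF that] g by (intro mult_right_mono) auto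
    finally show ?thesis by (simp add: mult_ac)
  qed
  then obtain h where h: "h \<in> vecs H" "\<And>f. f \<in> vecs H \<Longrightarrow> ip H (T f) g = ip H f h"
    using Riesz[of "\<lambda>v. ip H (T v) g" "C * hnorm H g"] TD g by auto
  have "hadjoint H T g = h" unfolding hadjoint_def
    using h by (intro the_equality) (auto intro: eq_if_ip_eq)
  then show "hadjoint H T g \<in> vecs H"
    "f \<in> vecs H \<Longrightarrow> ip H f (hadjoint H T g) = ip H (T f) g" using h by auto
qed

lemma hadjoint_eqI:
  assumes T: "bounded_operator H T" and g: "g \<in> vecs H" and h: "h \<in> vecs H"
    and "\<And>f. f \<in> vecs H \<Longrightarrow> ip H (T f) g = ip H f h"
  shows "hadjoint H T g = h"
  using assms hadjoint_in[OF T g] ip_hadjoint[OF T g] by (intro eq_if_ip_eq) auto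

lemma hnorm_hadjoint_le:
  assumes T: "bounded_operator H T" and g: "g \<in> vecs H"
    and C: "\<And>f. f \<in> vecs H \<Longrightarrow> hnorm H (T f) \<le> C * hnorm H f"
  shows "hnorm H (hadjoint H T g) \<le> C * hnorm H g"
proof (cases "hnorm H (hadjoint H T g) = 0")
  case True
  then show ?thesis using C[OF g] hnorm_nonneg[OF bounded_operatorD(1)[OF T g]] by linarith
next
  case False
  let ?h = "hadjoint H T g"
  have h: "?h \<in> vecs H" using T g by (rule hadjoint_in)
  have "(hnorm H ?h)\<^sup>2 = cmod (ip H (T ?h) g)"
    using ip_hadjoint[OF T g h] ip_self[OF h] by (metis norm_of_real abs_power2)
  also have "\<dots> \<le> hnorm H (T ?h) * hnorm H g"
    using Cauchy_Schwarz bounded_operatorD(1)[OF T h] g by simp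
  also have "\<dots> \<le> C * hnorm H ?h * hnorm H g"
    using C[OF h] g by (intro mult_right_mono) auto
  finally have "hnorm H ?h * hnorm H ?h \<le> hnorm H ?h * (C * hnorm H g)"
    by (simp add: power2_eq_square mult_ac)
  moreover have "hnorm H ?h > 0" using False hnorm_nonneg[OF h] by linarith
  ultimately show ?thesis by simp
qed

lemma bounded_operator_hadjoint:
  assumes T: "bounded_operator H T"
  shows "bounded_operator H (hadjoint H T)"
proof -
  obtain C where C: "\<And>f. f \<in> vecs H \<Longrightarrow> hnorm H (T f) \<le> C * hnorm H f"
    using bounded_operator_bound[OF T] by blast
  show ?thesis
  proof (rule bounded_operatorI)
    fix f g c assume f: "f \<in> vecs H" and g: "g \<in> vecs H"
    show "hadjoint H T (f + g) = hadjoint H T f + hadjoint H T g"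
      using f g hadjoint_in[OF T] ip_hadjoint[OF T] bounded_operatorD(1)[OF T]
      by (intro hadjoint_eqI[OF T]) auto
    show "hadjoint H T (cscale c f) = cscale c (hadjoint H T f)"
      using f hadjoint_in[OF T] ip_hadjoint[OF T] bounded_operatorD(1)[OF T]
      by (intro hadjoint_eqI[OF T]) auto
    show "hnorm H (hadjoint H T f) \<le> C * hnorm H f" using T f C by (rule hnorm_hadjoint_le)
    show "hadjoint H T f \<in> vecs H" using T f by (rule hadjoint_in)
  qed
qed

lemma orthogonal_projection:
  assumes V: "cfun.subspace V" "V \<subseteq> vecs H" and f: "f \<in> vecs H"
  obtains u s where "u \<in> vecs H" "\<And>n. s n \<in> V" "(\<lambda>n. hnorm H (s n - u)) \<longlonglongrightarrow> 0"
    "\<And>v. v \<in> V \<Longrightarrow> ip H v (f - u) = 0"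
proof -
  have V_in: "v \<in> vecs H" if "v \<in> V" for v using V(2) that by blast
  have bound: "cmod (ip H v f) \<le> hnorm H f * hnorm H v" if "v \<in> V" for v
    using Cauchy_Schwarz[of v f] f V that by (auto simp: mult.commute)
  obtain u s where u: "u \<in> vecs H" and s: "\<And>n. s n \<in> V" "(\<lambda>n. hnorm H (s n - u)) \<longlonglongrightarrow> 0"
    "\<And>v. v \<in> V \<Longrightarrow> ip H v f = ip H v u"
    by (rule functional_represented_on_range[of V "\<lambda>v. v" "\<lambda>v. ip H v f" "hnorm H f", OF V(1)])
      (use bound V_in f in auto)
  moreover have "ip H v (f - u) = 0" if "v \<in> V" for v using s(3)[OF that] V_in[OF that] f u by simp
  ultimately show ?thesis using that by blast
qed

lemma dense_if_orthogonal_trivial: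
  assumes V: "cfun.subspace V" "V \<subseteq> vecs H"
    and triv: "\<And>f. f \<in> vecs H \<Longrightarrow> (\<And>v. v \<in> V \<Longrightarrow> ip H v f = 0) \<Longrightarrow> f = 0"
  shows "htopology H closure_of V = vecs H"
proof -
  have "f \<in> htopology H closure_of V" if f: "f \<in> vecs H" for f
    unfolding in_closure_of_htopology[OF V(2)]
  proof (intro conjI allI impI)
    fix e :: real assume "e > 0"
    obtain u s where u: "u \<in> vecs H" and s: "\<And>n. s n \<in> V" and lim: "(\<lambda>n. hnorm H (s n - u)) \<longlonglongrightarrow> 0"
      and orth: "\<And>v. v \<in> V \<Longrightarrow> ip H v (f - u) = 0"
      using orthogonal_projection[OF V f] by blast
    have "f - u = 0" using orth f u by (intro triv) auto
    then have "f = u" by simp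
    obtain n where "hnorm H (s n - u) < e"
      using lim \<open>e > 0\<close> order_tendstoD(2)[OF lim] by (meson eventually_sequentially order_refl)
    then show "\<exists>g\<in>V. hnorm H (f - g) < e"
      using s[of n] V(2) f hnorm_minus_commute[of f "s n"] \<open>f = u\<close> by (metis subsetD)
  qed (fact f)
  then show ?thesis using closure_of_subset_topspace[of "htopology H" V] by auto
qed

lemma contraction_perturbation_bounded_below:
  assumes X: "bounded_operator H X" and contr: "\<And>f. f \<in> vecs H \<Longrightarrow> hnorm H (X f) \<le> hnorm H f"
    and f: "f \<in> vecs H"
  shows "(1 - cmod c) * hnorm H f \<le> hnorm H (f - cscale c (X f))"
proof -
  have Xf: "X f \<in> vecs H" using bounded_operatorD(1)[OF X f] .
  have "hnorm H f \<le> hnorm H (f - cscale c (X f)) + cmod c * hnorm H (X f)"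
    using hnorm_triangle[of "f - cscale c (X f)" "cscale c (X f)"] f Xf by simp
  moreover have "cmod c * hnorm H (X f) \<le> cmod c * hnorm H f"
    using contr[OF f] by (intro mult_left_mono) auto
  ultimately show ?thesis by (simp add: algebra_simps)
qed

text \<open>The adjoint \<open>T = I - cnj c X\<^sup>*\<close> of \<open>I - c X\<close> is bounded below, so \<open>T v \<mapsto> \<langle>v, g\<rangle>\<close> is a well-defined
  bounded functional on its range; a vector \<open>f\<close> representing it satisfies \<open>(I - c X) f = g\<close>.\<close>

lemma contraction_perturbation_surj:
  assumes X: "bounded_operator H X" and contr: "\<And>f. f \<in> vecs H \<Longrightarrow> hnorm H (X f) \<le> hnorm H f"
    and c: "cmod c < 1" and g: "g \<in> vecs H"
  obtains f where "f \<in> vecs H" "f - cscale c (X f) = g"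
proof -
  let ?Y = "hadjoint H X"
  have Y: "bounded_operator H ?Y" using X by (rule bounded_operator_hadjoint)
  have Y_contr: "hnorm H (?Y f) \<le> hnorm H f" if "f \<in> vecs H" for f
    using hnorm_hadjoint_le[OF X that, of 1] contr by simp
  define T where "T v = v - cscale (cnj c) (?Y v)" for v
  have T_in: "T v \<in> vecs H" if "v \<in> vecs H" for v
    using that bounded_operatorD(1)[OF Y] by (simp add: T_def)
  have bound: "cmod (ip H v g) \<le> (hnorm H g / (1 - cmod c)) * hnorm H (T v)" if v: "v \<in> vecs H" for v
  proof -
    have "(1 - cmod c) * cmod (ip H v g) \<le> (1 - cmod c) * (hnorm H v * hnorm H g)"
      using Cauchy_Schwarz[OF v g] c by (intro mult_left_mono) auto
    also have "\<dots> \<le> hnorm H (T v) * hnorm H g"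
      using contraction_perturbation_bounded_below[OF Y Y_contr v, of "cnj c"] g
      by (auto simp: T_def mult.assoc[symmetric] intro!: mult_right_mono)
    finally show ?thesis using c by (simp add: field_simps)
  qed
  have T_add: "T (v + w) = T v + T w" and T_scale: "T (cscale d v) = cscale d (T v)"
    if "v \<in> vecs H" "w \<in> vecs H" for v w d
    using that bounded_operatorD[OF Y]
    by (simp_all add: T_def cfun.scale_right_distrib cfun.scale_right_diff_distrib mult_ac)
  obtain f where f: "f \<in> vecs H" "\<And>v. v \<in> vecs H \<Longrightarrow> ip H v g = ip H (T v) f"
    by (rule functional_represented_on_range[of "vecs H" T "\<lambda>v. ip H v g" "hnorm H g / (1 - cmod c)",
          OF subspace_vecs T_in T_add T_scale[OF _ g] _ _ bound]) (use g in simp_all)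
  have Xf: "X f \<in> vecs H" using bounded_operatorD(1)[OF X f(1)] .
  have "f - cscale c (X f) = g"
  proof (rule eq_if_ip_eq)
    fix v assume v: "v \<in> vecs H"
    have "ip H (?Y v) f = ip H v (X f)"
      using ip_hadjoint[OF X v f(1)] ip_commute v f(1) Xf hadjoint_in[OF X v] by metis
    then show "ip H v (f - cscale c (X f)) = ip H v g"
      using f v Xf hadjoint_in[OF X v] by (simp add: T_def)
  qed (use f Xf g in auto)
  then show ?thesis using that f by blast
qed

end

section \<open>Square roots\<close>

text \<open>The Taylor coefficients at 0 of the function \<open>x \<mapsto> sqrt (1 - x)\<close>. All but the first are nonpositive
  and the partial sums are nonnegative; hence the series converges absolutely on the closed unit disc.\<close>

definition sqrt_coeff :: "nat \<Rightarrow> real"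
  where "sqrt_coeff n = (- 1) ^ n * ((1 / 2) gchoose n)"

lemma sqrt_coeff_0 [simp]: "sqrt_coeff 0 = 1"
  by (simp add: sqrt_coeff_def)

text \<open>The ratio of consecutive terms; its sign determines the signs of the coefficients and of their
  partial sums.\<close>

lemma signed_gbinomial_Suc:
  fixes a :: real
  shows "(- 1) ^ Suc n * (a gchoose Suc n) = (of_nat n - a) / of_nat (Suc n) * ((- 1) ^ n * (a gchoose n))"
proof -
  have "of_nat (Suc n) * (a gchoose Suc n) = (a - of_nat n) * (a gchoose n)"
    using gbinomial_mult_1[of a n] by (simp add: algebra_simps)
  then have *: "(a gchoose Suc n) = (a - of_nat n) * (a gchoose n) / of_nat (Suc n)"
    by (simp add: nonzero_eq_divide_eq mult.commute del: of_nat_Suc)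
  show ?thesis unfolding * by (simp add: divide_simps) (simp add: algebra_simps)
qed

lemma sqrt_coeff_nonpos: "sqrt_coeff (Suc n) \<le> 0"
proof (induction n)
  case 0
  show ?case by (simp add: sqrt_coeff_def)
next
  case (Suc n)
  have "sqrt_coeff (Suc (Suc n)) = (of_nat (Suc n) - 1 / 2) / of_nat (Suc (Suc n)) * sqrt_coeff (Suc n)"
    unfolding sqrt_coeff_def by (rule signed_gbinomial_Suc)
  also have "\<dots> \<le> 0" using Suc.IH by (intro mult_nonneg_nonpos) auto
  finally show ?case .
qed

lemma sum_sqrt_coeff_nonneg: "0 \<le> (\<Sum>k\<le>n. sqrt_coeff k)"
proof -
  have "0 \<le> (- 1) ^ m * ((- 1 / 2 :: real) gchoose m)" for m
  proof (induction m)
    case (Suc m)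
    have "0 \<le> (of_nat m - (- 1 / 2 :: real)) / of_nat (Suc m)" by simp
    from mult_nonneg_nonneg[OF this Suc.IH] show ?case unfolding signed_gbinomial_Suc .
  qed simp
  moreover have "(\<Sum>k\<le>n. sqrt_coeff k) = (- 1) ^ n * ((- 1 / 2) gchoose n)"
    using gbinomial_sum_lower_neg[of "1 / 2 :: real" n] by (simp add: sqrt_coeff_def mult.commute)
  ultimately show ?thesis by simp
qed

lemma sum_abs_sqrt_coeff: "(\<Sum>k\<le>n. \<bar>sqrt_coeff k\<bar>) = 2 - (\<Sum>k\<le>n. sqrt_coeff k)"
  by (induction n) (use sqrt_coeff_nonpos in \<open>auto simp: abs_if order_less_le\<close>)

lemma sum_abs_sqrt_coeff_le: "(\<Sum>k<n. \<bar>sqrt_coeff k\<bar>) \<le> 2"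
proof -
  have "(\<Sum>k<n. \<bar>sqrt_coeff k\<bar>) \<le> (\<Sum>k\<le>n. \<bar>sqrt_coeff k\<bar>)" by (intro sum_mono2) auto
  then show ?thesis using sum_abs_sqrt_coeff[of n] sum_sqrt_coeff_nonneg[of n] by linarith
qed

lemma summable_abs_sqrt_coeff: "summable (\<lambda>k. \<bar>sqrt_coeff k\<bar>)"
proof (rule bounded_imp_summable)
  show "(\<Sum>k\<le>n. \<bar>sqrt_coeff k\<bar>) \<le> 2" for n
    using sum_abs_sqrt_coeff_le[of "Suc n"] by (simp add: lessThan_Suc_atMost)
qed simp

lemma suminf_abs_sqrt_coeff_le: "(\<Sum>k. \<bar>sqrt_coeff k\<bar>) \<le> 2"
  using summable_abs_sqrt_coeff sum_abs_sqrt_coeff_le by (intro suminf_le_const) auto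

lemma sqrt_coeff_square:
  "(\<Sum>i\<le>k. sqrt_coeff i * sqrt_coeff (k - i)) = (if k = 0 then 1 else if k = 1 then - 1 else 0)"
proof -
  have "(\<Sum>i\<le>k. sqrt_coeff i * sqrt_coeff (k - i))
      = (\<Sum>i\<le>k. (- 1) ^ k * (((1 / 2 :: real) gchoose i) * ((1 / 2) gchoose (k - i))))"
    by (rule sum.cong) (auto simp: sqrt_coeff_def mult_ac simp flip: power_add)
  also have "\<dots> = (- 1) ^ k * ((1 / 2 + 1 / 2 :: real) gchoose k)"
    by (simp add: gbinomial_Vandermonde sum_distrib_left[symmetric] atMost_atLeast0 del: field_sum_of_halves)
  also have "(1 / 2 + 1 / 2 :: real) = of_nat 1" by simp
  also have "(of_nat 1 :: real) gchoose k = of_nat (1 choose k)" by (rule binomial_gbinomial[symmetric])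
  finally show ?thesis by (auto simp: binomial_eq_0)
qed

text \<open>The Cauchy product of \<open>d\<close> with itself, with the power \<open>x ^ k\<close> replaced by a bounded sequence
  \<open>s k\<close>.\<close>

lemma suminf_convolution:
  fixes d :: "nat \<Rightarrow> real" and s :: "nat \<Rightarrow> complex"
  assumes d: "summable (\<lambda>n. \<bar>d n\<bar>)" and s: "\<And>n. cmod (s n) \<le> C"
  shows "(\<Sum>n. d n * (\<Sum>m. d m * s (n + m))) = (\<Sum>k. (\<Sum>i\<le>k. d i * d (k - i)) * s k)"
proof -
  have d_on: "(\<lambda>n. norm (d n)) summable_on UNIV"
    using d by (intro norm_summable_imp_summable_on) simp
  define F where "F = (\<lambda>(n, m). complex_of_real (d n) * (complex_of_real (d m) * s (n + m)))"
  have dd: "Infinite_Sum.abs_summable_on (\<lambda>(n, m). d n * d m) (UNIV \<times> UNIV)"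
    unfolding Infinite_Sum.abs_summable_on_Sigma_iff
  proof (intro conjI ballI)
    show "Infinite_Sum.abs_summable_on (\<lambda>m. case (n, m) of (n, m) \<Rightarrow> d n * d m) (UNIV)" for n
      using summable_on_cmult_right[OF d_on, of "\<bar>d n\<bar>"] by (simp add: abs_mult)
    show "Infinite_Sum.abs_summable_on (\<lambda>n. \<Sum>\<^sub>\<infinity>m. norm (case (n, m) of (n, m) \<Rightarrow> d n * d m)) (UNIV)"
      using summable_on_cmult_left[OF d_on, of "\<Sum>\<^sub>\<infinity>m. \<bar>d m\<bar>"]
      by (simp add: abs_mult infsum_cmult_right' infsum_nonneg)
  qed
  have "Infinite_Sum.abs_summable_on F (UNIV \<times> UNIV)"
  proof (rule Infinite_Sum.abs_summable_on_comparison_test)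
    show "Infinite_Sum.abs_summable_on (\<lambda>p. C * (case p of (n, m) \<Rightarrow> d n * d m)) (UNIV \<times> UNIV)"
      using summable_on_cmult_right[OF dd, of "\<bar>C\<bar>"] by (simp add: abs_mult case_prod_unfold)
    show "norm (F p) \<le> norm (C * (case p of (n, m) \<Rightarrow> d n * d m))" for p
    proof -
      have "\<bar>d (fst p) * d (snd p)\<bar> * cmod (s (fst p + snd p)) \<le> \<bar>d (fst p) * d (snd p)\<bar> * \<bar>C\<bar>"
        using s[of "fst p + snd p"] by (intro mult_left_mono) auto
      then show ?thesis by (simp add: F_def norm_mult abs_mult case_prod_unfold mult_ac)
    qed
  qed
  then have F: "F summable_on UNIV \<times> UNIV" by (rule abs_summable_summable)
  have F': "(\<lambda>(k, i). F (i, k - i)) summable_on Sigma UNIV (\<lambda>k. {..k})"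
    and eq: "(\<Sum>\<^sub>\<infinity>p\<in>UNIV \<times> UNIV. F p) = (\<Sum>\<^sub>\<infinity>(k, i)\<in>Sigma UNIV (\<lambda>k. {..k}). F (i, k - i))"
    using F summable_on_reindex_bij_witness[of "UNIV \<times> UNIV" "\<lambda>(k, i). (i, k - i)" "\<lambda>(n, m). (n + m, n)" "Sigma UNIV (\<lambda>k. {..k})"
        "\<lambda>(k, i). F (i, k - i)" F]
      infsum_reindex_bij_witness[of "UNIV \<times> UNIV" "\<lambda>(k, i). (i, k - i)" "\<lambda>(n, m). (n + m, n)" "Sigma UNIV (\<lambda>k. {..k})"
        "\<lambda>(k, i). F (i, k - i)" F]
    by auto
  have sum_eq: "(\<Sum>\<^sub>\<infinity>n. f n) = (\<Sum>n. f n)" if "f summable_on UNIV" for f :: "nat \<Rightarrow> complex"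
    using has_sum_imp_sums[OF has_sum_infsum[OF that]] by (simp add: sums_iff)
  have inner: "(\<lambda>m. F (n, m)) summable_on UNIV" for n
    using summable_on_SigmaD1[of "\<lambda>n m. F (n, m)" UNIV "\<lambda>_. UNIV" n] F by simp
  have outer: "(\<lambda>n. \<Sum>\<^sub>\<infinity>m. F (n, m)) summable_on UNIV"
    using summable_on_Sigma_banach[of "\<lambda>n m. F (n, m)" UNIV "\<lambda>_. UNIV"] F by simp
  have d_s: "summable (\<lambda>m. complex_of_real (d m) * s (n + m))" for n
  proof (rule summable_comparison_test)
    show "\<exists>N. \<forall>m\<ge>N. norm (complex_of_real (d m) * s (n + m)) \<le> \<bar>d m\<bar> * C"
      using s by (auto simp: norm_mult intro!: mult_left_mono)
    show "summable (\<lambda>m. \<bar>d m\<bar> * C)" using d by (rule summable_mult2)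
  qed
  have "(\<Sum>\<^sub>\<infinity>p\<in>UNIV \<times> UNIV. F p) = (\<Sum>\<^sub>\<infinity>n. \<Sum>\<^sub>\<infinity>m. F (n, m))"
    using infsum_Sigma'_banach[of "\<lambda>n m. F (n, m)" UNIV "\<lambda>_. UNIV"] F by simp
  also have "\<dots> = (\<Sum>n. \<Sum>m. F (n, m))" using sum_eq[OF outer] sum_eq[OF inner] by simp
  also have "\<dots> = (\<Sum>n. d n * (\<Sum>m. d m * s (n + m)))"
    using suminf_mult[OF d_s] by (simp add: F_def)
  finally have 1: "(\<Sum>\<^sub>\<infinity>p\<in>UNIV \<times> UNIV. F p) = (\<Sum>n. d n * (\<Sum>m. d m * s (n + m)))" .
  have outer': "(\<lambda>k. \<Sum>\<^sub>\<infinity>i\<in>{..k}. F (i, k - i)) summable_on UNIV"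
    using summable_on_Sigma_banach[of "\<lambda>k i. F (i, k - i)" UNIV "\<lambda>k. {..k}"] F' by simp
  have "(\<Sum>\<^sub>\<infinity>p\<in>UNIV \<times> UNIV. F p) = (\<Sum>\<^sub>\<infinity>k. \<Sum>\<^sub>\<infinity>i\<in>{..k}. F (i, k - i))"
    using infsum_Sigma'_banach[of "\<lambda>k i. F (i, k - i)" UNIV "\<lambda>k. {..k}"] F' eq by simp
  also have "\<dots> = (\<Sum>k. \<Sum>i\<le>k. F (i, k - i))" using sum_eq[OF outer'] by simp
  also have "\<dots> = (\<Sum>k. (\<Sum>i\<le>k. d i * d (k - i)) * s k)"
    by (simp add: F_def sum_distrib_left mult_ac)
  finally show ?thesis using 1 by simp
qed

context hilbert_functions
begin

lemma positive_operator_ip_commute: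
  assumes R: "positive_operator H R" and f: "f \<in> vecs H" and g: "g \<in> vecs H"
  shows "ip H (R f) g = ip H f (R g)"
proof -
  have B: "bounded_operator H R" and real: "Im (ip H (R h) h) = 0" if "h \<in> vecs H" for h
    using R that by (auto simp: positive_operator_def complex_is_Real_iff)
  note B = B[OF f] note RD = bounded_operatorD[OF B]
  have Rf: "R f \<in> vecs H" and Rg: "R g \<in> vecs H" using RD f g by auto
  \<comment> \<open>Polarization along f + g and f + i g.\<close>
  have "Im (ip H (R f) g + ip H (R g) f) = 0"
    using real[of "f + g"] real[OF f] real[OF g] f g Rf Rg RD by simp
  moreover have "Im (ip H (R f) (cscale \<i> g) + ip H (R (cscale \<i> g)) f) = 0"
    using real[of "f + cscale \<i> g"] real[OF f] real[of "cscale \<i> g"] f g Rf Rg RD by simp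
  then have "Re (ip H (R f) g) = Re (ip H (R g) f)" using f g Rf Rg RD by simp
  ultimately show ?thesis using ip_commute[OF Rg f] by (simp add: complex_eq_iff)
qed

text \<open>The square root of \<open>I - A\<close> is the binomial series \<open>R = (\<Sum>n. sqrt_coeff n A\<^sup>n)\<close>. It is read weakly,
  through the bounded sesquilinear form \<open>\<langle>f, R g\<rangle> = (\<Sum>n. sqrt_coeff n \<langle>A\<^sup>n f, g\<rangle>)\<close>, so that the Riesz
  theorem provides \<open>R\<close> and only numerical series have to converge. Positivity follows from
  \<open>\<langle>A\<^sup>n f, f\<rangle> \<le> \<parallel>f\<parallel>\<^sup>2\<close> and the signs of the coefficients.\<close>

lemma positive_square_root_exists:
  assumes A: "bounded_operator H A" and contr: "\<And>f. f \<in> vecs H \<Longrightarrow> hnorm H (A f) \<le> hnorm H f"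
    and sym: "\<And>f g. f \<in> vecs H \<Longrightarrow> g \<in> vecs H \<Longrightarrow> ip H (A f) g = ip H f (A g)"
  obtains R where "positive_operator H R" "\<And>f. f \<in> vecs H \<Longrightarrow> R (R f) = f - A f"
proof -
  note AD = bounded_operatorD[OF A]
  have An: "(A ^^ n) f \<in> vecs H" if "f \<in> vecs H" for n f
    using that AD(1) by (induction n) auto
  have An_contr: "hnorm H ((A ^^ n) f) \<le> hnorm H f" if "f \<in> vecs H" for n f
    by (induction n) (use contr An that in \<open>auto intro: order_trans\<close>)
  have An_add: "(A ^^ n) (f + g) = (A ^^ n) f + (A ^^ n) g" if "f \<in> vecs H" "g \<in> vecs H" for n f g
  proof (induction n)
    case (Suc n)
    show ?case by (simp only: funpow.simps comp_apply Suc.IH AD(2)[OF An An] that)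
  qed simp
  have An_scale: "(A ^^ n) (cscale c f) = cscale c ((A ^^ n) f)" if "f \<in> vecs H" for n c f
  proof (induction n)
    case (Suc n)
    show ?case by (simp only: funpow.simps comp_apply Suc.IH AD(3)[OF An] that)
  qed simp
  have An_sym: "ip H ((A ^^ n) f) g = ip H f ((A ^^ n) g)" if "f \<in> vecs H" "g \<in> vecs H" for n f g
    using that
  proof (induction n arbitrary: g)
    case (Suc n)
    have "ip H ((A ^^ Suc n) f) g = ip H ((A ^^ n) f) (A g)" using sym An Suc.prems by simp
    also have "\<dots> = ip H f ((A ^^ Suc n) g)"
      using Suc.IH[of "A g"] Suc.prems AD(1) by (simp add: funpow_swap1)
    finally show ?case .
  qed simp
  have s_bound: "cmod (ip H ((A ^^ n) f) g) \<le> hnorm H f * hnorm H g" if "f \<in> vecs H" "g \<in> vecs H" for n f g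
    using Cauchy_Schwarz[OF An[OF that(1)] that(2)] mult_right_mono[OF An_contr[OF that(1)] hnorm_nonneg[OF that(2)]]
    by (rule order_trans)
  define t where "t f g n = complex_of_real (sqrt_coeff n) * ip H ((A ^^ n) f) g" for f g n
  have t_bound: "norm (t f g n) \<le> \<bar>sqrt_coeff n\<bar> * (hnorm H f * hnorm H g)" if "f \<in> vecs H" "g \<in> vecs H" for f g n
    using s_bound[OF that] by (auto simp: t_def norm_mult intro!: mult_left_mono)
  have t_maj: "summable (\<lambda>n. \<bar>sqrt_coeff n\<bar> * c)" for c
    using summable_abs_sqrt_coeff by (rule summable_mult2)
  have t_norm: "summable (\<lambda>n. norm (t f g n))" if "f \<in> vecs H" "g \<in> vecs H" for f g
    using t_bound[OF that] by (intro summable_comparison_test[OF _ t_maj]) auto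
  then have t: "summable (t f g)" if "f \<in> vecs H" "g \<in> vecs H" for f g
    using that summable_norm_cancel by blast
  have t_sum_bound: "cmod (suminf (t f g)) \<le> 2 * hnorm H g * hnorm H f" if "f \<in> vecs H" "g \<in> vecs H" for f g
  proof -
    have "cmod (suminf (t f g)) \<le> (\<Sum>n. norm (t f g n))" using that by (intro summable_norm t_norm)
    also have "\<dots> \<le> (\<Sum>n. \<bar>sqrt_coeff n\<bar> * (hnorm H f * hnorm H g))"
      using t_bound[OF that] by (intro suminf_le t_norm that t_maj)
    also have "\<dots> = (\<Sum>n. \<bar>sqrt_coeff n\<bar>) * (hnorm H f * hnorm H g)"
      using summable_abs_sqrt_coeff by (rule suminf_mult2[symmetric])
    also have "\<dots> \<le> 2 * (hnorm H f * hnorm H g)"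
      using suminf_abs_sqrt_coeff_le that by (intro mult_right_mono) auto
    finally show ?thesis by (simp add: mult_ac)
  qed
  have "\<exists>r\<in>vecs H. \<forall>f\<in>vecs H. suminf (t f g) = ip H f r" if g: "g \<in> vecs H" for g
  proof -
    have "suminf (t (f + f') g) = suminf (t f g) + suminf (t f' g)" if "f \<in> vecs H" "f' \<in> vecs H" for f f'
    proof -
      have "t (f + f') g = (\<lambda>n. t f g n + t f' g n)"
        using that g An by (intro ext) (simp add: t_def An_add distrib_left)
      then show ?thesis using suminf_add[OF t[OF that(1) g] t[OF that(2) g]] by simp
    qed
    moreover have "suminf (t (cscale c f) g) = c * suminf (t f g)" if "f \<in> vecs H" for f c
    proof -
      have "t (cscale c f) g = (\<lambda>n. c * t f g n)"
        using that g An by (intro ext) (simp add: t_def An_scale)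
      then show ?thesis using suminf_mult[OF t[OF that g]] by simp
    qed
    ultimately show ?thesis
      by (rule Riesz[of "\<lambda>f. suminf (t f g)" "2 * hnorm H g"]) (use t_sum_bound g in auto)
  qed
  then obtain R where R: "\<And>g. g \<in> vecs H \<Longrightarrow> R g \<in> vecs H"
    and ip_R: "\<And>f g. f \<in> vecs H \<Longrightarrow> g \<in> vecs H \<Longrightarrow> ip H f (R g) = suminf (t f g)" by metis
  have R_bounded: "bounded_operator H R"
  proof (rule bounded_operatorI)
    fix f g c assume f: "f \<in> vecs H" and g: "g \<in> vecs H"
    show "R f \<in> vecs H" using f by (rule R)
    show "R (f + g) = R f + R g"
    proof (rule eq_if_ip_eq)
      fix h assume h: "h \<in> vecs H"
      have "t h (f + g) = (\<lambda>n. t h f n + t h g n)"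
        using f g An[OF h] by (intro ext) (simp add: t_def distrib_left)
      then have "suminf (t h (f + g)) = suminf (t h f) + suminf (t h g)"
        using suminf_add[OF t[OF h f] t[OF h g]] by simp
      then show "ip H h (R (f + g)) = ip H h (R f + R g)" using f g h R ip_R by simp
    qed (use f g R in auto)
    show "R (cscale c f) = cscale c (R f)"
    proof (rule eq_if_ip_eq)
      fix h assume h: "h \<in> vecs H"
      have "t h (cscale c f) = (\<lambda>n. cnj c * t h f n)"
        using f An[OF h] by (intro ext) (simp add: t_def)
      then have "suminf (t h (cscale c f)) = cnj c * suminf (t h f)"
        using suminf_mult[OF t[OF h f]] by simp
      then show "ip H h (R (cscale c f)) = ip H h (cscale c (R f))" using f h R ip_R by simp
    qed (use f R in auto)
    have "hnorm H (R f) * hnorm H (R f) = cmod (ip H (R f) (R f))"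
      using ip_self[OF R[OF f]] by (simp add: norm_power power2_eq_square norm_mult)
    also have "\<dots> \<le> 2 * hnorm H f * hnorm H (R f)"
      using t_sum_bound[OF R[OF f] f] ip_R[OF R[OF f] f] by simp
    finally show "hnorm H (R f) \<le> 2 * hnorm H f"
      using hnorm_nonneg[OF R[OF f]] hnorm_nonneg[OF f]
      by (cases "hnorm H (R f) = 0") (auto simp: mult_le_cancel_right)
  qed
  have R_pos: "ip H (R f) f \<in> \<real> \<and> 0 \<le> Re (ip H (R f) f)" if f: "f \<in> vecs H" for f
  proof -
    define r where "r n = Re (ip H ((A ^^ n) f) f)" for n
    have r: "ip H ((A ^^ n) f) f = of_real (r n)" for n
      using An_sym[OF f f, of n] ip_commute[OF An[OF f] f, of n] by (simp add: r_def complex_eq_iff)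
    have r_le: "r n \<le> (hnorm H f)\<^sup>2" for n
      using s_bound[OF f f, of n] complex_Re_le_cmod[of "ip H ((A ^^ n) f) f"] by (simp add: r_def power2_eq_square)
    have tr: "t f f n = of_real (sqrt_coeff n * r n)" for n by (simp add: t_def r)
    have "summable (\<lambda>n. complex_of_real (sqrt_coeff n * r n))" using t[OF f f] unfolding tr[abs_def] .
    then have sr: "summable (\<lambda>n. sqrt_coeff n * r n)" by (simp only: summable_complex_of_real)
    have part: "0 \<le> (\<Sum>k\<le>n. sqrt_coeff k * r k)" for n
    proof -
      have "(\<Sum>k\<le>n. sqrt_coeff k) * (hnorm H f)\<^sup>2 = (\<Sum>k\<le>n. sqrt_coeff k * (hnorm H f)\<^sup>2)"
        by (rule sum_distrib_right)
      also have "\<dots> \<le> (\<Sum>k\<le>n. sqrt_coeff k * r k)"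
      proof (rule sum_mono)
        fix k
        show "sqrt_coeff k * (hnorm H f)\<^sup>2 \<le> sqrt_coeff k * r k"
        proof (cases k)
          case 0
          then show ?thesis using ip_self[OF f] by (simp add: r_def)
        next
          case (Suc j)
          then show ?thesis using sqrt_coeff_nonpos[of j] r_le[of k] by (simp add: mult_left_mono_neg)
        qed
      qed
      finally show ?thesis using sum_sqrt_coeff_nonneg[of n] by (smt (verit) zero_le_power2 mult_nonneg_nonneg)
    qed
    have "0 \<le> (\<Sum>n. sqrt_coeff n * r n)"
      using part by (intro LIMSEQ_le_const[OF summable_LIMSEQ'[OF sr]]) blast
    moreover have "ip H f (R f) = of_real (\<Sum>n. sqrt_coeff n * r n)"
      using suminf_of_real[OF sr, where 'a = complex] f ip_R by (simp add: tr[abs_def])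
    ultimately show ?thesis using ip_commute[OF f R[OF f]] by simp
  qed
  have "R (R g) = g - A g" if g: "g \<in> vecs H" for g
  proof (rule eq_if_ip_eq)
    fix f assume f: "f \<in> vecs H"
    have "ip H f (R (R g)) = (\<Sum>n. sqrt_coeff n * (\<Sum>m. sqrt_coeff m * ip H ((A ^^ (n + m)) f) g))"
    proof -
      have "(A ^^ (n + m)) f = (A ^^ m) ((A ^^ n) f)" for n m
        by (simp add: add.commute[of n] funpow_add)
      then show ?thesis using f g R An ip_R by (simp add: t_def[abs_def])
    qed
    also have "\<dots> = (\<Sum>k. (\<Sum>i\<le>k. sqrt_coeff i * sqrt_coeff (k - i)) * ip H ((A ^^ k) f) g)"
      using summable_abs_sqrt_coeff s_bound[OF f g] by (rule suminf_convolution)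
    also have "\<dots> = (\<Sum>k\<in>{0, 1}. (\<Sum>i\<le>k. sqrt_coeff i * sqrt_coeff (k - i)) * ip H ((A ^^ k) f) g)"
      by (rule suminf_finite) (auto simp: sqrt_coeff_square)
    also have "\<dots> = ip H f (g - A g)"
      unfolding sqrt_coeff_square using f g sym AD(1) by simp
    finally show "ip H f (R (R g)) = ip H f (g - A g)" .
  qed (use g R AD in auto)
  then show ?thesis using that[of R] R_bounded R_pos unfolding positive_operator_def by blast
qed

end

section \<open>Operator ranges\<close>

text \<open>The range of \<open>R\<close> with the norm that makes \<open>R\<close> a partial isometry onto it: \<open>range_lift H R u\<close> is the
  preimage of \<open>u\<close> orthogonal to the kernel. The de Branges--Rovnyak space of \<open>b\<close> is the case
  \<open>R = (I - T\<^sub>b T\<^sub>b\<^sup>*)\<^sup>1\<^sup>/\<^sup>2\<close>.\<close>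

definition range_lift :: "'x inner_space \<Rightarrow> 'x operator \<Rightarrow> 'x operator"
  where "range_lift H R u = (THE f. f \<in> hcomplement H (hkernel H R) \<and> R f = u)"

definition operator_range :: "'x inner_space \<Rightarrow> 'x operator \<Rightarrow> 'x inner_space"
  where "operator_range H R =
    \<lparr>vecs = R ` vecs H, ip = (\<lambda>u v. ip H (range_lift H R u) (range_lift H R v))\<rparr>"

lemma operator_range_sel:
  "vecs (operator_range H R) = R ` vecs H"
  "ip (operator_range H R) u v = ip H (range_lift H R u) (range_lift H R v)"
  "hnorm (operator_range H R) u = hnorm H (range_lift H R u)"
  by (simp_all add: operator_range_def hnorm_def)

locale hilbert_operator = hilbert_functions H for H :: "'x inner_space" +
  fixes R :: "'x operator"
  assumes R_bounded: "bounded_operator H R"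
begin

abbreviation "lift \<equiv> range_lift H R"
abbreviation "Rng \<equiv> operator_range H R"

lemmas RD = bounded_operatorD[OF R_bounded]

lemma kernel_subspace: "cfun.subspace (hkernel H R)"
  using RD bounded_operator_zero[OF R_bounded]
  by (intro cfun.subspaceI) (auto simp: hkernel_def)

lemma hcomplement_closed:
  assumes "M \<subseteq> vecs H"
  shows "f \<in> hcomplement H M \<Longrightarrow> g \<in> hcomplement H M \<Longrightarrow> f + g \<in> hcomplement H M"
    and "f \<in> hcomplement H M \<Longrightarrow> g \<in> hcomplement H M \<Longrightarrow> f - g \<in> hcomplement H M"
    and "f \<in> hcomplement H M \<Longrightarrow> cscale c f \<in> hcomplement H M"
  using assms by (auto simp: hcomplement_def subset_iff)

lemma complement_inter_kernel:
  "f \<in> hcomplement H (hkernel H R) \<Longrightarrow> R f = 0 \<Longrightarrow> f = 0"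
  by (auto simp: hcomplement_def hkernel_def intro: ip_definite)

lemma range_lift_ex1:
  assumes "f \<in> vecs H"
  shows "\<exists>!p. p \<in> hcomplement H (hkernel H R) \<and> R p = R f"
proof -
  have sub: "hkernel H R \<subseteq> vecs H" by (auto simp: hkernel_def)
  obtain p s where p: "p \<in> vecs H" and s: "\<And>n. s n \<in> hkernel H R" and lim: "(\<lambda>n. hnorm H (s n - p)) \<longlonglongrightarrow> 0"
    and orth: "\<And>v. v \<in> hkernel H R \<Longrightarrow> ip H v (f - p) = 0"
    using orthogonal_projection[OF kernel_subspace sub assms] by blast
  have s': "s n \<in> vecs H" "R (s n) = 0" for n using s by (auto simp: hkernel_def)
  have "(\<lambda>n. hnorm H (R (s n) - R p)) \<longlonglongrightarrow> 0"
    using R_bounded s'(1) p lim by (rule tendsto_bounded_operator)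
  then have "hnorm H (0 - R p) = 0" by (simp add: s'(2) LIMSEQ_const_iff)
  then have "0 - R p = 0" using hnorm_eq_0_iff[OF vecs_closed(3)[OF vecs_closed(1) RD(1)[OF p]]] by blast
  then have "R p = 0" by simp
  then have "R (f - p) = R f" using bounded_operator_diff[OF R_bounded assms p] by simp
  moreover have "f - p \<in> hcomplement H (hkernel H R)"
    using orth assms p ip_commute[of _ "f - p"] sub by (auto simp: hcomplement_def subset_iff)
  moreover have "q = q'" if "q \<in> hcomplement H (hkernel H R)" "R q = R f"
    "q' \<in> hcomplement H (hkernel H R)" "R q' = R f" for q q'
  proof -
    have "R (q - q') = 0" using that bounded_operator_diff[OF R_bounded, of q q'] by (simp add: hcomplement_def)
    then have "q - q' = 0" by (rule complement_inter_kernel[OF hcomplement_closed(2)[OF sub that(1,3)]])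
    then show ?thesis by simp
  qed
  ultimately show ?thesis by metis
qed

lemma
  assumes "u \<in> vecs Rng"
  shows lift_complement: "lift u \<in> hcomplement H (hkernel H R)"
    and lift_in: "lift u \<in> vecs H"
    and R_lift: "R (lift u) = u"
proof -
  obtain f where f: "f \<in> vecs H" "u = R f" using assms by (auto simp: operator_range_sel)
  have "lift u \<in> hcomplement H (hkernel H R) \<and> R (lift u) = u"
    unfolding range_lift_def f(2) by (rule theI'[OF range_lift_ex1[OF f(1)]])
  then show "lift u \<in> hcomplement H (hkernel H R)" "lift u \<in> vecs H" "R (lift u) = u"
    by (auto simp: hcomplement_def)
qed

lemma lift_eqI:
  assumes p: "p \<in> hcomplement H (hkernel H R)"
  shows "lift (R p) = p"
proof -
  have "p \<in> vecs H" using p by (simp add: hcomplement_def)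
  from the1_equality[OF range_lift_ex1[OF this]] p show ?thesis by (simp add: range_lift_def)
qed

lemma lift_linear:
  assumes "u \<in> vecs Rng" "v \<in> vecs Rng"
  shows "lift (u + v) = lift u + lift v" "lift (u - v) = lift u - lift v"
    "lift (cscale c u) = cscale c (lift u)"
proof -
  have sub: "hkernel H R \<subseteq> vecs H" by (auto simp: hkernel_def)
  note cl = hcomplement_closed[OF sub] and l = lift_complement[OF assms(1)] lift_complement[OF assms(2)]
  note R = R_lift[OF assms(1)] R_lift[OF assms(2)] and i = lift_in[OF assms(1)] lift_in[OF assms(2)]
  show "lift (u + v) = lift u + lift v"
    using lift_eqI[OF cl(1)[OF l]] RD(2)[OF i] R by simp
  show "lift (u - v) = lift u - lift v"
    using lift_eqI[OF cl(2)[OF l]] bounded_operator_diff[OF R_bounded i] R by simp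
  show "lift (cscale c u) = cscale c (lift u)"
    using lift_eqI[OF cl(3)[OF l(1)]] RD(3)[OF i(1)] R by simp
qed

lemma ip_range_left:
  assumes f: "f \<in> vecs H" and u: "u \<in> vecs Rng"
  shows "ip Rng (R f) u = ip H f (lift u)"
proof -
  have Rf: "R f \<in> vecs Rng" using f by (simp add: operator_range_sel)
  have "R (f - lift (R f)) = 0"
    using bounded_operator_diff[OF R_bounded f lift_in[OF Rf]] R_lift[OF Rf] by simp
  then have "f - lift (R f) \<in> hkernel H R" using f lift_in[OF Rf] by (simp add: hkernel_def)
  then have "ip H (lift u) (f - lift (R f)) = 0" using lift_complement[OF u] by (simp add: hcomplement_def)
  then have "ip H (f - lift (R f)) (lift u) = 0"
    using ip_commute[of "lift u" "f - lift (R f)"] lift_in[OF u] lift_in[OF Rf] f by simp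
  then show ?thesis using f lift_in[OF u] lift_in[OF Rf] by (simp add: operator_range_sel)
qed

lemma hnorm_range_le:
  assumes f: "f \<in> vecs H"
  shows "hnorm Rng (R f) \<le> hnorm H f"
proof -
  have Rf: "R f \<in> vecs Rng" using f by (simp add: operator_range_sel)
  let ?p = "lift (R f)"
  have p: "?p \<in> vecs H" using Rf by (rule lift_in)
  have "complex_of_real ((hnorm H ?p)\<^sup>2) = ip H f ?p"
    using ip_range_left[OF f Rf] ip_self[OF p] by (simp add: operator_range_sel)
  then have "(hnorm H ?p)\<^sup>2 = cmod (ip H f ?p)" by (metis norm_of_real abs_power2)
  also have "\<dots> \<le> hnorm H f * hnorm H ?p" using f p by (rule Cauchy_Schwarz)
  finally have "hnorm H ?p * hnorm H ?p \<le> hnorm H f * hnorm H ?p" by (simp add: power2_eq_square)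
  then show ?thesis using hnorm_nonneg[OF p] hnorm_nonneg[OF f]
    by (cases "hnorm H ?p = 0") (auto simp: operator_range_sel)
qed

lemma vecs_range_subset: "vecs Rng \<subseteq> vecs H"
  using RD(1) by (auto simp: operator_range_sel)

lemma range_inner_space: "complex_inner_space Rng"
proof -
  have sub: "cfun.subspace (vecs Rng)"
  proof (rule cfun.subspaceI)
    show "0 \<in> vecs Rng"
      using bounded_operator_zero[OF R_bounded] vecs_closed(1) unfolding operator_range_sel by (metis imageI)
    fix u v c assume u: "u \<in> vecs Rng" and v: "v \<in> vecs Rng"
    then show "u + v \<in> vecs Rng"
      using RD(2)[OF lift_in[OF u] lift_in[OF v]] R_lift[OF u] R_lift[OF v] lift_in
      unfolding operator_range_sel(1) by (metis imageI vecs_closed(2) operator_range_sel(1))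
    show "cscale c u \<in> vecs Rng"
      using RD(3)[OF lift_in[OF u]] R_lift[OF u] lift_in[OF u]
      unfolding operator_range_sel(1) by (metis imageI vecs_closed(4))
  qed
  show ?thesis
    unfolding complex_inner_space_def
  proof (intro conjI ballI allI impI)
    show "cfun.subspace (vecs Rng)" by fact
    fix u v w c assume u: "u \<in> vecs Rng" and v: "v \<in> vecs Rng"
    show "ip Rng (cscale c u) v = c * ip Rng u v"
      using lift_linear[OF u v] lift_in[OF u] lift_in[OF v] by (simp add: operator_range_sel)
    show "ip Rng v u = cnj (ip Rng u v)"
      using ip_commute[OF lift_in[OF u] lift_in[OF v]] by (simp add: operator_range_sel)
    show "0 \<le> Re (ip Rng u u)" using ip_self_Re lift_in[OF u] by (simp add: operator_range_sel)
    show "ip Rng (u + v) w = ip Rng u w + ip Rng v w" if w: "w \<in> vecs Rng"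
      using lift_linear[OF u v] lift_in[OF u] lift_in[OF v] lift_in[OF w] by (simp add: operator_range_sel)
    show "u = 0" if "ip Rng u u = 0"
      using ip_definite[OF lift_in[OF u]] that R_lift[OF u] bounded_operator_zero[OF R_bounded]
      by (simp add: operator_range_sel)
  qed
qed

sublocale rng: inner_product_functions Rng
  by unfold_locales (rule range_inner_space)

sublocale rng: hilbert_functions Rng
proof unfold_locales
  show "rng.mcomplete"
  proof (rule rng.mcompleteI)
    fix s :: "nat \<Rightarrow> 'x \<Rightarrow> complex" assume s: "\<And>n. s n \<in> vecs Rng"
      and cauchy: "\<forall>e>0. \<exists>N. \<forall>m\<ge>N. \<forall>n\<ge>N. hnorm Rng (s m - s n) < e"
    have "hnorm Rng (s m - s n) = hnorm H (lift (s m) - lift (s n))" for m n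
      by (simp add: operator_range_sel(3) lift_linear s)
    then obtain p where p: "p \<in> vecs H" and lim: "(\<lambda>n. hnorm H (lift (s n) - p)) \<longlonglongrightarrow> 0"
      using Cauchy_converges[of "\<lambda>n. lift (s n)"] lift_in[OF s] cauchy by auto
    have Rp: "R p \<in> vecs Rng" using p by (simp add: operator_range_sel)
    have bound: "hnorm Rng (s n - R p) \<le> hnorm H (lift (s n) - p)" for n
      using hnorm_range_le[of "lift (s n) - p"] bounded_operator_diff[OF R_bounded lift_in[OF s] p]
        R_lift[OF s] lift_in[OF s] p by simp
    have "(\<lambda>n. hnorm Rng (s n - R p)) \<longlonglongrightarrow> 0"
      using rng.hnorm_nonneg[OF rng.vecs_closed(3)[OF s Rp]] bound
      by (intro tendsto_sandwich[OF _ _ tendsto_const lim] always_eventually) auto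
    then show "\<exists>u\<in>vecs Rng. (\<lambda>n. hnorm Rng (s n - u)) \<longlonglongrightarrow> 0" using Rp by blast
  qed
qed

lemma range_separable:
  fixes e :: "nat \<Rightarrow> 'x \<Rightarrow> complex"
  assumes e: "\<And>n. e n \<in> vecs H"
    and dense: "\<And>f r. f \<in> vecs H \<Longrightarrow> r > 0 \<Longrightarrow>
      \<exists>N a. hnorm H (f - (\<Sum>n<N. cscale (a n) (e n))) < r"
  shows "separable_space (htopology Rng)"
proof (rule rng.separable_if_sequence_total)
  show "R (e n) \<in> vecs Rng" for n using e by (simp add: operator_range_sel)
  fix u r assume u: "u \<in> vecs Rng" and r: "0 < (r::real)"
  obtain N a where N: "hnorm H (lift u - (\<Sum>n<N. cscale (a n) (e n))) < r"
    using dense[OF lift_in[OF u] r] by blast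
  have sum_in: "(\<Sum>n<N. cscale (a n) (e n)) \<in> vecs H" for N
    using e by (intro cfun.subspace_sum[OF subspace_vecs]) auto
  have "R (\<Sum>n<N. cscale (a n) (e n)) = (\<Sum>n<N. cscale (a n) (R (e n)))" for N
  proof (induction N)
    case 0
    show ?case using bounded_operator_zero[OF R_bounded] by (simp flip: zero_fun_def)
  next
    case (Suc N)
    then show ?case by (simp only: sum.lessThan_Suc RD(2)[OF sum_in vecs_closed(4)[OF e]] RD(3)[OF e])
  qed
  then have "R (lift u - (\<Sum>n<N. cscale (a n) (e n))) = u - (\<Sum>n<N. cscale (a n) (R (e n)))"
    using bounded_operator_diff[OF R_bounded lift_in[OF u] sum_in] R_lift[OF u] by simp
  then have "hnorm Rng (u - (\<Sum>n<N. cscale (a n) (R (e n)))) < r"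
    using N hnorm_range_le[OF vecs_closed(3)[OF lift_in[OF u] sum_in[of N]]] by simp
  then show "\<exists>N a. hnorm Rng (u - (\<Sum>n<N. cscale (a n) (R (e n)))) < r" by blast
qed

end

text \<open>Membership in the range of \<open>R = (I - B B\<^sup>*)\<^sup>1\<^sup>/\<^sup>2\<close>, and the norm there, can be read off from the
  operator \<open>B\<close> alone: \<open>\<parallel>f\<parallel>\<^sup>2\<close> in the range is the supremum over \<open>g\<close> of \<open>\<parallel>f + B g\<parallel>\<^sup>2 - \<parallel>g\<parallel>\<^sup>2\<close>. All
  later estimates use this description instead of \<open>R\<close>.\<close>

locale defect_operator = hilbert_operator H R for H :: "'x inner_space" and R +
  fixes B :: "'x operator"
  assumes B_bounded: "bounded_operator H B"
    and R_positive: "positive_operator H R"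
    and R_square: "\<And>f. f \<in> vecs H \<Longrightarrow> R (R f) = f - B (hadjoint H B f)"
begin

lemmas BD = bounded_operatorD[OF B_bounded]
lemmas B_adj = hadjoint_in[OF B_bounded] ip_hadjoint[OF B_bounded]

lemma hnorm_defect_sq:
  assumes w: "w \<in> vecs H"
  shows "(hnorm H (R w))\<^sup>2 + (hnorm H (hadjoint H B w))\<^sup>2 = (hnorm H w)\<^sup>2"
proof -
  have "complex_of_real ((hnorm H (R w))\<^sup>2) = ip H w (R (R w))"
    using positive_operator_ip_commute[OF R_positive w RD(1)[OF w]] ip_self[OF RD(1)[OF w]] by simp
  also have "\<dots> = ip H w w - ip H w (B (hadjoint H B w))"
    using w B_adj(1)[OF w] BD(1) by (simp add: R_square)
  also have "ip H w (B (hadjoint H B w)) = cnj (ip H (B (hadjoint H B w)) w)"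
    using w BD(1)[OF B_adj(1)[OF w]] by (intro ip_commute)
  also have "\<dots> = cnj (ip H (hadjoint H B w) (hadjoint H B w))"
    using B_adj(2)[OF w B_adj(1)[OF w]] by simp
  finally have "complex_of_real ((hnorm H (R w))\<^sup>2) = of_real ((hnorm H w)\<^sup>2 - (hnorm H (hadjoint H B w))\<^sup>2)"
    using ip_self[OF w] ip_self[OF B_adj(1)[OF w]] by simp
  then show ?thesis unfolding of_real_eq_iff by simp
qed

text \<open>Since \<open>R\<^sup>2 + B B\<^sup>* = I\<close>, the row operator \<open>(p, g) \<mapsto> R p + B g\<close> is the adjoint of the isometry
  \<open>w \<mapsto> (R w, B\<^sup>* w)\<close>, hence a contraction.\<close>

lemma hnorm_add_range_le:
  assumes u: "u \<in> vecs Rng" and g: "g \<in> vecs H"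
  shows "(hnorm H (u + B g))\<^sup>2 \<le> (hnorm H g)\<^sup>2 + (hnorm Rng u)\<^sup>2"
proof -
  define p where "p = lift u"
  have p: "p \<in> vecs H" "R p = u" using u by (simp_all add: p_def lift_in R_lift)
  define w where "w = u + B g"
  have uH: "u \<in> vecs H" using p RD(1) by blast
  have Bg: "B g \<in> vecs H" using BD(1)[OF g] .
  have w: "w \<in> vecs H" unfolding w_def using uH Bg by (rule vecs_closed)
  have Rw: "R w \<in> vecs H" and Bw: "hadjoint H B w \<in> vecs H" using RD(1)[OF w] B_adj(1)[OF w] .
  have "ip H p (R w) + ip H g (hadjoint H B w) = ip H w w"
    using positive_operator_ip_commute[OF R_positive p(1) w] B_adj(2)[OF w g] p(2) uH Bg w
    by (simp add: w_def)
  then have cross: "Re (ip H p (R w)) + Re (ip H g (hadjoint H B w)) = (hnorm H w)\<^sup>2"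
    using ip_self[OF w] by (simp add: complex_eq_iff)
  have "0 \<le> (hnorm H (p - R w))\<^sup>2 + (hnorm H (g - hadjoint H B w))\<^sup>2" by simp
  also have "\<dots> = (hnorm H p)\<^sup>2 + (hnorm H g)\<^sup>2 - (hnorm H w)\<^sup>2"
    using hnorm_diff_sq[OF p(1) Rw] hnorm_diff_sq[OF g Bw] hnorm_defect_sq[OF w] cross by linarith
  finally show ?thesis by (simp add: w_def p_def operator_range_sel(3))
qed

text \<open>Testing the hypothesis with \<open>g = B\<^sup>* w\<close> gives \<open>2 Re \<langle>w, f\<rangle> \<le> M + \<parallel>R w\<parallel>\<^sup>2\<close> for all \<open>w\<close>, which makes
  \<open>R w \<mapsto> \<langle>w, f\<rangle>\<close> a bounded functional on the range of \<open>R\<close>. A vector \<open>u\<close> representing it satisfies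
  \<open>R u = f\<close>.\<close>

lemma in_rangeI:
  assumes f: "f \<in> vecs H" and bound: "\<And>g. g \<in> vecs H \<Longrightarrow> (hnorm H (f + B g))\<^sup>2 \<le> (hnorm H g)\<^sup>2 + M"
  shows "f \<in> vecs Rng" "(hnorm Rng f)\<^sup>2 \<le> M"
proof -
  have key: "2 * Re (ip H w f) \<le> M + (hnorm H (R w))\<^sup>2" if w: "w \<in> vecs H" for w
  proof -
    have Rw: "R w \<in> vecs H" "R (R w) \<in> vecs H" and Bw: "hadjoint H B w \<in> vecs H"
      using RD(1) B_adj(1) w by auto
    \<comment> \<open>The test vector \<open>g = B\<^sup>* w\<close> turns \<open>f + B g\<close> into \<open>(f - R\<^sup>2 w) + w\<close>.\<close>
    have split: "f + B (hadjoint H B w) = (f - R (R w)) + w" by (simp add: R_square w)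
    have "(hnorm H ((f - R (R w)) + w))\<^sup>2 \<le> (hnorm H (hadjoint H B w))\<^sup>2 + M"
      using bound[OF Bw] unfolding split .
    moreover have "(hnorm H ((f - R (R w)) + w))\<^sup>2
        = (hnorm H (f - R (R w)))\<^sup>2 + 2 * (Re (ip H f w) - (hnorm H (R w))\<^sup>2) + (hnorm H w)\<^sup>2"
      using hnorm_add_sq[of "f - R (R w)" w] f Rw w ip_self[OF Rw(1)]
        positive_operator_ip_commute[OF R_positive Rw(1) w] by simp
    moreover have "Re (ip H f w) = Re (ip H w f)" using ip_commute[OF f w] by simp
    ultimately show ?thesis using hnorm_defect_sq[OF w] zero_le_power2[of "hnorm H (f - R (R w))"] by argo
  qed
  obtain u where u: "u \<in> vecs H" "(hnorm H u)\<^sup>2 \<le> M" "\<And>w. w \<in> vecs H \<Longrightarrow> ip H w f = ip H (R w) u"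
    by (rule functional_represented[of "vecs H" R "\<lambda>w. ip H w f" M, OF subspace_vecs RD _ _ key])
      (use f in simp_all)
  have "f = R u"
    using f RD(1)[OF u(1)] u positive_operator_ip_commute[OF R_positive _ u(1)] by (intro eq_if_ip_eq) auto
  then show "f \<in> vecs Rng" using u(1) by (simp add: operator_range_sel)
  have "(hnorm Rng f)\<^sup>2 \<le> (hnorm H u)\<^sup>2"
    unfolding \<open>f = R u\<close> using hnorm_range_le[OF u(1)] rng.hnorm_nonneg \<open>f \<in> vecs Rng\<close> \<open>f = R u\<close>
    by (intro power_mono) auto
  then show "(hnorm Rng f)\<^sup>2 \<le> M" using u(2) by simp
qed

end

section \<open>Spaces invariant under both shifts\<close>

text \<open>Spaces of functions on the disc that are invariant under the forward shift \<open>S\<close> and on which the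
  backward shift \<open>X f = (f - f 0) / z\<close> is a contraction.\<close>

locale backward_shift_space = hilbert_functions H for H :: "complex inner_space" +
  fixes S X :: "complex operator" and C :: real
  assumes separable: "separable_space (htopology H)"
    and nontrivial: "\<exists>f\<in>vecs H. f \<noteq> 0"
    and disc_functions: "vecs H \<subseteq> disc_holomorphic"
    and eval_bound: "\<And>f. f \<in> vecs H \<Longrightarrow> cmod (f 0) \<le> C * hnorm H f"
    and S_bounded: "bounded_operator H S"
    and S_eq: "\<And>f z. f \<in> vecs H \<Longrightarrow> S f z = z * f z"
    and X_bounded: "bounded_operator H X"
    and X_contraction: "\<And>f. f \<in> vecs H \<Longrightarrow> hnorm H (X f) \<le> hnorm H f"
    and X_eq: "\<And>f z. f \<in> vecs H \<Longrightarrow> cmod z < 1 \<Longrightarrow> f z = f 0 + z * X f z"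
begin

abbreviation "S_adj \<equiv> hadjoint H S"
abbreviation "X_adj \<equiv> hadjoint H X"

lemmas SD = bounded_operatorD[OF S_bounded]
lemmas XD = bounded_operatorD[OF X_bounded]
lemmas S_adj_bounded = bounded_operator_hadjoint[OF S_bounded]
lemmas S_adjD = bounded_operatorD[OF S_adj_bounded]
lemmas X_adj_bounded = bounded_operator_hadjoint[OF X_bounded]
lemmas X_adjD = bounded_operatorD[OF X_adj_bounded]
lemmas S_adj_ip = ip_hadjoint[OF S_bounded]
lemmas X_adj_ip = ip_hadjoint[OF X_bounded]

lemma vanishes_off_disc: "f \<in> vecs H \<Longrightarrow> \<not> cmod z < 1 \<Longrightarrow> f z = 0"
  using disc_functions by (auto simp: disc_holomorphic_def)

lemma continuous_at_0: "f \<in> vecs H \<Longrightarrow> isCont f 0"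
proof -
  assume "f \<in> vecs H"
  then have "f holomorphic_on ball 0 1" using disc_functions by (auto simp: disc_holomorphic_def)
  then have "continuous_on (ball 0 1) f" by (rule holomorphic_on_imp_continuous_on)
  then show ?thesis by (rule continuous_on_interior) simp
qed

text \<open>The identity is immediate away from the origin, and extends to the origin by continuity.\<close>

lemma X_S:
  assumes f: "f \<in> vecs H"
  shows "X (S f) = f"
proof
  fix z
  have XSf: "X (S f) \<in> vecs H" using XD(1) SD(1) f by blast
  have nz: "X (S f) w = f w" if "cmod w < 1" "w \<noteq> 0" for w
    using X_eq[OF SD(1)[OF f] that(1)] that(2) by (simp add: S_eq[OF f])
  consider "\<not> cmod z < 1" | "cmod z < 1" "z \<noteq> 0" | "z = 0" by auto
  then show "X (S f) z = f z"
  proof cases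
    case 1
    then show ?thesis using vanishes_off_disc[OF f] vanishes_off_disc[OF XSf] by simp
  next
    case 2
    then show ?thesis by (rule nz)
  next
    case 3
    have "(X (S f) \<longlongrightarrow> X (S f) 0) (at 0)" using continuous_at_0[OF XSf] by (simp add: isCont_def)
    moreover have "(f \<longlongrightarrow> f 0) (at 0)" using continuous_at_0[OF f] by (simp add: isCont_def)
    moreover have "\<forall>\<^sub>F w in at 0. X (S f) w = f w"
      unfolding eventually_at using nz by (intro exI[of _ 1]) auto
    ultimately show ?thesis using 3 tendsto_cong tendsto_unique[of "at (0::complex)"] by (metis at_neq_bot)
  qed
qed

lemma S_X:
  assumes f: "f \<in> vecs H" and "f 0 = 0"
  shows "S (X f) = f"
proof
  fix z
  show "S (X f) z = f z"
    using X_eq[OF f, of z] vanishes_off_disc[OF f, of z] vanishes_off_disc[OF XD(1)[OF f], of z] assms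
    by (cases "cmod z < 1") (simp_all add: S_eq[OF XD(1)[OF f]])
qed

lemma S_adj_X_adj:
  assumes g: "g \<in> vecs H"
  shows "S_adj (X_adj g) = g"
  using g X_adjD(1) SD(1) S_adj_ip X_adj_ip X_S
  by (intro hadjoint_eqI[OF S_bounded]) auto

text \<open>Evaluating \<open>u = u 0 + z X u\<close> at \<open>z\<close> itself reduces every point evaluation to the one at the origin.\<close>

lemma value_of_resolvent:
  assumes "u \<in> vecs H" "cmod z < 1" "u - cscale z (X u) = f"
  shows "f z = u 0"
  using X_eq[OF assms(1,2)] assms(3) by (auto simp: cscale_def)

lemma resolvent:
  assumes "f \<in> vecs H" "cmod z < 1"
  obtains u where "u \<in> vecs H" "u - cscale z (X u) = f"
  using contraction_perturbation_surj[OF X_bounded X_contraction assms(2,1)] by blast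

lemma X_adj_contraction: "g \<in> vecs H \<Longrightarrow> hnorm H (X_adj g) \<le> hnorm H g"
  using hnorm_hadjoint_le[OF X_bounded, of g 1] X_contraction by simp

lemma adjoint_resolvent:
  assumes "g \<in> vecs H" "cmod w < 1"
  obtains q where "q \<in> vecs H" "q - cscale w (X_adj q) = g"
  using contraction_perturbation_surj[OF X_adj_bounded X_adj_contraction assms(2,1)] by blast

text \<open>If the evaluation at 0 vanished on the space, then by the previous identity so would all the others,
  and the space would be trivial.\<close>

lemma kernel_at_0:
  obtains k where "k \<in> vecs H" "\<And>f. f \<in> vecs H \<Longrightarrow> f 0 = ip H f k" "k \<noteq> 0"
proof -
  obtain k where k: "k \<in> vecs H" "\<And>f. f \<in> vecs H \<Longrightarrow> f 0 = ip H f k"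
    by (rule Riesz[of "\<lambda>f. f 0" C]) (use eval_bound in \<open>auto simp: cscale_def\<close>)
  have "k \<noteq> 0"
  proof
    assume "k = 0"
    then have zero: "f 0 = 0" if "f \<in> vecs H" for f using k(2)[OF that] that by simp
    have "f z = 0" if f: "f \<in> vecs H" for f z
    proof (cases "cmod z < 1")
      case True
      obtain u where "u \<in> vecs H" "u - cscale z (X u) = f" using resolvent[OF f True] .
      then show ?thesis using value_of_resolvent True zero by metis
    qed (use vanishes_off_disc f in blast)
    then show False using nontrivial by (auto simp: fun_eq_iff)
  qed
  then show ?thesis using that k by blast
qed

text \<open>Since \<open>S\<^sup>* X\<^sup>* = I\<close>, the operator \<open>I - w X\<^sup>*\<close> maps the eigenspace of \<open>S\<^sup>*\<close> at \<open>w\<close> into the kernel of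
  \<open>S\<^sup>*\<close>. This kernel is spanned by \<open>k\<close>, because a vector in it is orthogonal to \<open>S (X f) = f\<close> for every
  \<open>f\<close> with \<open>f 0 = 0\<close>, that is, for every \<open>f\<close> orthogonal to \<open>k\<close>.\<close>

lemma eigenspace_S_adj:
  assumes k: "k \<in> vecs H" "\<And>f. f \<in> vecs H \<Longrightarrow> f 0 = ip H f k" "k \<noteq> 0"
    and q: "q \<in> vecs H" "q - cscale w (X_adj q) = k" and w: "cmod w < 1"
  shows "hkernel H (\<lambda>f. S_adj f - cscale w f) = cfun.span {q}"
proof
  have S_adj_k: "S_adj k = 0"
    using k SD(1) S_eq by (intro hadjoint_eqI[OF S_bounded]) (auto simp flip: k(2))
  have resolve: "S_adj (g - cscale w (X_adj g)) = S_adj g - cscale w g" if g: "g \<in> vecs H" for g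
    using bounded_operator_diff[OF S_adj_bounded g vecs_closed(4)[OF X_adjD(1)[OF g]]]
      S_adjD(3)[OF X_adjD(1)[OF g]] S_adj_X_adj[OF g] by simp
  have kernel_subspace: "cfun.subspace (hkernel H (\<lambda>f. S_adj f - cscale w f))"
    using S_adjD bounded_operator_zero[OF S_adj_bounded]
    by (intro cfun.subspaceI) (auto simp: hkernel_def cfun.scale_right_distrib mult.commute)
  have "q \<in> hkernel H (\<lambda>f. S_adj f - cscale w f)"
    using q resolve[OF q(1)] S_adj_k by (simp add: hkernel_def)
  then show "cfun.span {q} \<subseteq> hkernel H (\<lambda>f. S_adj f - cscale w f)"
    using kernel_subspace by (intro cfun.span_minimal) auto
  show "hkernel H (\<lambda>f. S_adj f - cscale w f) \<subseteq> cfun.span {q}"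
  proof
    fix g assume "g \<in> hkernel H (\<lambda>f. S_adj f - cscale w f)"
    then have g: "g \<in> vecs H" "S_adj g - cscale w g = 0" by (auto simp: hkernel_def)
    define h where "h = g - cscale w (X_adj g)"
    have h: "h \<in> vecs H" "S_adj h = 0" using g X_adjD(1)[OF g(1)] resolve[OF g(1)] by (auto simp: h_def)
    have orth: "ip H f h = 0" if f: "f \<in> vecs H" "f 0 = 0" for f
      using S_adj_ip[OF h(1) XD(1)[OF f(1)]] S_X[OF f] h(2) XD(1)[OF f(1)] by simp
    define c where "c = ip H h k / ip H k k"
    have kk: "ip H k k \<noteq> 0" using k ip_definite by blast
    define f where "f = h - cscale c k"
    have f: "f \<in> vecs H" using h(1) k(1) by (simp add: f_def)
    have "ip H f k = 0" using h(1) k(1) kk by (simp add: f_def c_def)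
    then have "f 0 = 0" using k(2)[OF f] by simp
    have "ip H f f = ip H f h - cnj c * ip H f k"
      unfolding f_def using h(1) k(1) by simp
    then have "f = 0" using orth[OF f \<open>f 0 = 0\<close>] \<open>ip H f k = 0\<close> ip_definite[OF f] by simp
    then have "h = cscale c k" by (simp add: f_def)
    \<comment> \<open>Injectivity of \<open>I - w X\<^sup>*\<close> transfers this to \<open>g\<close> and \<open>q\<close>.\<close>
    define d where "d = g - cscale c q"
    have d: "d \<in> vecs H" using g q by (simp add: d_def)
    have "d - cscale w (X_adj d) = h - cscale c (q - cscale w (X_adj q))"
      using bounded_operator_diff[OF X_adj_bounded g(1) vecs_closed(4)[OF q(1)]] X_adjD(3)[OF q(1)]
      by (simp add: d_def h_def cfun.scale_right_diff_distrib mult.commute)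
    also have "\<dots> = 0" using q(2) \<open>h = cscale c k\<close> by simp
    finally have "(1 - cmod w) * hnorm H d \<le> 0"
      using contraction_perturbation_bounded_below[OF X_adj_bounded X_adj_contraction d, of w] by simp
    then have "hnorm H d = 0" using w hnorm_nonneg[OF d] by (simp add: mult_le_0_iff)
    then have "g = cscale c q" using hnorm_eq_0_iff[OF d] by (simp add: d_def)
    then show "g \<in> cfun.span {q}" by (simp add: cfun.span_base cfun.span_scale)
  qed
qed

text \<open>The eigenvector \<open>q w = (I - w X\<^sup>*)\<^sup>-\<^sup>1 k\<close> is the reproducing kernel at \<open>cnj w\<close>, so a function orthogonal
  to all eigenvectors vanishes at every point. Surjectivity of \<open>S\<^sup>* - w I\<close> comes from
  \<open>(S\<^sup>* - w I) X\<^sup>* = I - w X\<^sup>*\<close>.\<close>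

theorem S_adj_cowen_douglas: "S_adj \<in> cowen_douglas 1 (ball 0 1) H"
proof -
  obtain k where k: "k \<in> vecs H" "\<And>f. f \<in> vecs H \<Longrightarrow> f 0 = ip H f k" "k \<noteq> 0"
    using kernel_at_0 by blast
  have "\<exists>q. q \<in> vecs H \<and> q - cscale w (X_adj q) = k" if "cmod w < 1" for w
    using adjoint_resolvent[OF k(1) that] by blast
  then obtain q where q: "\<And>w. cmod w < 1 \<Longrightarrow> q w \<in> vecs H"
    "\<And>w. cmod w < 1 \<Longrightarrow> q w - cscale w (X_adj (q w)) = k" by metis
  have eig: "hkernel H (\<lambda>f. S_adj f - cscale w f) = cfun.span {q w}" if "cmod w < 1" for w
    using k q[OF that] that by (rule eigenspace_S_adj)
  have q_nz: "q w \<noteq> 0" if "cmod w < 1" for w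
    using q(2)[OF that] k(3) bounded_operator_zero[OF X_adj_bounded] by auto
  let ?U = "\<Union>w\<in>ball 0 1. hkernel H (\<lambda>f. S_adj f - cscale w f)"
  have "htopology H closure_of cfun.span ?U = vecs H"
  proof (rule dense_if_orthogonal_trivial)
    show "cfun.subspace (cfun.span ?U)" by (rule cfun.subspace_span)
    show "cfun.span ?U \<subseteq> vecs H"
      using subspace_vecs by (intro cfun.span_minimal) (auto simp: hkernel_def)
    fix f assume f: "f \<in> vecs H" and orth: "\<And>v. v \<in> cfun.span ?U \<Longrightarrow> ip H v f = 0"
    have "f z = 0" if z: "cmod z < 1" for z
    proof -
      have w: "cmod (cnj z) < 1" using z by simp
      have "q (cnj z) \<in> ?U" using eig[OF w] w cfun.span_base by fastforce
      then have "ip H (q (cnj z)) f = 0" by (intro orth cfun.span_base)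
      then have "ip H f (q (cnj z)) = 0" using ip_commute[OF q(1)[OF w] f] by simp
      moreover obtain u where u: "u \<in> vecs H" "u - cscale z (X u) = f" using resolvent[OF f z] .
      moreover have "ip H (u - cscale z (X u)) (q (cnj z)) = ip H u (q (cnj z) - cscale (cnj z) (X_adj (q (cnj z))))"
        using u(1) XD(1)[OF u(1)] q(1)[OF w] X_adjD(1)[OF q(1)[OF w]] X_adj_ip[OF q(1)[OF w] u(1)] by simp
      ultimately have "ip H u k = 0" using q(2)[OF w] by simp
      then show ?thesis using value_of_resolvent[OF u(1) z u(2)] k(2)[OF u(1)] by simp
    qed
    then show "f = 0" using vanishes_off_disc[OF f] by (auto simp: fun_eq_iff)
  qed
  moreover have "cfun.dim (hkernel H (\<lambda>f. S_adj f - cscale w f)) = 1" if "w \<in> ball 0 1" for w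
  proof -
    have w: "cmod w < 1" using that by simp
    have "cfun.independent {q w}" using q_nz[OF w] by (simp add: cfun.independent_insert cfun.independent_empty)
    then show ?thesis unfolding eig[OF w] using cfun.dim_span_eq_card_independent by fastforce
  qed
  moreover have "(\<lambda>f. S_adj f - cscale w f) ` vecs H = vecs H" if "w \<in> ball 0 1" for w
  proof
    show "(\<lambda>f. S_adj f - cscale w f) ` vecs H \<subseteq> vecs H" using S_adjD(1) by auto
    show "vecs H \<subseteq> (\<lambda>f. S_adj f - cscale w f) ` vecs H"
    proof
      fix g assume "g \<in> vecs H"
      moreover have "cmod w < 1" using that by simp
      ultimately obtain p where p: "p \<in> vecs H" "p - cscale w (X_adj p) = g" by (rule adjoint_resolvent)
      then have "g = S_adj (X_adj p) - cscale w (X_adj p)" using S_adj_X_adj[OF p(1)] by simp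
      then show "g \<in> (\<lambda>f. S_adj f - cscale w f) ` vecs H" using X_adjD(1)[OF p(1)] by blast
    qed
  qed
  ultimately show ?thesis
    unfolding cowen_douglas_def separable_hilbert_space_def
    using S_adj_bounded separable complete inner_space by auto
qed

end

section \<open>The Hardy space as a Hilbert space\<close>

lemma taylor_coeff_sums:
  assumes "f \<in> disc_holomorphic" "cmod z < 1"
  shows "(\<lambda>n. taylor_coeff f n * z ^ n) sums f z"
  using holomorphic_power_series[of f 0 1 z] assms by (simp add: disc_holomorphic_def taylor_coeff_def)

lemma taylor_coeff_eqI:
  assumes a: "\<And>z. cmod z < 1 \<Longrightarrow> (\<lambda>n. a n * z ^ n) sums f z"
  shows "taylor_coeff f = a"
proof
  fix n
  have "summable (\<lambda>n. a n * (1 / 2) ^ n)" using a[of "1/2"] by (simp add: sums_iff)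
  then have "conv_radius a \<ge> ereal (norm (1 / 2 :: complex))" by (rule conv_radius_geI)
  then have "fps_conv_radius (Abs_fps a) > 0"
    unfolding fps_conv_radius_def by (simp add: less_le_trans[of 0 "ereal (1/2)"])
  moreover have "\<forall>\<^sub>F z in nhds 0. eval_fps (Abs_fps a) z = f z"
    using eventually_nhds_in_open[of "ball 0 1" "0::complex"]
    by (rule eventually_mono) (use a in \<open>auto simp: eval_fps_def sums_iff\<close>)
  ultimately have "f has_fps_expansion Abs_fps a" by (simp add: has_fps_expansion_def)
  then show "taylor_coeff f n = a n" using fps_nth_fps_expansion[of f "Abs_fps a" n] by (simp add: taylor_coeff_def)
qed

definition disc_series :: "(nat \<Rightarrow> complex) \<Rightarrow> complex \<Rightarrow> complex"
  where "disc_series a = (\<lambda>z. if cmod z < 1 then \<Sum>n. a n * z ^ n else 0)"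

lemma
  assumes a: "\<And>z. cmod z < 1 \<Longrightarrow> summable (\<lambda>n. a n * z ^ n)"
  shows disc_series_holomorphic: "disc_series a \<in> disc_holomorphic"
    and taylor_coeff_disc_series: "taylor_coeff (disc_series a) = a"
proof -
  have sums: "(\<lambda>n. a n * z ^ n) sums disc_series a z" if "cmod z < 1" for z
    using a[OF that] that by (simp add: disc_series_def summable_sums)
  then have "disc_series a holomorphic_on ball 0 1"
    using power_series_holomorphic[of 0 1 a "disc_series a"] by simp
  then show "disc_series a \<in> disc_holomorphic" by (simp add: disc_holomorphic_def disc_series_def)
  show "taylor_coeff (disc_series a) = a" using sums by (rule taylor_coeff_eqI)
qed

lemma disc_holomorphic_eqI:
  assumes f: "f \<in> disc_holomorphic" and g: "g \<in> disc_holomorphic" and "taylor_coeff f = taylor_coeff g"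
  shows "f = g"
proof
  fix z
  show "f z = g z"
  proof (cases "cmod z < 1")
    case True
    then show ?thesis using taylor_coeff_sums[OF f True] taylor_coeff_sums[OF g True] assms(3)
      by (metis sums_unique2)
  qed (use f g in \<open>auto simp: disc_holomorphic_def\<close>)
qed

lemma disc_holomorphic_closed:
  "0 \<in> disc_holomorphic"
  "f \<in> disc_holomorphic \<Longrightarrow> g \<in> disc_holomorphic \<Longrightarrow> f + g \<in> disc_holomorphic"
  "f \<in> disc_holomorphic \<Longrightarrow> cscale c f \<in> disc_holomorphic"
  "f \<in> disc_holomorphic \<Longrightarrow> mult_op (\<lambda>z. z) f \<in> disc_holomorphic"
  "f \<in> disc_holomorphic \<Longrightarrow> g \<in> disc_holomorphic \<Longrightarrow> mult_op f g \<in> disc_holomorphic"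
  by (auto simp: disc_holomorphic_def cscale_def mult_op_def plus_fun_def zero_fun_def intro!: holomorphic_intros)

lemma taylor_coeff_add:
  assumes "f \<in> disc_holomorphic" "g \<in> disc_holomorphic"
  shows "taylor_coeff (f + g) = (\<lambda>n. taylor_coeff f n + taylor_coeff g n)"
  using sums_add[OF taylor_coeff_sums[OF assms(1)] taylor_coeff_sums[OF assms(2)]]
  by (intro taylor_coeff_eqI) (simp add: distrib_right)

lemma taylor_coeff_cscale:
  assumes "f \<in> disc_holomorphic"
  shows "taylor_coeff (cscale c f) = (\<lambda>n. c * taylor_coeff f n)"
  using sums_mult[OF taylor_coeff_sums[OF assms], of _ c]
  by (intro taylor_coeff_eqI) (simp add: cscale_def mult.assoc)

lemma taylor_coeff_diff:
  assumes "f \<in> disc_holomorphic" "g \<in> disc_holomorphic"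
  shows "taylor_coeff (f - g) = (\<lambda>n. taylor_coeff f n - taylor_coeff g n)"
  using sums_diff[OF taylor_coeff_sums[OF assms(1)] taylor_coeff_sums[OF assms(2)]]
  by (intro taylor_coeff_eqI) (simp add: left_diff_distrib)

lemma taylor_coeff_0: "taylor_coeff f 0 = f 0"
  by (simp add: taylor_coeff_def)

lemma taylor_coeff_shift:
  assumes "f \<in> disc_holomorphic"
  shows "taylor_coeff (mult_op (\<lambda>z. z) f) = case_nat 0 (taylor_coeff f)"
proof (rule taylor_coeff_eqI)
  fix z :: complex assume "cmod z < 1"
  from sums_mult[OF taylor_coeff_sums[OF assms this], of z]
  have "(\<lambda>n. case_nat 0 (taylor_coeff f) (Suc n) * z ^ Suc n) sums (z * f z)" by (simp add: mult_ac)
  from sums_Suc[OF this] show "(\<lambda>n. case_nat 0 (taylor_coeff f) n * z ^ n) sums mult_op (\<lambda>z. z) f z"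
    by (simp add: mult_op_def)
qed

lemma Hardy2_sel:
  "f \<in> vecs Hardy2 \<longleftrightarrow> f \<in> disc_holomorphic \<and> summable (\<lambda>n. (cmod (taylor_coeff f n))\<^sup>2)"
  "ip Hardy2 f g = (\<Sum>n. taylor_coeff f n * cnj (taylor_coeff g n))"
  by (simp_all add: Hardy2_def)

lemma summable_mult_square_summable:
  fixes a b :: "nat \<Rightarrow> complex"
  assumes "summable (\<lambda>n. (cmod (a n))\<^sup>2)" "summable (\<lambda>n. (cmod (b n))\<^sup>2)"
  shows "summable (\<lambda>n. a n * b n)"
proof (rule summable_comparison_test)
  have "cmod (a n * b n) \<le> (cmod (a n))\<^sup>2 + (cmod (b n))\<^sup>2" for n
    using sum_squares_bound[of "cmod (a n)" "cmod (b n)"] mult_nonneg_nonneg[OF norm_ge_zero[of "a n"] norm_ge_zero[of "b n"]]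
    by (simp only: norm_mult)
  then show "\<exists>N. \<forall>n\<ge>N. norm (a n * b n) \<le> (cmod (a n))\<^sup>2 + (cmod (b n))\<^sup>2" by blast
qed (rule summable_add[OF assms])

lemma square_summable_add:
  fixes a b :: "nat \<Rightarrow> complex"
  assumes "summable (\<lambda>n. (cmod (a n))\<^sup>2)" "summable (\<lambda>n. (cmod (b n))\<^sup>2)"
  shows "summable (\<lambda>n. (cmod (a n + b n))\<^sup>2)"
proof (rule summable_comparison_test)
  have "(cmod (a n + b n))\<^sup>2 \<le> 2 * (cmod (a n))\<^sup>2 + 2 * (cmod (b n))\<^sup>2" for n
  proof -
    have "(cmod (a n + b n))\<^sup>2 \<le> (cmod (a n) + cmod (b n))\<^sup>2"
      by (intro power_mono norm_triangle_ineq) simp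
    also have "\<dots> \<le> 2 * (cmod (a n))\<^sup>2 + 2 * (cmod (b n))\<^sup>2"
      using sum_squares_bound[of "cmod (a n)" "cmod (b n)"] by (simp add: power2_sum)
    finally show ?thesis .
  qed
  then show "\<exists>N. \<forall>n\<ge>N. norm ((cmod (a n + b n))\<^sup>2) \<le> 2 * (cmod (a n))\<^sup>2 + 2 * (cmod (b n))\<^sup>2"
    by simp
  show "summable (\<lambda>n. 2 * (cmod (a n))\<^sup>2 + 2 * (cmod (b n))\<^sup>2)"
    using assms by (intro summable_add summable_mult)
qed

lemma square_summable_power_series:
  assumes a: "summable (\<lambda>n. (cmod (a n))\<^sup>2)" and z: "cmod z < 1"
  shows "summable (\<lambda>n. a n * z ^ n)"
proof (rule summable_mult_square_summable[OF a])
  have "(cmod z)\<^sup>2 < 1" using z by (simp add: abs_square_less_1)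
  then have "summable (\<lambda>n. ((cmod z)\<^sup>2) ^ n)" by (intro summable_geometric) simp
  then show "summable (\<lambda>n. (cmod (z ^ n))\<^sup>2)" by (simp add: norm_power mult.commute flip: power_mult)
qed

lemma disc_series_Hardy2:
  assumes "summable (\<lambda>n. (cmod (a n))\<^sup>2)"
  shows "disc_series a \<in> vecs Hardy2" "taylor_coeff (disc_series a) = a"
  using assms disc_series_holomorphic[of a] taylor_coeff_disc_series[of a] square_summable_power_series[OF assms]
  by (auto simp: Hardy2_sel)

lemma ip_Hardy2_self:
  assumes "f \<in> vecs Hardy2"
  shows "ip Hardy2 f f = of_real (\<Sum>n. (cmod (taylor_coeff f n))\<^sup>2)"
proof -
  have "ip Hardy2 f f = (\<Sum>n. of_real ((cmod (taylor_coeff f n))\<^sup>2))"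
    by (simp only: Hardy2_sel(2) complex_norm_square)
  also have "\<dots> = of_real (\<Sum>n. (cmod (taylor_coeff f n))\<^sup>2)"
    using assms by (intro suminf_of_real[symmetric]) (simp add: Hardy2_sel)
  finally show ?thesis .
qed

lemma hnorm_Hardy2_sq:
  assumes "f \<in> vecs Hardy2"
  shows "(hnorm Hardy2 f)\<^sup>2 = (\<Sum>n. (cmod (taylor_coeff f n))\<^sup>2)"
  using assms ip_Hardy2_self[OF assms] suminf_nonneg[of "\<lambda>n. (cmod (taylor_coeff f n))\<^sup>2"]
  by (simp add: hnorm_def Hardy2_sel(1))

lemma Hardy2_inner_space: "complex_inner_space Hardy2"
  unfolding complex_inner_space_def
proof (intro conjI ballI allI impI)
  show "cfun.subspace (vecs Hardy2)"
  proof (rule cfun.subspaceI)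
    have "taylor_coeff 0 = (\<lambda>n. 0)" by (rule taylor_coeff_eqI) simp
    then show "0 \<in> vecs Hardy2" by (simp add: Hardy2_sel disc_holomorphic_closed)
    show "f + g \<in> vecs Hardy2" if "f \<in> vecs Hardy2" "g \<in> vecs Hardy2" for f g
      using that by (simp add: Hardy2_sel disc_holomorphic_closed taylor_coeff_add square_summable_add)
    show "cscale c f \<in> vecs Hardy2" if "f \<in> vecs Hardy2" for f c
      using that by (simp add: Hardy2_sel disc_holomorphic_closed taylor_coeff_cscale norm_mult power_mult_distrib summable_mult)
  qed
  fix f g h c assume f: "f \<in> vecs Hardy2" and g: "g \<in> vecs Hardy2"
  have summ: "summable (\<lambda>n. taylor_coeff f n * cnj (taylor_coeff g n))"
    if "f \<in> vecs Hardy2" "g \<in> vecs Hardy2" for f g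
    using that by (intro summable_mult_square_summable) (simp_all add: Hardy2_sel)
  show "ip Hardy2 (f + g) h = ip Hardy2 f h + ip Hardy2 g h" if h: "h \<in> vecs Hardy2"
    unfolding Hardy2_sel(2) suminf_add[OF summ[OF f h] summ[OF g h]]
    using f g by (simp add: Hardy2_sel taylor_coeff_add distrib_right)
  show "ip Hardy2 (cscale c f) g = c * ip Hardy2 f g"
    unfolding Hardy2_sel(2) suminf_mult[OF summ[OF f g], symmetric]
    using f by (simp add: Hardy2_sel taylor_coeff_cscale mult.assoc)
  have "(\<lambda>n. cnj (taylor_coeff f n * cnj (taylor_coeff g n))) sums cnj (ip Hardy2 f g)"
    unfolding Hardy2_sel(2) sums_cnj by (rule summable_sums[OF summ[OF f g]])
  then show "ip Hardy2 g f = cnj (ip Hardy2 f g)"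
    unfolding Hardy2_sel(2)[of g f] by (simp add: sums_iff mult.commute)
  have s: "summable (\<lambda>n. (cmod (taylor_coeff f n))\<^sup>2)" using f by (simp add: Hardy2_sel)
  note ff = ip_Hardy2_self[OF f]
  show "0 \<le> Re (ip Hardy2 f f)" unfolding ff using suminf_nonneg[OF s] by simp
  assume "ip Hardy2 f f = 0"
  then have "(\<Sum>n. (cmod (taylor_coeff f n))\<^sup>2) = 0" unfolding ff by simp
  then have "taylor_coeff f n = 0" for n using suminf_eq_zero_iff[OF s] by simp
  then show "f = 0"
    using f disc_holomorphic_closed(1) taylor_coeff_eqI[of "\<lambda>n. 0" 0]
    by (intro disc_holomorphic_eqI) (auto simp: Hardy2_sel fun_eq_iff)
qed

interpretation Hardy2: inner_product_functions Hardy2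
  by unfold_locales (rule Hardy2_inner_space)

lemma sum_coeffs_le_hnorm:
  assumes "f \<in> vecs Hardy2"
  shows "(\<Sum>n<N. (cmod (taylor_coeff f n))\<^sup>2) \<le> (hnorm Hardy2 f)\<^sup>2"
  using assms unfolding hnorm_Hardy2_sq[OF assms]
  by (intro sum_le_suminf) (auto simp: Hardy2_sel)

lemma coeff_le_hnorm:
  assumes "f \<in> vecs Hardy2"
  shows "cmod (taylor_coeff f n) \<le> hnorm Hardy2 f"
proof (rule power2_le_imp_le)
  have "(cmod (taylor_coeff f n))\<^sup>2 \<le> (\<Sum>k<Suc n. (cmod (taylor_coeff f k))\<^sup>2)" by (simp add: sum_nonneg)
  then show "(cmod (taylor_coeff f n))\<^sup>2 \<le> (hnorm Hardy2 f)\<^sup>2"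
    using sum_coeffs_le_hnorm[OF assms, of "Suc n"] by linarith
qed (use assms in simp)

lemma Hardy2_coeffI:
  assumes f: "f \<in> disc_holomorphic" and b: "\<And>N. (\<Sum>n<N. (cmod (taylor_coeff f n))\<^sup>2) \<le> M"
  shows "f \<in> vecs Hardy2" "(hnorm Hardy2 f)\<^sup>2 \<le> M"
proof -
  have s: "summable (\<lambda>n. (cmod (taylor_coeff f n))\<^sup>2)"
  proof (rule bounded_imp_summable)
    show "(\<Sum>k\<le>n. (cmod (taylor_coeff f k))\<^sup>2) \<le> M" for n using b[of "Suc n"] by (simp add: lessThan_Suc_atMost)
  qed simp
  then show m: "f \<in> vecs Hardy2" using f by (simp add: Hardy2_sel)
  show "(hnorm Hardy2 f)\<^sup>2 \<le> M" unfolding hnorm_Hardy2_sq[OF m] using s b by (rule suminf_le_const)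
qed

text \<open>A Cauchy sequence converges coefficientwise; the bound on the differences passes to the limit in
  every partial sum, hence in the norm.\<close>

interpretation Hardy2: hilbert_functions Hardy2
proof unfold_locales
  show "Hardy2.mcomplete"
  proof (rule Hardy2.mcompleteI)
    fix s :: "nat \<Rightarrow> complex \<Rightarrow> complex" assume s: "\<And>n. s n \<in> vecs Hardy2"
      and cauchy: "\<forall>e>0. \<exists>N. \<forall>m\<ge>N. \<forall>n\<ge>N. hnorm Hardy2 (s m - s n) < e"
    have hol: "s j \<in> disc_holomorphic" for j using s by (simp add: Hardy2_sel)
    have diff: "taylor_coeff (s j - s k) = (\<lambda>n. taylor_coeff (s j) n - taylor_coeff (s k) n)" for j k
      using hol by (intro taylor_coeff_diff)
    have "Cauchy (\<lambda>j. taylor_coeff (s j) n)" for n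
      unfolding Cauchy_iff
    proof (intro allI impI)
      fix e :: real assume "e > 0"
      then obtain N where N: "\<forall>i\<ge>N. \<forall>j\<ge>N. hnorm Hardy2 (s i - s j) < e" using cauchy by blast
      have "norm (taylor_coeff (s i) n - taylor_coeff (s j) n) < e" if "i \<ge> N" "j \<ge> N" for i j
        using N that coeff_le_hnorm[OF Hardy2.vecs_closed(3)[OF s s], of i j n] by (fastforce simp: diff)
      then show "\<exists>N. \<forall>i\<ge>N. \<forall>j\<ge>N. norm (taylor_coeff (s i) n - taylor_coeff (s j) n) < e" by blast
    qed
    then have "\<forall>n. \<exists>l. (\<lambda>j. taylor_coeff (s j) n) \<longlonglongrightarrow> l" by (simp add: Cauchy_convergent_iff convergent_def)
    then obtain a where a: "\<And>n. (\<lambda>j. taylor_coeff (s j) n) \<longlonglongrightarrow> a n" by metis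
    have tail: "(\<Sum>n<M. (cmod (taylor_coeff (s i) n - a n))\<^sup>2) \<le> e\<^sup>2"
      if N: "\<forall>i\<ge>N. \<forall>j\<ge>N. hnorm Hardy2 (s i - s j) < e" and i: "i \<ge> N" for N i M e
    proof (rule LIMSEQ_le_const2)
      show "(\<lambda>j. \<Sum>n<M. (cmod (taylor_coeff (s i) n - taylor_coeff (s j) n))\<^sup>2)
          \<longlonglongrightarrow> (\<Sum>n<M. (cmod (taylor_coeff (s i) n - a n))\<^sup>2)"
        by (intro tendsto_intros a)
      have "(\<Sum>n<M. (cmod (taylor_coeff (s i) n - taylor_coeff (s j) n))\<^sup>2) \<le> e\<^sup>2" if "j \<ge> N" for j
      proof -
        have "(hnorm Hardy2 (s i - s j))\<^sup>2 \<le> e\<^sup>2"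
          using N i that s by (intro power_mono) (auto intro: less_imp_le)
        then show ?thesis using sum_coeffs_le_hnorm[OF Hardy2.vecs_closed(3)[OF s s], of i j M] by (simp add: diff)
      qed
      then show "\<exists>N. \<forall>j\<ge>N. (\<Sum>n<M. (cmod (taylor_coeff (s i) n - taylor_coeff (s j) n))\<^sup>2) \<le> e\<^sup>2" by blast
    qed
    obtain N where N: "\<forall>i\<ge>N. \<forall>j\<ge>N. hnorm Hardy2 (s i - s j) < 1" using cauchy zero_less_one by blast
    have "summable (\<lambda>n. (cmod (taylor_coeff (s N) n - a n))\<^sup>2)"
    proof (rule bounded_imp_summable)
      show "(\<Sum>n\<le>M. (cmod (taylor_coeff (s N) n - a n))\<^sup>2) \<le> 1" for M
        using tail[OF N order_refl, of "Suc M"] by (simp add: lessThan_Suc_atMost)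
    qed simp
    then have "summable (\<lambda>n. (cmod (- (taylor_coeff (s N) n - a n) + taylor_coeff (s N) n))\<^sup>2)"
      using s[of N] by (intro square_summable_add) (simp_all only: norm_minus_cancel Hardy2_sel)
    then have "summable (\<lambda>n. (cmod (a n))\<^sup>2)" by simp
    note u = disc_series_Hardy2[OF this]
    have u_hol: "disc_series a \<in> disc_holomorphic" using u(1) by (simp add: Hardy2_sel)
    have "(\<lambda>n. hnorm Hardy2 (s n - disc_series a)) \<longlonglongrightarrow> 0"
    proof (rule LIMSEQ_I)
      fix r :: real assume "0 < r"
      then obtain N where N: "\<forall>i\<ge>N. \<forall>j\<ge>N. hnorm Hardy2 (s i - s j) < r/2" using cauchy half_gt_zero by blast
      have "norm (hnorm Hardy2 (s i - disc_series a) - 0) < r" if i: "i \<ge> N" for i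
      proof -
        have v: "s i - disc_series a \<in> vecs Hardy2" using s u(1) by (rule Hardy2.vecs_closed)
        have "(hnorm Hardy2 (s i - disc_series a))\<^sup>2 \<le> (r/2)\<^sup>2"
        proof (rule Hardy2_coeffI(2))
          show "s i - disc_series a \<in> disc_holomorphic" using v by (simp add: Hardy2_sel)
          show "(\<Sum>n<M. (cmod (taylor_coeff (s i - disc_series a) n))\<^sup>2) \<le> (r/2)\<^sup>2" for M
            unfolding taylor_coeff_diff[OF hol u_hol] u(2) using N i by (rule tail)
        qed
        then have "hnorm Hardy2 (s i - disc_series a) \<le> r/2" using \<open>0 < r\<close> by (rule power2_le_imp_le[OF _ less_imp_le[OF half_gt_zero]])
        then show ?thesis using \<open>0 < r\<close> Hardy2.hnorm_nonneg[OF v] by simp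
      qed
      then show "\<exists>N. \<forall>i\<ge>N. norm (hnorm Hardy2 (s i - disc_series a) - 0) < r" by blast
    qed
    then show "\<exists>u\<in>vecs Hardy2. (\<lambda>n. hnorm Hardy2 (s n - u)) \<longlonglongrightarrow> 0" using u(1) by blast
  qed
qed

definition disc_monomial :: "nat \<Rightarrow> complex \<Rightarrow> complex"
  where "disc_monomial n = disc_series (\<lambda>k. if k = n then 1 else 0)"

lemma disc_monomial:
  "disc_monomial n \<in> vecs Hardy2" "taylor_coeff (disc_monomial n) = (\<lambda>k. if k = n then 1 else 0)"
proof -
  have "summable (\<lambda>k. (cmod (if k = n then 1 else 0))\<^sup>2)"
    by (rule summable_finite[of "{n}"]) auto
  from disc_series_Hardy2[OF this] show "disc_monomial n \<in> vecs Hardy2"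
    "taylor_coeff (disc_monomial n) = (\<lambda>k. if k = n then 1 else 0)"
    by (simp_all add: disc_monomial_def)
qed

lemma disc_monomial_eq: "disc_monomial n z = (if cmod z < 1 then z ^ n else 0)"
proof -
  have "(\<lambda>k. (if k = n then 1 else 0) * z ^ k) sums z ^ n"
    using sums_single[of n "\<lambda>k. z ^ k"] by (simp add: if_distrib[of "\<lambda>c. c * _"] cong: if_cong)
  then show ?thesis by (simp add: disc_monomial_def disc_series_def sums_iff)
qed

lemma disc_monomials_total:
  assumes f: "f \<in> vecs Hardy2" and r: "r > 0"
  shows "\<exists>N a. hnorm Hardy2 (f - (\<Sum>n<N. cscale (a n) (disc_monomial n))) < r"
proof -
  have s: "summable (\<lambda>n. (cmod (taylor_coeff f n))\<^sup>2)" using f by (simp add: Hardy2_sel)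
  obtain N where N: "norm (\<Sum>n. (cmod (taylor_coeff f (n + N)))\<^sup>2) < r\<^sup>2"
    using suminf_exist_split[OF _ s, of "r\<^sup>2"] r by auto
  define p where "p M = (\<Sum>n<M. cscale (taylor_coeff f n) (disc_monomial n))" for M
  have p: "p M \<in> vecs Hardy2 \<and> taylor_coeff (p M) = (\<lambda>n. if n < M then taylor_coeff f n else 0)" for M
  proof (induction M)
    case 0
    have "taylor_coeff 0 = (\<lambda>n. 0)" by (rule taylor_coeff_eqI) simp
    then show ?case unfolding p_def by (simp flip: zero_fun_def)
  next
    case (Suc M)
    have m: "cscale (taylor_coeff f M) (disc_monomial M) \<in> vecs Hardy2" using disc_monomial(1) by blast
    have step: "p (Suc M) = p M + cscale (taylor_coeff f M) (disc_monomial M)" unfolding p_def by (simp only: sum.lessThan_Suc)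
    have "p (Suc M) \<in> vecs Hardy2" unfolding step using Suc.IH m by blast
    moreover have "taylor_coeff (p (Suc M)) = (\<lambda>n. if n < Suc M then taylor_coeff f n else 0)"
    proof -
      have "taylor_coeff (p (Suc M)) = (\<lambda>n. taylor_coeff (p M) n + taylor_coeff f M * taylor_coeff (disc_monomial M) n)"
        unfolding step using Suc.IH m disc_monomial(1)[of M]
        by (subst taylor_coeff_add) (simp_all add: Hardy2_sel(1) taylor_coeff_cscale)
      also have "\<dots> = (\<lambda>n. if n < Suc M then taylor_coeff f n else 0)"
        using Suc.IH by (auto simp: disc_monomial(2) fun_eq_iff less_Suc_eq)
      finally show ?thesis .
    qed
    ultimately show ?case by blast
  qed
  have d: "f - p N \<in> vecs Hardy2" using f p by blast
  have coeff: "taylor_coeff (f - p N) = (\<lambda>n. if n < N then 0 else taylor_coeff f n)"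
    using taylor_coeff_diff[of f "p N"] f p[of N] by (auto simp: Hardy2_sel fun_eq_iff)
  have "(hnorm Hardy2 (f - p N))\<^sup>2 = (\<Sum>n. (cmod (taylor_coeff (f - p N) (n + N)))\<^sup>2)"
    unfolding hnorm_Hardy2_sq[OF d]
    using suminf_split_initial_segment[of "\<lambda>n. (cmod (taylor_coeff (f - p N) n))\<^sup>2" N] d
    by (simp add: Hardy2_sel(1)) (simp add: coeff)
  also have "\<dots> < r\<^sup>2" using N by (simp add: coeff)
  finally have "hnorm Hardy2 (f - p N) < r" by (rule power2_less_imp_less[OF _ less_imp_le[OF r]])
  then show ?thesis unfolding p_def by blast
qed

section \<open>Pointwise domination and shifts in the Hardy space\<close>

text \<open>Parseval's identity for a polynomial of degree less than \<open>N\<close>, with the integral over the circle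
  replaced by the sum over the \<open>N\<close>-th roots of unity.\<close>

lemma sum_roots_of_unity_square:
  fixes c :: "nat \<Rightarrow> complex"
  assumes N: "N > 0"
  defines "w \<equiv> \<lambda>k. exp (2 * of_real pi * \<i> * of_nat k / of_nat N) :: complex"
  shows "(\<Sum>k<N. (cmod (\<Sum>n<N. c n * w k ^ n))\<^sup>2) = real N * (\<Sum>n<N. (cmod (c n))\<^sup>2)"
proof -
  have cn: "w k * cnj (w k) = 1" for k
  proof -
    have "cmod (w k) = 1" by (simp add: w_def)
    then show ?thesis using complex_norm_square[of "w k"] by simp
  qed
  have pw: "w j ^ k = w k ^ j" for j k
    by (simp add: w_def mult_ac flip: exp_of_nat_mult)
  have root: "w j ^ N = 1" for j unfolding w_def using N by (intro complex_root_unity) simp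
  have lt: "(\<Sum>k<N. w k ^ n * cnj (w k) ^ m) = 0" if "m < n" "n < N" for m n
  proof -
    have "w k ^ n * cnj (w k) ^ m = w (n - m) ^ k" for k
    proof -
      have "w k ^ n * cnj (w k) ^ m = w k ^ (n - m) * (w k * cnj (w k)) ^ m"
        using that by (simp add: power_mult_distrib mult.assoc[symmetric] flip: power_add)
      then show ?thesis by (simp add: cn pw)
    qed
    moreover have "w (n - m) \<noteq> 1"
      using complex_root_unity_eq_1[of N "n - m"] N that by (auto simp: w_def dvd_imp_le dest!: dvd_imp_le)
    ultimately show ?thesis using geometric_sum[of "w (n - m)" N] root by simp
  qed
  have orth: "(\<Sum>k<N. w k ^ n * cnj (w k) ^ m) = (if n = m then of_nat N else 0)" if "n < N" "m < N" for n m
  proof -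
    consider "m < n" | "n = m" | "n < m" by linarith
    then show ?thesis
    proof cases
      case 1
      then show ?thesis using lt[OF 1 that(1)] by simp
    next
      case 2
      then show ?thesis by (simp add: cn flip: power_mult_distrib)
    next
      case 3
      have "(\<Sum>k<N. w k ^ n * cnj (w k) ^ m) = cnj (\<Sum>k<N. w k ^ m * cnj (w k) ^ n)"
        by (simp add: mult.commute)
      then show ?thesis using lt[OF 3 that(2)] 3 by simp
    qed
  qed
  have "complex_of_real (\<Sum>k<N. (cmod (\<Sum>n<N. c n * w k ^ n))\<^sup>2)
      = (\<Sum>k<N. (\<Sum>n<N. c n * w k ^ n) * cnj (\<Sum>m<N. c m * w k ^ m))"
    by (simp only: of_real_sum complex_norm_square)
  also have "\<dots> = (\<Sum>k<N. \<Sum>n<N. \<Sum>m<N. c n * cnj (c m) * (w k ^ n * cnj (w k) ^ m))"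
    by (simp add: sum_product mult_ac)
  also have "\<dots> = (\<Sum>n<N. \<Sum>k<N. \<Sum>m<N. c n * cnj (c m) * (w k ^ n * cnj (w k) ^ m))"
    by (rule sum.swap)
  also have "\<dots> = (\<Sum>n<N. \<Sum>m<N. \<Sum>k<N. c n * cnj (c m) * (w k ^ n * cnj (w k) ^ m))"
    by (intro sum.cong refl sum.swap)
  also have "\<dots> = (\<Sum>n<N. \<Sum>m<N. c n * cnj (c m) * (if n = m then of_nat N else 0))"
    by (intro sum.cong refl) (simp add: orth flip: sum_distrib_left)
  also have "\<dots> = (\<Sum>n<N. c n * cnj (c n) * of_nat N)"
    by (intro sum.cong refl) (simp add: if_distrib cong: if_cong)
  also have "\<dots> = complex_of_real (real N * (\<Sum>n<N. (cmod (c n))\<^sup>2))"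
    by (simp add: sum_distrib_left mult_ac flip: complex_norm_square)
  finally show ?thesis by (simp only: of_real_eq_iff)
qed

lemma summable_norm_circle:
  assumes f: "f \<in> disc_holomorphic" and r: "0 \<le> r" "r < 1"
  shows "summable (\<lambda>n. cmod (taylor_coeff f n * of_real r ^ n))"
proof -
  obtain \<rho> where \<rho>: "r < \<rho>" "\<rho> < 1" using dense[OF r(2)] by blast
  have "summable (\<lambda>n. taylor_coeff f n * of_real \<rho> ^ n)"
    using taylor_coeff_sums[OF f, of "of_real \<rho>"] \<rho> r by (simp add: sums_iff)
  then show ?thesis by (rule powser_insidea) (use \<rho> r in simp)
qed

lemma summable_circle:
  assumes f: "f \<in> disc_holomorphic" and r: "0 \<le> r" "r < 1"
  shows "summable (\<lambda>n. (cmod (taylor_coeff f n))\<^sup>2 * r ^ (2 * n))"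
proof -
  note c_abs = summable_norm_circle[OF assms]
  have "summable (\<lambda>n. (cmod (taylor_coeff f n * of_real r ^ n))\<^sup>2)"
  proof (rule summable_comparison_test_ev[OF _ c_abs])
    have "\<forall>\<^sub>F n in sequentially. cmod (taylor_coeff f n * of_real r ^ n) < 1"
      using summable_LIMSEQ_zero[OF c_abs] by (rule order_tendstoD) simp
    then show "\<forall>\<^sub>F n in sequentially. norm ((cmod (taylor_coeff f n * of_real r ^ n))\<^sup>2) \<le> cmod (taylor_coeff f n * of_real r ^ n)"
      by eventually_elim (simp add: power2_eq_square mult_left_le)
  qed
  moreover have "(cmod (taylor_coeff f n * of_real r ^ n))\<^sup>2 = (cmod (taylor_coeff f n))\<^sup>2 * r ^ (2 * n)" for n
    using r by (simp add: norm_mult norm_power power_mult_distrib mult.commute flip: power_mult)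
  ultimately show ?thesis by simp
qed

text \<open>The coefficients on the circle are absolutely summable, so the partial sum of length \<open>N\<close>
  approximates the function uniformly, with an error that tends to zero; for the partial sum the mean
  over the \<open>N\<close>-th roots of unity is known.\<close>

lemma circle_mean_tendsto:
  assumes f: "f \<in> disc_holomorphic" and r: "0 \<le> r" "r < 1"
  shows "(\<lambda>N. (\<Sum>k<N. (cmod (f (of_real r * exp (2 * of_real pi * \<i> * of_nat k / of_nat N))))\<^sup>2) / real N)
    \<longlonglongrightarrow> (\<Sum>n. (cmod (taylor_coeff f n))\<^sup>2 * r ^ (2 * n))" (is "?mean \<longlonglongrightarrow> ?L")
proof -
  define c where "c n = taylor_coeff f n * of_real r ^ n" for n
  have c_abs: "summable (\<lambda>n. cmod (c n))" unfolding c_def using f r by (rule summable_norm_circle)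
  define K where "K = (\<Sum>n. cmod (c n))"
  define t where "t N = (\<Sum>n. cmod (c (n + N)))" for N
  have t: "t \<longlonglongrightarrow> 0" unfolding t_def
    using suminf_exist_split2[OF c_abs] by simp
  have K_part: "(\<Sum>n<N. cmod (c n)) \<le> K" for N unfolding K_def using c_abs by (intro sum_le_suminf) auto
  define w where "w N k = (exp (2 * of_real pi * \<i> * of_nat k / of_nat N) :: complex)" for N k
  have w1: "cmod (w N k) = 1" for N k by (simp add: w_def)
  have close: "\<bar>(cmod (f (of_real r * w N k)))\<^sup>2 - (cmod (\<Sum>n<N. c n * w N k ^ n))\<^sup>2\<bar> \<le> t N * (2 * K)" for N k
  proof -
    have s: "(\<lambda>n. c n * w N k ^ n) sums f (of_real r * w N k)"
      using taylor_coeff_sums[OF f, of "of_real r * w N k"] r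
      by (simp add: norm_mult w1 c_def power_mult_distrib mult.assoc)
    have n: "cmod (c n * w N k ^ n) = cmod (c n)" for n by (simp add: norm_mult norm_power w1)
    have "f (of_real r * w N k) - (\<Sum>n<N. c n * w N k ^ n) = (\<Sum>n. c (n + N) * w N k ^ (n + N))"
      using suminf_split_initial_segment[of "\<lambda>n. c n * w N k ^ n" N] s by (simp add: sums_iff)
    also have "cmod \<dots> \<le> t N" unfolding t_def
      using summable_norm[of "\<lambda>n. c (n + N) * w N k ^ (n + N)"] summable_ignore_initial_segment[OF c_abs, of N]
      by (simp only: n)
    finally have d: "cmod (f (of_real r * w N k) - (\<Sum>n<N. c n * w N k ^ n)) \<le> t N" .
    have fK: "cmod (f (of_real r * w N k)) \<le> K"
      using summable_norm[of "\<lambda>n. c n * w N k ^ n"] c_abs s by (simp add: n K_def sums_iff)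
    have pK: "cmod (\<Sum>n<N. c n * w N k ^ n) \<le> K"
      using norm_sum[of "\<lambda>n. c n * w N k ^ n" "{..<N}"] K_part[of N] by (simp add: n)
    let ?x = "cmod (f (of_real r * w N k))" and ?y = "cmod (\<Sum>n<N. c n * w N k ^ n)"
    have "\<bar>?x\<^sup>2 - ?y\<^sup>2\<bar> = \<bar>?x - ?y\<bar> * (?x + ?y)"
      by (simp add: power2_eq_square square_diff_square_factored abs_mult mult.commute)
    also have "\<dots> \<le> t N * (2 * K)"
      using norm_triangle_ineq3[of "f (of_real r * w N k)" "\<Sum>n<N. c n * w N k ^ n"] d fK pK
      by (intro mult_mono) auto
    finally show ?thesis .
  qed
  have "(\<lambda>N. ?mean N - (\<Sum>n<N. (cmod (c n))\<^sup>2)) \<longlonglongrightarrow> 0"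
  proof (rule Lim_null_comparison)
    show "\<forall>\<^sub>F N in sequentially. norm (?mean N - (\<Sum>n<N. (cmod (c n))\<^sup>2)) \<le> t N * (2 * K)"
      using eventually_gt_at_top[of 0]
    proof eventually_elim
      case (elim N)
      have "(\<Sum>n<N. (cmod (c n))\<^sup>2) = (\<Sum>k<N. (cmod (\<Sum>n<N. c n * w N k ^ n))\<^sup>2) / real N"
        unfolding w_def using sum_roots_of_unity_square[OF elim, of c] elim by simp
      then have "?mean N - (\<Sum>n<N. (cmod (c n))\<^sup>2)
          = (\<Sum>k<N. (cmod (f (of_real r * w N k)))\<^sup>2 - (cmod (\<Sum>n<N. c n * w N k ^ n))\<^sup>2) / real N"
        by (simp add: w_def sum_subtractf diff_divide_distrib)
      also have "norm \<dots> \<le> (\<Sum>k<N. t N * (2 * K)) / real N"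
        unfolding real_norm_def abs_divide abs_of_nat
        by (intro divide_right_mono order_trans[OF sum_abs] sum_mono close) simp
      also have "\<dots> = t N * (2 * K)" using elim by simp
      finally show ?case .
    qed
    show "(\<lambda>N. t N * (2 * K)) \<longlonglongrightarrow> 0" using tendsto_mult_left_zero[OF t] by simp
  qed
  moreover have c_sq: "(cmod (c n))\<^sup>2 = (cmod (taylor_coeff f n))\<^sup>2 * r ^ (2 * n)" for n
    using r by (simp add: c_def norm_mult norm_power power_mult_distrib mult.commute flip: power_mult)
  moreover have "(\<lambda>N. \<Sum>n<N. (cmod (c n))\<^sup>2) \<longlonglongrightarrow> ?L"
    unfolding c_sq by (intro summable_LIMSEQ summable_circle f r)
  ultimately show ?thesis using tendsto_add by fastforce
qed

text \<open>The inequality passes to the means over each circle of radius less than 1, and then to the norms by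
  letting the radius tend to 1.\<close>

lemma hnorm_Hardy2_dominated:
  assumes f: "f \<in> vecs Hardy2" and p: "p \<in> disc_holomorphic" and q: "q \<in> disc_holomorphic"
    and le: "\<And>z. cmod z < 1 \<Longrightarrow> (cmod (p z))\<^sup>2 + (cmod (q z))\<^sup>2 \<le> (cmod (f z))\<^sup>2"
  shows "p \<in> vecs Hardy2" "q \<in> vecs Hardy2"
    "(hnorm Hardy2 p)\<^sup>2 + (hnorm Hardy2 q)\<^sup>2 \<le> (hnorm Hardy2 f)\<^sup>2"
proof -
  have fh: "f \<in> disc_holomorphic" and fs: "summable (\<lambda>n. (cmod (taylor_coeff f n))\<^sup>2)"
    using f by (auto simp: Hardy2_sel)
  define P where "P g r = (\<Sum>n. (cmod (taylor_coeff g n))\<^sup>2 * r ^ (2 * n))" for g and r :: real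
  have P_le: "P p r + P q r \<le> P f r" if r: "0 \<le> r" "r < 1" for r
  proof (rule LIMSEQ_le)
    let ?m = "\<lambda>g N. (\<Sum>k<N. (cmod (g (of_real r * exp (2 * of_real pi * \<i> * of_nat k / of_nat N))))\<^sup>2) / real N"
    show "(\<lambda>N. ?m p N + ?m q N) \<longlonglongrightarrow> P p r + P q r"
      unfolding P_def by (intro tendsto_add circle_mean_tendsto p q r)
    show "?m f \<longlonglongrightarrow> P f r" unfolding P_def by (intro circle_mean_tendsto fh r)
    have "?m p N + ?m q N \<le> ?m f N" for N
      unfolding add_divide_distrib[symmetric] sum.distrib[symmetric]
      using r by (intro divide_right_mono sum_mono le) (auto simp: norm_mult)
    then show "\<exists>N. \<forall>n\<ge>N. ?m p n + ?m q n \<le> ?m f n" by blast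
  qed
  have P_f: "P f r \<le> (hnorm Hardy2 f)\<^sup>2" if r: "0 \<le> r" "r < 1" for r
    unfolding P_def hnorm_Hardy2_sq[OF f]
  proof (rule suminf_le)
    show "(cmod (taylor_coeff f n))\<^sup>2 * r ^ (2 * n) \<le> (cmod (taylor_coeff f n))\<^sup>2" for n
      using r by (simp add: mult_left_le power_le_one)
  qed (use summable_circle[OF fh r] fs in auto)
  have part: "(\<Sum>n<N. (cmod (taylor_coeff p n))\<^sup>2) + (\<Sum>n<M. (cmod (taylor_coeff q n))\<^sup>2) \<le> (hnorm Hardy2 f)\<^sup>2" for N M
  proof -
    define F where "F r = (\<Sum>n<N. (cmod (taylor_coeff p n))\<^sup>2 * r ^ (2 * n)) + (\<Sum>n<M. (cmod (taylor_coeff q n))\<^sup>2 * r ^ (2 * n))" for r :: real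
    have "(F \<longlongrightarrow> F 1) (at_left 1)"
      unfolding F_def by (intro tendsto_intros)
    moreover have "\<forall>\<^sub>F r in at_left 1. F r \<le> (hnorm Hardy2 f)\<^sup>2"
    proof -
      have "F r \<le> (hnorm Hardy2 f)\<^sup>2" if r: "0 < r" "r < 1" for r
      proof -
        have "F r \<le> P p r + P q r"
          unfolding F_def P_def using r
          by (intro add_mono sum_le_suminf summable_circle p q) auto
        then show ?thesis using P_le[of r] P_f[of r] r by linarith
      qed
      then show ?thesis using eventually_at_left_real[of 0 "1::real"] by (auto elim!: eventually_mono)
    qed
    ultimately have "F 1 \<le> (hnorm Hardy2 f)\<^sup>2" by (intro tendsto_upperbound) auto
    then show ?thesis by (simp add: F_def)
  qed
  have "(\<Sum>n<N. (cmod (taylor_coeff p n))\<^sup>2) \<le> (hnorm Hardy2 f)\<^sup>2" for N using part[of N 0] by simp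
  then show pH: "p \<in> vecs Hardy2" by (rule Hardy2_coeffI(1)[OF p])
  have "(\<Sum>n<N. (cmod (taylor_coeff q n))\<^sup>2) \<le> (hnorm Hardy2 f)\<^sup>2" for N using part[of 0 N] by simp
  then show qH: "q \<in> vecs Hardy2" by (rule Hardy2_coeffI(1)[OF q])
  have "(\<Sum>n<N. (cmod (taylor_coeff q n))\<^sup>2) \<le> (hnorm Hardy2 f)\<^sup>2 - (\<Sum>n<M. (cmod (taylor_coeff p n))\<^sup>2)" for N M
    using part[of M N] by simp
  then have "(hnorm Hardy2 q)\<^sup>2 \<le> (hnorm Hardy2 f)\<^sup>2 - (\<Sum>n<M. (cmod (taylor_coeff p n))\<^sup>2)" for M
    by (rule Hardy2_coeffI(2)[OF q])
  then have "(\<Sum>n<M. (cmod (taylor_coeff p n))\<^sup>2) \<le> (hnorm Hardy2 f)\<^sup>2 - (hnorm Hardy2 q)\<^sup>2" for M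
    by (simp add: algebra_simps)
  then have "(hnorm Hardy2 p)\<^sup>2 \<le> (hnorm Hardy2 f)\<^sup>2 - (hnorm Hardy2 q)\<^sup>2" by (rule Hardy2_coeffI(2)[OF p])
  then show "(hnorm Hardy2 p)\<^sup>2 + (hnorm Hardy2 q)\<^sup>2 \<le> (hnorm Hardy2 f)\<^sup>2" by simp
qed

abbreviation shift :: "complex operator" where "shift \<equiv> mult_op (\<lambda>z. z)"

definition backward_shift :: "complex operator"
  where "backward_shift f = disc_series (\<lambda>n. taylor_coeff f (Suc n))"

lemma
  assumes f: "f \<in> vecs Hardy2"
  shows shift_Hardy2: "shift f \<in> vecs Hardy2"
    and hnorm_const_add_shift: "(hnorm Hardy2 (cscale c (disc_monomial 0) + shift f))\<^sup>2 = (cmod c)\<^sup>2 + (hnorm Hardy2 f)\<^sup>2"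
proof -
  have fh: "f \<in> disc_holomorphic" and fs: "summable (\<lambda>n. (cmod (taylor_coeff f n))\<^sup>2)"
    using f by (auto simp: Hardy2_sel)
  have sh: "shift f \<in> disc_holomorphic" using fh by (rule disc_holomorphic_closed)
  have "summable (\<lambda>n. (cmod (taylor_coeff (shift f) (Suc n)))\<^sup>2)"
    using fs by (simp add: taylor_coeff_shift[OF fh])
  then have "summable (\<lambda>n. (cmod (taylor_coeff (shift f) n))\<^sup>2)"
    using summable_Suc_iff[of "\<lambda>n. (cmod (taylor_coeff (shift f) n))\<^sup>2"] by blast
  then show s: "shift f \<in> vecs Hardy2" using sh by (simp add: Hardy2_sel)
  let ?g = "cscale c (disc_monomial 0) + shift f"
  have g: "?g \<in> vecs Hardy2" using s disc_monomial(1) by blast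
  have "taylor_coeff ?g = (\<lambda>n. c * taylor_coeff (disc_monomial 0) n + taylor_coeff (shift f) n)"
    using disc_monomial(1)[of 0] sh
    by (subst taylor_coeff_add) (simp_all add: Hardy2_sel(1) disc_holomorphic_closed taylor_coeff_cscale)
  then have co: "taylor_coeff ?g = case_nat c (taylor_coeff f)"
    by (auto simp: disc_monomial(2) taylor_coeff_shift[OF fh] fun_eq_iff split: nat.split)
  show "(hnorm Hardy2 ?g)\<^sup>2 = (cmod c)\<^sup>2 + (hnorm Hardy2 f)\<^sup>2"
    unfolding hnorm_Hardy2_sq[OF g] hnorm_Hardy2_sq[OF f]
    using suminf_split_head[of "\<lambda>n. (cmod (taylor_coeff ?g n))\<^sup>2"] g by (simp add: Hardy2_sel(1) co)
qed

lemma
  assumes f: "f \<in> vecs Hardy2"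
  shows backward_shift_Hardy2: "backward_shift f \<in> vecs Hardy2"
    and taylor_coeff_backward_shift: "taylor_coeff (backward_shift f) n = taylor_coeff f (Suc n)"
    and backward_shift_decomposition: "cscale (f 0) (disc_monomial 0) + shift (backward_shift f) = f"
proof -
  have fh: "f \<in> disc_holomorphic" and fs: "summable (\<lambda>n. (cmod (taylor_coeff f n))\<^sup>2)"
    using f by (auto simp: Hardy2_sel)
  then have "summable (\<lambda>n. (cmod (taylor_coeff f (Suc n)))\<^sup>2)"
    using summable_Suc_iff[of "\<lambda>n. (cmod (taylor_coeff f n))\<^sup>2"] by blast
  note b = disc_series_Hardy2[OF this, folded backward_shift_def]
  show m: "backward_shift f \<in> vecs Hardy2" by (rule b(1))
  show "taylor_coeff (backward_shift f) n = taylor_coeff f (Suc n)" by (simp add: b(2))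
  have mh: "backward_shift f \<in> disc_holomorphic" using m by (simp add: Hardy2_sel)
  show "cscale (f 0) (disc_monomial 0) + shift (backward_shift f) = f"
  proof (rule disc_holomorphic_eqI)
    have 1: "cscale (f 0) (disc_monomial 0) \<in> disc_holomorphic" "disc_monomial 0 \<in> disc_holomorphic"
      using disc_monomial(1)[of 0] by (auto simp: Hardy2_sel disc_holomorphic_closed)
    have 2: "shift (backward_shift f) \<in> disc_holomorphic" using mh by (rule disc_holomorphic_closed)
    show "cscale (f 0) (disc_monomial 0) + shift (backward_shift f) \<in> disc_holomorphic"
      using 1(1) 2 by (rule disc_holomorphic_closed)
    show "taylor_coeff (cscale (f 0) (disc_monomial 0) + shift (backward_shift f)) = taylor_coeff f"
      unfolding taylor_coeff_add[OF 1(1) 2] taylor_coeff_cscale[OF 1(2)] taylor_coeff_shift[OF mh] b(2)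
      by (auto simp: disc_monomial(2) fun_eq_iff taylor_coeff_0 split: nat.split)
  qed (fact fh)
qed

lemma backward_shift_linear:
  assumes f: "f \<in> vecs Hardy2"
  shows "g \<in> vecs Hardy2 \<Longrightarrow> backward_shift (f + g) = backward_shift f + backward_shift g"
    and "backward_shift (cscale c f) = cscale c (backward_shift f)"
proof -
  note X = backward_shift_Hardy2 and co = taylor_coeff_backward_shift
  have hol: "h \<in> disc_holomorphic" if "h \<in> vecs Hardy2" for h using that by (simp add: Hardy2_sel)
  show "backward_shift (f + g) = backward_shift f + backward_shift g" if g: "g \<in> vecs Hardy2"
  proof -
    have fg: "f + g \<in> vecs Hardy2" using f g by auto
    show ?thesis
      using X[OF fg] X[OF f] X[OF g] f g hol
      by (intro disc_holomorphic_eqI)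
        (simp_all add: co[OF fg] co[OF f] co[OF g] taylor_coeff_add disc_holomorphic_closed fun_eq_iff)
  qed
  have cf: "cscale c f \<in> vecs Hardy2" using f by auto
  show "backward_shift (cscale c f) = cscale c (backward_shift f)"
    using X[OF cf] X[OF f] f hol
    by (intro disc_holomorphic_eqI)
      (simp_all add: co[OF cf] co[OF f] taylor_coeff_cscale disc_holomorphic_closed fun_eq_iff)
qed

lemma hnorm_shift:
  assumes "f \<in> vecs Hardy2"
  shows "hnorm Hardy2 (shift f) = hnorm Hardy2 f"
proof -
  have "cscale 0 (disc_monomial 0) + shift f = shift f" by simp
  then have "(hnorm Hardy2 (shift f))\<^sup>2 = (hnorm Hardy2 f)\<^sup>2"
    using hnorm_const_add_shift[OF assms, of 0] by simp
  then show ?thesis using assms shift_Hardy2[OF assms] by (simp add: power2_eq_iff_nonneg)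
qed

section \<open>The de Branges--Rovnyak space of a non-extreme function\<close>

lemma Hinf1D:
  assumes "b \<in> Hinf1"
  shows "b \<in> disc_holomorphic" "cmod z < 1 \<Longrightarrow> cmod (b z) \<le> 1"
proof -
  show "b \<in> disc_holomorphic" using assms by (simp add: Hinf1_def Hinf_def)
  assume z: "cmod z < 1"
  have "bdd_above ((\<lambda>z. cmod (b z)) ` ball 0 1)"
    using assms by (auto simp: Hinf1_def Hinf_def bounded_iff bdd_above_def)
  then have "cmod (b z) \<le> Hinf_norm b" unfolding Hinf_norm_def using z by (intro cSUP_upper) auto
  then show "cmod (b z) \<le> 1" using assms by (simp add: Hinf1_def)
qed

text \<open>If \<open>b = (1 - t) f + t g\<close>, the parallelogram identity
  \<open>\<bar>b\<bar>\<^sup>2 + t (1 - t) \<bar>f - g\<bar>\<^sup>2 = (1 - t) \<bar>f\<bar>\<^sup>2 + t \<bar>g\<bar>\<^sup>2 \<le> 1\<close> shows that a multiple of \<open>f - g\<close> serves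
  as \<open>h\<close>.\<close>

lemma non_extreme_witness:
  assumes b: "b \<in> Hinf1" and "\<not> Hinf1_extreme b"
  obtains h where "h \<in> disc_holomorphic" "h \<noteq> 0"
    "\<And>z. cmod z < 1 \<Longrightarrow> (cmod (b z))\<^sup>2 + (cmod (h z))\<^sup>2 \<le> 1"
proof -
  obtain f g t where f: "f \<in> Hinf1" and g: "g \<in> Hinf1" and "f \<noteq> g" and t: "0 < t" "t < 1"
    and b_eq: "b = cscale (complex_of_real (1 - t)) f + cscale (complex_of_real t) g"
    using assms by (auto simp: Hinf1_extreme_def)
  note F = Hinf1D[OF f] and G = Hinf1D[OF g]
  define s where "s = sqrt (t * (1 - t))"
  have s: "s\<^sup>2 = t * (1 - t)" "s > 0" using t by (simp_all add: s_def)
  define h where "h = cscale (of_real s) (f + cscale (- 1) g)"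
  have "h \<in> disc_holomorphic" using F(1) G(1) unfolding h_def by (intro disc_holomorphic_closed)
  moreover have "h \<noteq> 0"
  proof
    assume "h = 0"
    then have hz: "h z = 0" for z by simp
    have "f z = g z" for z using s(2) hz[of z] by (simp add: h_def cscale_def)
    then show False using \<open>f \<noteq> g\<close> by (simp add: fun_eq_iff)
  qed
  moreover have "(cmod (b z))\<^sup>2 + (cmod (h z))\<^sup>2 \<le> 1" if z: "cmod z < 1" for z
  proof -
    have id: "(cmod (of_real (1 - t) * u + of_real t * v))\<^sup>2 + t * (1 - t) * (cmod (u - v))\<^sup>2
        = (1 - t) * (cmod u)\<^sup>2 + t * (cmod v)\<^sup>2" for u v
      unfolding cmod_power2 by (simp add: power2_eq_square algebra_simps)
    have "(cmod (b z))\<^sup>2 + (cmod (h z))\<^sup>2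
        = (cmod (of_real (1 - t) * f z + of_real t * g z))\<^sup>2 + t * (1 - t) * (cmod (f z - g z))\<^sup>2"
      using s by (simp add: b_eq h_def cscale_def norm_mult power_mult_distrib)
    also have "\<dots> = (1 - t) * (cmod (f z))\<^sup>2 + t * (cmod (g z))\<^sup>2" by (rule id)
    also have "\<dots> \<le> (1 - t) * 1 + t * 1"
      using F(2)[OF z] G(2)[OF z] t by (intro add_mono mult_left_mono power_le_one) auto
    finally show ?thesis by simp
  qed
  ultimately show ?thesis using that by blast
qed

locale non_extreme_symbol =
  fixes b h :: "complex \<Rightarrow> complex"
  assumes b_hol: "b \<in> disc_holomorphic" and h_hol: "h \<in> disc_holomorphic" and h_nz: "h \<noteq> 0"
    and b_h: "\<And>z. cmod z < 1 \<Longrightarrow> (cmod (b z))\<^sup>2 + (cmod (h z))\<^sup>2 \<le> 1"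
begin

abbreviation "one \<equiv> disc_monomial 0"
abbreviation "B \<equiv> mult_op b"

lemma column_contraction:
  assumes f: "f \<in> vecs Hardy2"
  shows "B f \<in> vecs Hardy2" "mult_op h f \<in> vecs Hardy2"
    "(hnorm Hardy2 (B f))\<^sup>2 + (hnorm Hardy2 (mult_op h f))\<^sup>2 \<le> (hnorm Hardy2 f)\<^sup>2"
proof -
  have fh: "f \<in> disc_holomorphic" using f by (simp add: Hardy2_sel)
  have le: "(cmod (B f z))\<^sup>2 + (cmod (mult_op h f z))\<^sup>2 \<le> (cmod (f z))\<^sup>2" if "cmod z < 1" for z
    using mult_right_mono[OF b_h[OF that], of "(cmod (f z))\<^sup>2"]
    by (simp add: mult_op_def norm_mult power_mult_distrib distrib_right)
  note hnorm_Hardy2_dominated[OF f disc_holomorphic_closed(5)[OF b_hol fh] disc_holomorphic_closed(5)[OF h_hol fh] le]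
  then show "B f \<in> vecs Hardy2" "mult_op h f \<in> vecs Hardy2"
    "(hnorm Hardy2 (B f))\<^sup>2 + (hnorm Hardy2 (mult_op h f))\<^sup>2 \<le> (hnorm Hardy2 f)\<^sup>2" by auto
qed

lemma B_contraction: "f \<in> vecs Hardy2 \<Longrightarrow> hnorm Hardy2 (B f) \<le> hnorm Hardy2 f"
  using column_contraction(3)[of f] by (intro power2_le_imp_le[OF _ Hardy2.hnorm_nonneg]) (smt (verit) zero_le_power2)+

lemma B_bounded: "bounded_operator Hardy2 B"
proof (rule Hardy2.bounded_operatorI)
  show "B f \<in> vecs Hardy2" if "f \<in> vecs Hardy2" for f using that by (rule column_contraction)
  show "hnorm Hardy2 (B f) \<le> 1 * hnorm Hardy2 f" if "f \<in> vecs Hardy2" for f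
    using B_contraction[OF that] by simp
qed (simp_all add: mult_op_def cscale_def fun_eq_iff algebra_simps)

lemma defect_sqrt:
  "positive_operator Hardy2 (defect_sqrt b)"
  "f \<in> vecs Hardy2 \<Longrightarrow> defect_sqrt b (defect_sqrt b f) = f - B (hadjoint Hardy2 B f)"
proof -
  let ?A = "\<lambda>f. B (hadjoint Hardy2 B f)"
  note BD = Hardy2.bounded_operatorD[OF B_bounded]
  note adj_in = Hardy2.hadjoint_in[OF B_bounded] and adj = Hardy2.ip_hadjoint[OF B_bounded]
  note adjD = Hardy2.bounded_operatorD[OF Hardy2.bounded_operator_hadjoint[OF B_bounded]]
  have contr: "hnorm Hardy2 (?A f) \<le> 1 * hnorm Hardy2 f" if "f \<in> vecs Hardy2" for f
    using B_contraction[OF adj_in[OF that]] Hardy2.hnorm_hadjoint_le[OF B_bounded that, of 1] B_contraction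
    by fastforce
  have A: "bounded_operator Hardy2 ?A"
    by (rule Hardy2.bounded_operatorI[OF _ _ _ contr]) (simp_all add: BD adjD)
  have sym: "ip Hardy2 (?A f) g = ip Hardy2 f (?A g)" if f: "f \<in> vecs Hardy2" and g: "g \<in> vecs Hardy2" for f g
  proof -
    have "ip Hardy2 (?A f) g = ip Hardy2 (hadjoint Hardy2 B f) (hadjoint Hardy2 B g)"
      by (rule adj[OF g adj_in[OF f], symmetric])
    also have "\<dots> = cnj (ip Hardy2 (hadjoint Hardy2 B g) (hadjoint Hardy2 B f))"
      by (rule Hardy2.ip_commute[OF adj_in[OF g] adj_in[OF f]])
    also have "\<dots> = cnj (ip Hardy2 (?A g) f)" by (simp only: adj[OF f adj_in[OF g]])
    also have "\<dots> = ip Hardy2 f (?A g)"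
      by (rule Hardy2.ip_commute[OF BD(1)[OF adj_in[OF g]] f, symmetric])
    finally show ?thesis .
  qed
  obtain R where "positive_operator Hardy2 R" "\<And>f. f \<in> vecs Hardy2 \<Longrightarrow> R (R f) = f - ?A f"
    using Hardy2.positive_square_root_exists[OF A _ sym] contr by auto
  then have "\<exists>R. positive_operator Hardy2 R \<and> (\<forall>f\<in>vecs Hardy2. R (R f) = f - ?A f)" by blast
  from someI_ex[OF this]
  show "positive_operator Hardy2 (defect_sqrt b)"
    "f \<in> vecs Hardy2 \<Longrightarrow> defect_sqrt b (defect_sqrt b f) = f - ?A f"
    unfolding defect_sqrt_def sqrt_operator_def by blast+
qed

lemma deBranges_Rovnyak_eq: "deBranges_Rovnyak b = operator_range Hardy2 (defect_sqrt b)"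
  by (simp add: deBranges_Rovnyak_def operator_range_def defect_lift_def[abs_def] range_lift_def[abs_def])

sublocale defect_operator Hardy2 "defect_sqrt b" B
proof unfold_locales
  show "bounded_operator Hardy2 (defect_sqrt b)" using defect_sqrt(1) by (simp add: positive_operator_def)
qed (fact B_bounded defect_sqrt)+

text \<open>Let \<open>k\<close> be the order of the zero of \<open>h\<close> at the origin. If \<open>f 0 = 1\<close>, then \<open>h f\<close> has the same
  \<open>k\<close>-th Taylor coefficient as \<open>h\<close>, which bounds \<open>\<parallel>h f\<parallel>\<close> from below; and \<open>\<parallel>b f\<parallel>\<^sup>2\<close> is at most
  \<open>\<parallel>f\<parallel>\<^sup>2 - \<parallel>h f\<parallel>\<^sup>2\<close>.\<close>

lemma norm_gap:
  "\<exists>\<delta>>0. \<forall>f\<in>vecs Hardy2. f 0 = 1 \<longrightarrow> (hnorm Hardy2 (B f))\<^sup>2 \<le> (hnorm Hardy2 f)\<^sup>2 - \<delta>"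
proof -
  have "\<exists>k. taylor_coeff h k \<noteq> 0"
  proof (rule ccontr)
    assume "\<not> (\<exists>k. taylor_coeff h k \<noteq> 0)"
    then have "taylor_coeff h = taylor_coeff 0" using taylor_coeff_eqI[of "\<lambda>n. 0" 0] by (auto simp: fun_eq_iff)
    then show False using disc_holomorphic_eqI[OF h_hol disc_holomorphic_closed(1)] h_nz by blast
  qed
  then obtain k where k: "taylor_coeff h k \<noteq> 0" and least: "\<And>i. i < k \<Longrightarrow> taylor_coeff h i = 0"
    using exists_least_iff[of "\<lambda>k. taylor_coeff h k \<noteq> 0"] by auto
  have "(hnorm Hardy2 (B f))\<^sup>2 \<le> (hnorm Hardy2 f)\<^sup>2 - (cmod (taylor_coeff h k))\<^sup>2"
    if f: "f \<in> vecs Hardy2" and f0: "f 0 = 1" for f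
  proof -
    \<comment> \<open>In Leibniz' rule only the term \<open>i = k\<close> survives.\<close>
    have "(deriv ^^ k) (\<lambda>w. h w * f w) 0 = (\<Sum>i = 0..k. of_nat (k choose i) * (deriv ^^ i) h 0 * (deriv ^^ (k - i)) f 0)"
      using h_hol f by (intro higher_deriv_mult[of _ "ball 0 1"]) (auto simp: Hardy2_sel disc_holomorphic_def)
    also have "\<dots> = (\<Sum>i\<in>{k}. of_nat (k choose i) * (deriv ^^ i) h 0 * (deriv ^^ (k - i)) f 0)"
      using least by (intro sum.mono_neutral_right) (auto simp: taylor_coeff_def)
    also have "\<dots> = (deriv ^^ k) h 0" by (simp add: f0)
    finally have "taylor_coeff (mult_op h f) k = taylor_coeff h k" by (simp add: taylor_coeff_def mult_op_def)
    then have "cmod (taylor_coeff h k) \<le> hnorm Hardy2 (mult_op h f)"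
      using coeff_le_hnorm[OF column_contraction(2)[OF f], of k] by simp
    then have "(cmod (taylor_coeff h k))\<^sup>2 \<le> (hnorm Hardy2 (mult_op h f))\<^sup>2" by (intro power_mono) auto
    then show ?thesis using column_contraction(3)[OF f] by linarith
  qed
  then show ?thesis using k by (intro exI[of _ "(cmod (taylor_coeff h k))\<^sup>2"]) simp
qed

lemma one: "one \<in> vecs Hardy2" "one 0 = 1" "hnorm Hardy2 one = 1"
proof -
  show m: "one \<in> vecs Hardy2" by (rule disc_monomial)
  show "one 0 = 1" by (simp add: disc_monomial_eq)
  have "(hnorm Hardy2 one)\<^sup>2 = 1"
    unfolding hnorm_Hardy2_sq[OF m] disc_monomial(2)
    using suminf_finite[of "{0}" "\<lambda>n. (cmod (if n = (0::nat) then 1 else 0))\<^sup>2"] by simp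
  then show "hnorm Hardy2 one = 1" using Hardy2.hnorm_nonneg[OF m] by (simp add: power2_eq_1_iff)
qed

lemma hnorm_decomposition:
  assumes f: "f \<in> vecs Hardy2"
  shows "(hnorm Hardy2 f)\<^sup>2 = (cmod (f 0))\<^sup>2 + (hnorm Hardy2 (backward_shift f))\<^sup>2"
  using hnorm_const_add_shift[OF backward_shift_Hardy2[OF f], of "f 0"] backward_shift_decomposition[OF f] by simp

text \<open>If the space were trivial, then \<open>B B\<^sup>* = I\<close>, and \<open>g = B\<^sup>* 1\<close> would satisfy \<open>b g = 1\<close> and
  \<open>\<parallel>b g\<parallel> = \<parallel>g\<parallel>\<close>. The second equality forces \<open>h g = 0\<close>, the first one then \<open>h = 0\<close>.\<close>

lemma range_nontrivial: "\<exists>u\<in>vecs Rng. u \<noteq> 0"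
proof (rule ccontr)
  assume "\<not> ?thesis"
  then have R0: "defect_sqrt b f = 0" if "f \<in> vecs Hardy2" for f using that by (auto simp: operator_range_sel)
  let ?g = "hadjoint Hardy2 B one"
  have g: "?g \<in> vecs Hardy2" by (rule B_adj(1)[OF one(1)])
  have "one - B ?g = 0" using R_square[OF one(1)] R0 RD(1) one(1) by simp
  then have Bg: "B ?g = one" by simp
  have "(hnorm Hardy2 ?g)\<^sup>2 = 1" using hnorm_defect_sq[OF one(1)] R0[OF one(1)] one(3) by simp
  then have "hnorm Hardy2 (mult_op h ?g) = 0" using column_contraction(3)[OF g] by (simp add: Bg one(3))
  then have hg: "mult_op h ?g = 0" using Hardy2.hnorm_eq_0_iff column_contraction(2)[OF g] by blast
  have "h z = 0" for z
  proof (cases "cmod z < 1")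
    case True
    then have "b z * ?g z = 1" using fun_cong[OF Bg, of z] by (simp add: mult_op_def disc_monomial_eq)
    moreover have "h z * ?g z = 0" using fun_cong[OF hg, of z] by (simp add: mult_op_def)
    ultimately show ?thesis by auto
  qed (use h_hol in \<open>simp add: disc_holomorphic_def\<close>)
  then show False using h_nz by (auto simp: fun_eq_iff)
qed

lemma range_Hardy2: "u \<in> vecs Rng \<Longrightarrow> u \<in> vecs Hardy2"
  using vecs_range_subset by blast

text \<open>From \<open>f + b (z g) = f 0 + z (X f + b g)\<close> one gets \<open>\<parallel>X f + b g\<parallel> \<le> \<parallel>f + b (z g)\<parallel>\<close>, while
  \<open>\<parallel>z g\<parallel> = \<parallel>g\<parallel>\<close>; so every bound in the variational description of \<open>f\<close> is one for \<open>X f\<close>.\<close>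

lemma backward_shift_range:
  assumes f: "f \<in> vecs Rng"
  shows "backward_shift f \<in> vecs Rng" "hnorm Rng (backward_shift f) \<le> hnorm Rng f"
proof -
  note fH = range_Hardy2[OF f]
  have X: "backward_shift f \<in> vecs Hardy2" by (rule backward_shift_Hardy2[OF fH])
  have bound: "(hnorm Hardy2 (backward_shift f + B g))\<^sup>2 \<le> (hnorm Hardy2 g)\<^sup>2 + (hnorm Rng f)\<^sup>2" if g: "g \<in> vecs Hardy2" for g
  proof -
    have "f + B (shift g) = (cscale (f 0) one + shift (backward_shift f)) + B (shift g)"
      by (simp only: backward_shift_decomposition[OF fH])
    also have "\<dots> = cscale (f 0) one + shift (backward_shift f + B g)"
      by (auto simp: mult_op_def fun_eq_iff algebra_simps)
    finally have "(hnorm Hardy2 (f + B (shift g)))\<^sup>2 = (cmod (f 0))\<^sup>2 + (hnorm Hardy2 (backward_shift f + B g))\<^sup>2"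
      using hnorm_const_add_shift[OF Hardy2.vecs_closed(2)[OF X column_contraction(1)[OF g]]] by presburger
    moreover have "(hnorm Hardy2 (f + B (shift g)))\<^sup>2 \<le> (hnorm Hardy2 g)\<^sup>2 + (hnorm Rng f)\<^sup>2"
      using hnorm_add_range_le[OF f shift_Hardy2[OF g]] by (simp only: hnorm_shift[OF g])
    ultimately show ?thesis using zero_le_power2[of "cmod (f 0)"] by argo
  qed
  show r: "backward_shift f \<in> vecs Rng" using X bound by (rule in_rangeI)
  have "(hnorm Rng (backward_shift f))\<^sup>2 \<le> (hnorm Rng f)\<^sup>2" using X bound by (rule in_rangeI)
  then show "hnorm Rng (backward_shift f) \<le> hnorm Rng f" using rng.hnorm_nonneg[OF f] by (rule power2_le_imp_le)
qed

lemma symbol_Hardy2: "b \<in> vecs Hardy2"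
proof -
  have "B one = b" using b_hol by (auto simp: mult_op_def disc_monomial_eq fun_eq_iff disc_holomorphic_def)
  then show ?thesis using column_contraction(1)[OF one(1)] by simp
qed

text \<open>The identity \<open>b (1 + z g) = b 0 + z (X b + b g)\<close> reduces the claim to the norm gap for the function
  \<open>1 + z g\<close>, whose value at the origin is 1. The number \<open>\<delta>\<close> is what makes the forward shift
  bounded.\<close>

lemma backward_shift_symbol:
  obtains \<delta> where "\<delta> > 0" "backward_shift b \<in> vecs Rng"
    "(hnorm Rng (backward_shift b))\<^sup>2 \<le> 1 - (cmod (b 0))\<^sup>2 - \<delta>"
proof -
  obtain \<delta> where \<delta>: "\<delta> > 0" and gap: "\<And>f. f \<in> vecs Hardy2 \<Longrightarrow> f 0 = 1 \<Longrightarrow> (hnorm Hardy2 (B f))\<^sup>2 \<le> (hnorm Hardy2 f)\<^sup>2 - \<delta>"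
    using norm_gap by blast
  have X: "backward_shift b \<in> vecs Hardy2" by (rule backward_shift_Hardy2[OF symbol_Hardy2])
  have bound: "(hnorm Hardy2 (backward_shift b + B g))\<^sup>2 \<le> (hnorm Hardy2 g)\<^sup>2 + (1 - (cmod (b 0))\<^sup>2 - \<delta>)"
    if g: "g \<in> vecs Hardy2" for g
  proof -
    define u where "u = cscale 1 one + shift g"
    have u: "u \<in> vecs Hardy2" "u 0 = 1"
      using one shift_Hardy2[OF g] by (auto simp: u_def cscale_def mult_op_def)
    have un: "(hnorm Hardy2 u)\<^sup>2 = 1 + (hnorm Hardy2 g)\<^sup>2"
      unfolding u_def using hnorm_const_add_shift[OF g, of 1] by simp
    have "B u = b + shift (B g)"
      using b_hol by (auto simp: u_def mult_op_def disc_monomial_eq fun_eq_iff cscale_def disc_holomorphic_def algebra_simps)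
    also have "\<dots> = (cscale (b 0) one + shift (backward_shift b)) + shift (B g)"
      by (simp only: backward_shift_decomposition[OF symbol_Hardy2])
    also have "\<dots> = cscale (b 0) one + shift (backward_shift b + B g)"
      by (auto simp: mult_op_def fun_eq_iff algebra_simps)
    finally have "(hnorm Hardy2 (B u))\<^sup>2 = (cmod (b 0))\<^sup>2 + (hnorm Hardy2 (backward_shift b + B g))\<^sup>2"
      using hnorm_const_add_shift[OF Hardy2.vecs_closed(2)[OF X column_contraction(1)[OF g]]] by presburger
    then show ?thesis using gap[OF u] un by argo
  qed
  show ?thesis using that[OF \<delta> in_rangeI[OF X bound]] .
qed

text \<open>With \<open>c = g 0\<close> one has \<open>z f + b g = c b 0 + z (f + c X b + b X g)\<close>. Hence \<open>\<parallel>z f + b g\<parallel>\<^sup>2 - \<parallel>g\<parallel>\<^sup>2\<close> is at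
  most \<open>\<parallel>f + c X b\<parallel>\<^sup>2 - \<bar>c\<bar>\<^sup>2 (1 - \<bar>b 0\<bar>\<^sup>2)\<close>, the first norm being the one of the range space. By
  Young's inequality this is bounded uniformly in \<open>c\<close>, since \<open>\<parallel>X b\<parallel>\<^sup>2\<close> lies below
  \<open>1 - \<bar>b 0\<bar>\<^sup>2\<close> by the margin \<open>\<delta>\<close>.\<close>

lemma shift_range:
  "\<exists>C. \<forall>f\<in>vecs Rng. shift f \<in> vecs Rng \<and> hnorm Rng (shift f) \<le> C * hnorm Rng f"
proof -
  obtain \<delta> where \<delta>: "\<delta> > 0" and Xb: "backward_shift b \<in> vecs Rng"
    and Xb_norm: "(hnorm Rng (backward_shift b))\<^sup>2 \<le> 1 - (cmod (b 0))\<^sup>2 - \<delta>" by (rule backward_shift_symbol)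
  define \<beta> where "\<beta> = 1 - (cmod (b 0))\<^sup>2"
  have \<beta>: "\<beta> \<le> 1" by (simp add: \<beta>_def)
  let ?y = "hnorm Rng (backward_shift b)"
  have y: "?y \<ge> 0" using rng.hnorm_nonneg[OF Xb] .
  \<comment> \<open>The weight in Young's inequality is \<open>\<delta>\<close> itself; this suffices as \<open>\<beta> \<le> 1\<close>.\<close>
  have absorb: "(1 + \<delta>) * ?y\<^sup>2 \<le> \<beta>"
  proof -
    have "(1 + \<delta>) * ?y\<^sup>2 \<le> (1 + \<delta>) * (\<beta> - \<delta>)" using Xb_norm \<delta> by (intro mult_left_mono) (auto simp: \<beta>_def)
    also have "\<dots> = \<beta> - \<delta> * (1 - \<beta>) - \<delta> * \<delta>" by (simp add: algebra_simps)
    also have "\<dots> \<le> \<beta>" using \<delta> \<beta> mult_nonneg_nonneg[of \<delta> "1 - \<beta>"] mult_nonneg_nonneg[of \<delta> \<delta>] by linarith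
    finally show ?thesis .
  qed
  have main: "shift f \<in> vecs Rng \<and> (hnorm Rng (shift f))\<^sup>2 \<le> (1 + 1 / \<delta>) * (hnorm Rng f)\<^sup>2" if f: "f \<in> vecs Rng" for f
  proof -
    note fH = range_Hardy2[OF f]
    let ?x = "hnorm Rng f"
    have x: "?x \<ge> 0" using rng.hnorm_nonneg[OF f] .
    have bound: "(hnorm Hardy2 (shift f + B g))\<^sup>2 \<le> (hnorm Hardy2 g)\<^sup>2 + (1 + 1 / \<delta>) * ?x\<^sup>2" if g: "g \<in> vecs Hardy2" for g
    proof -
      define c where "c = g 0"
      let ?Xg = "backward_shift g"
      have Xg: "?Xg \<in> vecs Hardy2" by (rule backward_shift_Hardy2[OF g])
      have v: "f + cscale c (backward_shift b) \<in> vecs Rng" using f Xb by blast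
      let ?w = "(f + cscale c (backward_shift b)) + B ?Xg"
      have w: "?w \<in> vecs Hardy2" using range_Hardy2[OF v] column_contraction(1)[OF Xg] by (rule Hardy2.vecs_closed)
      have "shift f + B g = shift f + B (cscale c one + shift ?Xg)"
        unfolding c_def by (simp only: backward_shift_decomposition[OF g])
      also have "\<dots> = shift f + cscale c b + shift (B ?Xg)"
        using b_hol by (auto simp: mult_op_def disc_monomial_eq fun_eq_iff cscale_def disc_holomorphic_def algebra_simps)
      also have "\<dots> = shift f + cscale c (cscale (b 0) one + shift (backward_shift b)) + shift (B ?Xg)"
        by (simp only: backward_shift_decomposition[OF symbol_Hardy2])
      also have "\<dots> = cscale (c * b 0) one + shift ?w"
        by (auto simp: mult_op_def fun_eq_iff cscale_def algebra_simps)
      finally have split: "(hnorm Hardy2 (shift f + B g))\<^sup>2 = (cmod (c * b 0))\<^sup>2 + (hnorm Hardy2 ?w)\<^sup>2"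
        using hnorm_const_add_shift[OF w] by presburger
      have w_le: "(hnorm Hardy2 ?w)\<^sup>2 \<le> (hnorm Hardy2 ?Xg)\<^sup>2 + (hnorm Rng (f + cscale c (backward_shift b)))\<^sup>2"
        using hnorm_add_range_le[OF v Xg] .
      have g_norm: "(hnorm Hardy2 g)\<^sup>2 = (cmod c)\<^sup>2 + (hnorm Hardy2 ?Xg)\<^sup>2"
        unfolding c_def by (rule hnorm_decomposition[OF g])
      have "(hnorm Rng (f + cscale c (backward_shift b)))\<^sup>2 \<le> (?x + cmod c * ?y)\<^sup>2"
        using rng.hnorm_triangle[OF f rng.vecs_closed(4)[OF Xb]] rng.hnorm_nonneg[OF v] rng.hnorm_cscale[OF Xb]
        by (intro power_mono) auto
      also have "\<dots> \<le> (1 + 1 / \<delta>) * ?x\<^sup>2 + (cmod c)\<^sup>2 * ((1 + \<delta>) * ?y\<^sup>2)"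
      proof -
        have "0 \<le> (?x - \<delta> * (cmod c * ?y))\<^sup>2 / \<delta>" using \<delta> by simp
        also have "\<dots> = ?x\<^sup>2 / \<delta> - 2 * ?x * (cmod c * ?y) + \<delta> * (cmod c * ?y)\<^sup>2"
          using \<delta> by (simp add: power2_eq_square divide_simps) (simp add: algebra_simps)
        finally show ?thesis by (simp add: power2_sum power_mult_distrib algebra_simps)
      qed
      also have "\<dots> \<le> (1 + 1 / \<delta>) * ?x\<^sup>2 + (cmod c)\<^sup>2 * \<beta>"
        using absorb by (intro add_left_mono mult_left_mono) auto
      finally have "(hnorm Rng (f + cscale c (backward_shift b)))\<^sup>2 \<le> (1 + 1 / \<delta>) * ?x\<^sup>2 + (cmod c)\<^sup>2 * \<beta>" .
      moreover have "(cmod c)\<^sup>2 * \<beta> = (cmod c)\<^sup>2 - (cmod (c * b 0))\<^sup>2"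
        by (simp add: \<beta>_def norm_mult power_mult_distrib algebra_simps)
      ultimately show ?thesis using split w_le g_norm by argo
    qed
    show ?thesis using in_rangeI[OF shift_Hardy2[OF fH] bound] by blast
  qed
  have "hnorm Rng (shift f) \<le> sqrt (1 + 1 / \<delta>) * hnorm Rng f" if f: "f \<in> vecs Rng" for f
  proof (rule power2_le_imp_le)
    show "(hnorm Rng (shift f))\<^sup>2 \<le> (sqrt (1 + 1 / \<delta>) * hnorm Rng f)\<^sup>2"
      using main[OF f] \<delta> by (simp add: power_mult_distrib)
    show "0 \<le> sqrt (1 + 1 / \<delta>) * hnorm Rng f" using \<delta> rng.hnorm_nonneg[OF f] by simp
  qed
  then show ?thesis using main by blast
qed

lemma shift_dBR_adjoint_cowen_douglas:
  "hadjoint (deBranges_Rovnyak b) (shift_dBR b) \<in> cowen_douglas 1 (ball 0 1) (deBranges_Rovnyak b)"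
proof -
  obtain C where shift_in: "\<And>f. f \<in> vecs Rng \<Longrightarrow> shift f \<in> vecs Rng"
    and shift_bound: "\<And>f. f \<in> vecs Rng \<Longrightarrow> hnorm Rng (shift f) \<le> C * hnorm Rng f" using shift_range by blast
  have S_eq: "shift_dBR b f = shift f" if "f \<in> vecs Rng" for f
    using that by (simp add: shift_dBR_def deBranges_Rovnyak_eq)
  interpret backward_shift_space Rng "shift_dBR b" backward_shift 1
  proof unfold_locales
    show "separable_space (htopology Rng)"
      using disc_monomial(1) disc_monomials_total by (rule range_separable)
    show "\<exists>f\<in>vecs Rng. f \<noteq> 0" by (rule range_nontrivial)
    show "vecs Rng \<subseteq> disc_holomorphic" using range_Hardy2 by (auto simp: Hardy2_sel)
    show "bounded_operator Rng (shift_dBR b)"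
    proof (rule rng.bounded_operatorI[where C = C])
      fix f g c assume f: "f \<in> vecs Rng" and g: "g \<in> vecs Rng"
      show "shift_dBR b (f + g) = shift_dBR b f + shift_dBR b g"
        unfolding S_eq[OF f] S_eq[OF g] S_eq[OF rng.vecs_closed(2)[OF f g]]
        by (simp add: mult_op_def fun_eq_iff algebra_simps)
      show "shift_dBR b (cscale c f) = cscale c (shift_dBR b f)"
        unfolding S_eq[OF f] S_eq[OF rng.vecs_closed(4)[OF f]]
        by (simp add: mult_op_def cscale_def fun_eq_iff)
    qed (simp_all only: S_eq shift_in shift_bound)
    show "bounded_operator Rng backward_shift"
      by (rule rng.bounded_operatorI[where C = 1])
        (simp_all add: backward_shift_range backward_shift_linear range_Hardy2)
    fix f assume f: "f \<in> vecs Rng"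
    note fH = range_Hardy2[OF f]
    show "hnorm Rng (backward_shift f) \<le> hnorm Rng f" using f by (rule backward_shift_range)
    show "shift_dBR b f z = z * f z" for z unfolding S_eq[OF f] by (simp add: mult_op_def)
    show "f z = f 0 + z * backward_shift f z" if "cmod z < 1" for z
      using fun_cong[OF backward_shift_decomposition[OF fH], of z] that
      by (simp add: mult_op_def cscale_def disc_monomial_eq)
    have "cmod (f 0) \<le> hnorm Hardy2 f" using coeff_le_hnorm[OF fH, of 0] by (simp add: taylor_coeff_0)
    also have "(hnorm Hardy2 f)\<^sup>2 \<le> (hnorm Rng f)\<^sup>2"
      using hnorm_add_range_le[OF f Hardy2.vecs_closed(1)] Hardy2.bounded_operator_zero[OF B_bounded] by simp
    then have "hnorm Hardy2 f \<le> hnorm Rng f" using rng.hnorm_nonneg[OF f] by (rule power2_le_imp_le)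
    finally show "cmod (f 0) \<le> 1 * hnorm Rng f" by simp
  qed
  show ?thesis using S_adj_cowen_douglas unfolding deBranges_Rovnyak_eq .
qed

end

theorem theorem2p2:
  fixes b :: "complex \<Rightarrow> complex"
  assumes "b \<in> Hinf1"
    and "\<not> Hinf1_extreme b"
  shows "hadjoint (deBranges_Rovnyak b) (shift_dBR b)
           \<in> cowen_douglas 1 (ball 0 1) (deBranges_Rovnyak b)"
proof -
  obtain h where "h \<in> disc_holomorphic" "h \<noteq> 0"
    "\<And>z. cmod z < 1 \<Longrightarrow> (cmod (b z))\<^sup>2 + (cmod (h z))\<^sup>2 \<le> 1"
    using non_extreme_witness[OF assms] by blast
  then interpret non_extreme_symbol b h
    using Hinf1D(1)[OF assms(1)] by unfold_locales
  show ?thesis by (rule shift_dBR_adjoint_cowen_douglas)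
qed

end
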